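(* Let $m\in\{1,\dots,M\}$ and let Model $m$ be correctly specified, i.e. there is $\theta_{m,0}\in\mathrm{Int}(\Theta_m)$ with $\mathbf{\Sigma}_0=\mathbf{\Sigma}_m(\theta_{m,0})$. Assume conditions [A], [B] and [C1] given in the context, and suppose that $$\log\pi_{m,n}(\hat\theta_{m,n})=\log\pi_{m,n}(\theta_{m,0})+o_p(1)\qquad(n\to\infty).$$ Then, as $n\to\infty$, $$\log\left(\int_{\Theta_m}\exp\{\mathbb{H}_{m,n}(\theta_m)\}\,\pi_{m,n}(\theta_m)\,d\theta_m\right)=\mathbb{H}_{m,n}(\hat\theta_{m,n})+\frac{q_m}{2}\log 2\pi-\frac12\log\det\bigl\{-\partial^2_{\theta_m}\mathbb{H}_{m,n}(\hat\theta_{m,n})\bigr\}+\log\pi_{m,n}(\hat\theta_{m,n})+o_p(1)$$ on the event $J_{m,n}=\{-n^{-1}\partial^2_{\theta_m}\mathbb{H}_{m,n}(\hat\theta_{m,n})>0\}$ (that is, the difference of the two sides without the $o_p(1)$ term, multiplied by the indicator of $J_{m,n}$, converges to $0$ in probability).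
   Context: **True model.** On a stochastic basis $(\Omega,\mathscr F,\{\mathscr F_t\},\mathbf P)$ satisfying the usual conditions, let $W_{1,t},\dots,W_{4,t}$ be independent standard Wiener processes of dimensions $r_1,\dots,r_4$. Fix $p_1,p_2\ge 1$, $k_1\le p_1$, $k_2\le p_2$, and put $p=p_1+p_2$. Let $$\mathbb X_{1,0,t}=\mathbf\Lambda_{x_1,0}\xi_{0,t}+\delta_{0,t},\quad \mathbb X_{2,0,t}=\mathbf\Lambda_{x_2,0}\eta_{0,t}+\varepsilon_{0,t},\quad \eta_{0,t}=\mathbf B_0\eta_{0,t}+\mathbf\Gamma_0\xi_{0,t}+\zeta_{0,t},$$ where $d\xi_{0,t}=B_1(\xi_{0,t})dt+\mathbf S_{1,0}dW_{1,t}$, $\xi_{0,0}=c_1\in\mathbb R^{k_1}$; $d\delta_{0,t}=B_2(\delta_{0,t})dt+\mathbf S_{2,0}dW_{2,t}$, $\delta_{0,0}=c_2\in\mathbb R^{p_1}$; $d\varepsilon_{0,t}=B_3(\varepsilon_{0,t})dt+\mathbf S_{3,0}dW_{3,t}$, $\varepsilon_{0,0}=c_3\in\mathbb R^{p_2}$; $d\zeta_{0,t}=B_4(\zeta_{0,t})dt+\mathbf S_{4,0}dW_{4,t}$, $\zeta_{0,0}=c_4\in\mathbb R^{k_2}$. Here $B_1:\mathbb R^{k_1}\to\mathbb R^{k_1}$, $B_2:\mathbb R^{p_1}\to\mathbb R^{p_1}$, $B_3:\mathbb R^{p_2}\to\mathbb R^{p_2}$, $B_4:\mathbb R^{k_2}\to\mathbb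 R^{k_2}$; $\mathbf S_{1,0}\in\mathbb R^{k_1\times r_1}$, $\mathbf S_{2,0}\in\mathbb R^{p_1\times r_2}$, $\mathbf S_{3,0}\in\mathbb R^{p_2\times r_3}$, $\mathbf S_{4,0}\in\mathbb R^{k_2\times r_4}$, $\mathbf\Lambda_{x_1,0}\in\mathbb R^{p_1\times k_1}$, $\mathbf\Lambda_{x_2,0}\in\mathbb R^{p_2\times k_2}$, $\mathbf\Gamma_0\in\mathbb R^{k_2\times k_1}$ and $\mathbf B_0\in\mathbb R^{k_2\times k_2}$ (with zero diagonal) are constant matrices. Put $\mathbf\Psi_0=\mathbb I_{k_2}-\mathbf B_0$, $\mathbf\Sigma_{\xi\xi,0}=\mathbf S_{1,0}\mathbf S_{1,0}^\top$, $\mathbf\Sigma_{\delta\delta,0}=\mathbf S_{2,0}\mathbf S_{2,0}^\top$, $\mathbf\Sigma_{\varepsilon\varepsilon,0}=\mathbf S_{3,0}\mathbf S_{3,0}^\top$, $\mathbf\Sigma_{\zeta\zeta,0}=\mathbf S_{4,0}\mathbf S_{4,0}^\top$. It is assumed that $\mathbf\Lambda_{x_1,0}$ has full column rank, $\mathbf\Psi_0$ is non-singular, and $\mathbf\Sigma_{\delta\delta,0},\mathbf\Sigma_{\varepsilon\varepsilon,0}$ are positive definite. Define $\mathbf\Sigma_0=\begin{pmatrix}\mathbf\Sigma_0^{11}&\mathbf\Sigma_0^{12}\\ \mathbf\Sigma_0^{12\top}&\mathbf\Sigma_0^{22}\end{pmatrix}$ with $\mathbf\Sigma_0^{11}=\mathbf\Lambda_{x_1,0}\mathbf\Sigma_{\xi\xi,0}\mathbf\Lambda_{x_1,0}^\top+\mathbf\Sigma_{\delta\delta,0}$,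 $\mathbf\Sigma_0^{12}=\mathbf\Lambda_{x_1,0}\mathbf\Sigma_{\xi\xi,0}\mathbf\Gamma_0^\top(\mathbf\Psi_0^{-1})^\top\mathbf\Lambda_{x_2,0}^\top$, $\mathbf\Sigma_0^{22}=\mathbf\Lambda_{x_2,0}\mathbf\Psi_0^{-1}(\mathbf\Gamma_0\mathbf\Sigma_{\xi\xi,0}\mathbf\Gamma_0^\top+\mathbf\Sigma_{\zeta\zeta,0})(\mathbf\Psi_0^{-1})^\top\mathbf\Lambda_{x_2,0}^\top+\mathbf\Sigma_{\varepsilon\varepsilon,0}$. **Observations.** $\mathbb X_t=(\mathbb X_{1,0,t}^\top,\mathbb X_{2,0,t}^\top)^\top$ is observed at $t_i^n=ih_n$, $i=0,\dots,n$, with $h_n=T/n$ and $T>0$ fixed; $\Delta_i\mathbb X=\mathbb X_{t_i^n}-\mathbb X_{t_{i-1}^n}$. **Parametric models.** For $m=1,\dots,M$, Model $m$ has parameter $\theta_m\in\Theta_m$, where $\Theta_m\subset\mathbb R^{q_m}$ is convex and compact with locally Lipschitz boundary. It has the same structure, dimensions, drifts $B_i$, Wiener processes $W_{i}$ and initial values $c_i$ as the true model, with the constant matrices replaced by $\theta_m$-dependent matrices $\mathbf\Lambda^\theta_{x_1,m},\mathbf\Lambda^\theta_{x_2,m},\mathbf B^\theta_m$ (zero diagonal), $\mathbf\Gamma^\theta_m,\mathbf S^\theta_{1,m},\dots,\mathbf S^\theta_{4,m}$ of the same sizes. With $\mathbf\Psi^\theta_m,\mathbf\Sigma^\theta_{\xi\xi,m},\mathbf\Sigma^\theta_{\delta\delta,m},\mathbf\Sigma^\theta_{\varepsilon\varepsilon,m},\mathbf\Sigma^\theta_{\zeta\zeta,m}$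 defined correspondingly, $\mathbf\Lambda^\theta_{x_1,m}$ has full column rank, $\mathbf\Psi^\theta_m$ is non-singular, $\mathbf\Sigma^\theta_{\delta\delta,m},\mathbf\Sigma^\theta_{\varepsilon\varepsilon,m}$ are positive definite, and $\mathbf\Sigma_m(\theta_m)$ is defined by the same formula as $\mathbf\Sigma_0$ with these matrices. The map $\theta_m\mapsto\mathbf\Sigma_m(\theta_m)$ is three times continuously differentiable on (a neighbourhood of) $\Theta_m$. **Notation.** $A[B]=\mathrm{tr}(AB^\top)$; $A^{\otimes2}=AA^\top$; $|A|=\sqrt{\mathrm{tr}(AA^\top)}$; $A>0$ means positive definite; $\mathrm{vech}$ is half-vectorization; $\partial^2_{\theta_m}$ is the Hessian. $C^k_\uparrow(\mathbb R^d)$ is the space of $C^k$ functions which, together with all derivatives up to order $k$, are of polynomial growth. **Quasi-likelihood.** $$\mathbb L_{m,n}(\theta_m)=\prod_{i=1}^n\frac{1}{(2\pi h_n)^{p/2}\det\mathbf\Sigma_m(\theta_m)^{1/2}}\exp\Bigl(-\frac{1}{2h_n}\mathbf\Sigma_m(\theta_m)^{-1}\bigl[(\Delta_i\mathbb X)^{\otimes2}\bigr]\Bigr),\qquad \mathbb H_{m,n}(\theta_m)=\log\bigl\{(2\pi h_n)^{np/2}\mathbb L_{m,n}(\theta_m)\bigr\}.$$ The quasi-maximum likelihood estimator $\hat\theta_{m,n}$ satisfies $\mathbb L_{m,n}(\hat\theta_{m,n})=\sup_{\theta_m\in\Theta_m}\mathbb L_{m,n}(\theta_m)$. $\pi_{m,n}$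 is the prior density of $\theta_m$ on $\Theta_m$, and $\mathbb U_{m,n}(\theta_{m,0})=\{u_m\in\mathbb R^{q_m}:\theta_{m,0}+n^{-1/2}u_m\in\Theta_m\}$. **[A]** For each pair $(B,Z)\in\{(B_1,\xi_0),(B_2,\delta_0),(B_3,\varepsilon_0),(B_4,\zeta_0)\}$: (i) $B$ is globally Lipschitz; (ii) $\sup_t\mathbf E[|Z_t|^\ell]<\infty$ for all $\ell>0$; (iii) $B\in C^4_\uparrow$. **[B]** (a) $\inf_{n}\pi_{m,n}(\theta_{m,0})>0$ and $\sup_{\theta_m\in\Theta_m}\sup_n\pi_{m,n}(\theta_m)<\infty$; (b) for each $L>0$, $\sup_{u_m\in\{|u_m|<L\}\cap\mathbb U_{m,n}(\theta_{m,0})}|\pi_{m,n}(\theta_{m,0}+n^{-1/2}u_m)-\pi_{m,n}(\theta_{m,0})|\to0$ as $n\to\infty$. **[C1]** Let $$\mathbb Y_m(\theta_m)=-\tfrac12\bigl(\mathbf\Sigma_m(\theta_m)^{-1}-\mathbf\Sigma_m(\theta_{m,0})^{-1}\bigr)\bigl[\mathbf\Sigma_m(\theta_{m,0})\bigr]-\tfrac12\log\frac{\det\mathbf\Sigma_m(\theta_m)}{\det\mathbf\Sigma_m(\theta_{m,0})},\qquad \Delta_{m,0}=\frac{\partial}{\partial\theta_m^\top}\mathrm{vech}\,\mathbf\Sigma_m(\theta_m)\Big|_{\theta_m=\theta_{m,0}}.$$ (a) There is $\chi>0$ with $\mathbb Y_m(\theta_m)\le-\chi|\theta_m-\theta_{m,0}|^2$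 for all $\theta_m\in\Theta_m$; (b) $\mathrm{rank}\,\Delta_{m,0}=q_m$. *)

theory Defs
  imports "HOL-Probability.Probability" "HOL-Library.Uprod"
begin

definition pos_def :: "real^'n^'n \<Rightarrow> bool" where
  "pos_def A \<longleftrightarrow> transpose A = A \<and> (\<forall>x. x \<noteq> 0 \<longrightarrow> x \<bullet> (A *v x) > 0)"

text \<open>The bracket \<open>A[B] = tr(A B\<^sup>T)\<close> and \<open>v\<^sup>\<otimes>\<^sup>2 = v v\<^sup>T\<close>.\<close>

definition mat_dot :: "real^'n^'m \<Rightarrow> real^'n^'m \<Rightarrow> real" where
  "mat_dot A B = trace (A ** transpose B)"

definition outer_sq :: "real^'n \<Rightarrow> real^'n^'n" where
  "outer_sq v = (\<chi> i j. v $ i * v $ j)"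

definition block_mat ::
  "real^'a^'a \<Rightarrow> real^'b^'a \<Rightarrow> real^'a^'b \<Rightarrow> real^'b^'b \<Rightarrow> real^('a + 'b)^('a + 'b)" where
  "block_mat A B C D = (\<chi> i j.
     case i of
       Inl a \<Rightarrow> (case j of Inl a' \<Rightarrow> A $ a $ a' | Inr b' \<Rightarrow> B $ a $ b')
     | Inr b \<Rightarrow> (case j of Inl a' \<Rightarrow> C $ b $ a' | Inr b' \<Rightarrow> D $ b $ b'))"

definition vec_append :: "real^'a \<Rightarrow> real^'b \<Rightarrow> real^('a + 'b)" where
  "vec_append x y = (\<chi> i. case i of Inl a \<Rightarrow> x $ a | Inr b \<Rightarrow> y $ b)"

text \<open>The half-vectorization of a symmetric \<open>p \<times> p\<close> matrix keeps one of the two equal entries at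
  \<open>(i, j)\<close> and \<open>(j, i)\<close>, so its \<open>p (p + 1) / 2\<close> components are indexed by unordered pairs
  (with \<open>i = j\<close> allowed). On symmetric matrices, the only ones it is applied to, the choice of
  representative is immaterial; see \<open>vech_Upair\<close>.\<close>

instance uprod :: (finite) finite
  by standard simp

definition vech :: "real^'n^'n \<Rightarrow> real^('n uprod)" where
  "vech A = (\<chi> z. case (SOME (i, j). Upair i j = z) of (i, j) \<Rightarrow> A $ i $ j)"

lemma vech_Upair:
  assumes "transpose A = A"
  shows "vech A $ Upair i j = A $ i $ j"
proof -
  obtain a b where ab: "(SOME (a, b). Upair a b = Upair i j) = (a, b)"
    by fastforce
  have "case (SOME (a, b). Upair a b = Upair i j) of (a, b) \<Rightarrow> Upair a b = Upair i j"
    by (rule someI[of _ "(i, j)"]) simp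
  with ab have "(a = i \<and> b = j) \<or> (a = j \<and> b = i)"
    by simp
  moreover have "A $ j $ i = A $ i $ j"
    using assms by (metis transpose_def vec_lambda_beta)
  ultimately show ?thesis
    unfolding vech_def using ab by auto
qed

definition dir_deriv ::
  "('a::real_normed_vector \<Rightarrow> 'b::real_normed_vector) \<Rightarrow> 'a \<Rightarrow> 'a \<Rightarrow> 'b" where
  "dir_deriv f v x = frechet_derivative f (at x) v"

definition hessian :: "(real^'n \<Rightarrow> real) \<Rightarrow> real^'n \<Rightarrow> real^'n^'n" where
  "hessian f x = (\<chi> i j. dir_deriv (dir_deriv f (axis j 1)) (axis i 1) x)"

text \<open>Meant for open \<open>U\<close> only: derivatives are taken in the whole space.\<close>

primrec Ck_on ::
  "nat \<Rightarrow> 'a::euclidean_space set \<Rightarrow> ('a \<Rightarrow> 'b::real_normed_vector) \<Rightarrow> bool" where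
  "Ck_on 0 U f \<longleftrightarrow> continuous_on U f"
| "Ck_on (Suc k) U f \<longleftrightarrow>
     (\<forall>x\<in>U. f differentiable (at x)) \<and> (\<forall>b\<in>Basis. Ck_on k U (dir_deriv f b))"

definition poly_growth :: "('a::real_normed_vector \<Rightarrow> 'b::real_normed_vector) \<Rightarrow> bool" where
  "poly_growth f \<longleftrightarrow> (\<exists>C N. \<forall>x. norm (f x) \<le> C * (1 + norm x) ^ N)"

text \<open>The class \<open>C\<^sup>k\<close> with all partial derivatives of order at most \<open>k\<close> of polynomial growth.\<close>

primrec Ck_up :: "nat \<Rightarrow> ('a::euclidean_space \<Rightarrow> 'b::real_normed_vector) \<Rightarrow> bool" where
  "Ck_up 0 f \<longleftrightarrow> continuous_on UNIV f \<and> poly_growth f"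
| "Ck_up (Suc k) f \<longleftrightarrow>
     (\<forall>x. f differentiable (at x)) \<and> poly_growth f \<and> (\<forall>b\<in>Basis. Ck_up k (dir_deriv f b))"

text \<open>Near every boundary point the closed set is, in suitable orthonormal coordinates, the part
  lying above the graph of a Lipschitz function on the hyperplane orthogonal to \<open>u\<close>.\<close>

definition locally_lipschitz_boundary :: "'a::euclidean_space set \<Rightarrow> bool" where
  "locally_lipschitz_boundary K \<longleftrightarrow>
     (\<forall>x\<in>frontier K. \<exists>V u g L. open V \<and> x \<in> V \<and> norm u = 1 \<and>
        L-lipschitz_on {v. v \<bullet> u = 0} g \<and>
        K \<inter> V = {y \<in> V. g (y - (y \<bullet> u) *\<^sub>R u) \<le> y \<bullet> u})"

text \<open>Processes are indexed by \<open>real\<close>; only times \<open>t \<ge> 0\<close> matter.\<close>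

definition stochastic_basis :: "'w measure \<Rightarrow> (real \<Rightarrow> 'w measure) \<Rightarrow> bool" where
  "stochastic_basis P F \<longleftrightarrow>
     prob_space P \<and> complete_measure P \<and>
     (\<forall>t\<ge>0. subalgebra P (F t)) \<and>
     (\<forall>s t. 0 \<le> s \<and> s \<le> t \<longrightarrow> sets (F s) \<subseteq> sets (F t)) \<and>
     null_sets P \<subseteq> sets (F 0) \<and>
     (\<forall>t\<ge>0. sets (F t) = (\<Inter>s\<in>{t<..}. sets (F s)))"

definition wiener_process ::
  "'w measure \<Rightarrow> (real \<Rightarrow> 'w measure) \<Rightarrow> (real \<Rightarrow> 'w \<Rightarrow> real^'r) \<Rightarrow> bool" where
  "wiener_process P F W \<longleftrightarrow>
     (\<forall>t\<ge>0. W t \<in> borel_measurable (F t)) \<and>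
     (AE w in P. W 0 w = 0 \<and> continuous_on {0..} (\<lambda>t. W t w)) \<and>
     (\<forall>s t. 0 \<le> s \<and> s < t \<longrightarrow>
        distributed P lborel (\<lambda>w. W t w - W s w)
          (\<lambda>x. \<Prod>i\<in>UNIV. normal_density 0 (sqrt (t - s)) (x $ i)) \<and>
        prob_space.indep_set P (sets (F s))
          {(\<lambda>w. W t w - W s w) -` A \<inter> space P | A. A \<in> sets borel})"

definition process_sigma ::
  "'w measure \<Rightarrow> (real \<Rightarrow> 'w \<Rightarrow> real^'r) \<Rightarrow> 'w set set" where
  "process_sigma P W =
     sigma_sets (space P) {W t -` A \<inter> space P | t A. 0 \<le> t \<and> A \<in> sets borel}"

definition independent_processes4 ::
  "'w measure \<Rightarrow> (real \<Rightarrow> 'w \<Rightarrow> real^'r1) \<Rightarrow> (real \<Rightarrow> 'w \<Rightarrow> real^'r2) \<Rightarrow>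
   (real \<Rightarrow> 'w \<Rightarrow> real^'r3) \<Rightarrow> (real \<Rightarrow> 'w \<Rightarrow> real^'r4) \<Rightarrow> bool" where
  "independent_processes4 P W1 W2 W3 W4 \<longleftrightarrow>
     prob_space.indep_sets P
       (\<lambda>j::nat. [process_sigma P W1, process_sigma P W2, process_sigma P W3, process_sigma P W4] ! j)
       {..<4}"

text \<open>Solutions of \<open>dZ = b(Z) dt + S dW\<close>, \<open>Z\<^sub>0 = c\<close>. As \<open>S\<close> is a constant matrix and \<open>W\<^sub>0 = 0\<close>,
  the stochastic integral of \<open>S\<close> over \<open>[0, t]\<close> is \<open>S W\<^sub>t\<close>.\<close>

definition sde_solution ::
  "'w measure \<Rightarrow> (real \<Rightarrow> 'w measure) \<Rightarrow> (real^'d \<Rightarrow> real^'d) \<Rightarrow> real^'r^'d \<Rightarrow>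
   (real \<Rightarrow> 'w \<Rightarrow> real^'r) \<Rightarrow> real^'d \<Rightarrow> (real \<Rightarrow> 'w \<Rightarrow> real^'d) \<Rightarrow> bool" where
  "sde_solution P F b S W c Z \<longleftrightarrow>
     (\<forall>t\<ge>0. Z t \<in> borel_measurable (F t)) \<and>
     (AE w in P. continuous_on {0..} (\<lambda>t. Z t w) \<and>
        (\<forall>t\<ge>0. (\<lambda>s. b (Z s w)) integrable_on {0..t} \<and>
           Z t w = c + integral {0..t} (\<lambda>s. b (Z s w)) + S *v W t w))"

text \<open>Convergence to \<open>0\<close> in probability, for extended real random variables.\<close>

definition op_one :: "'w measure \<Rightarrow> (nat \<Rightarrow> 'w \<Rightarrow> ereal) \<Rightarrow> bool" where
  "op_one P Y \<longleftrightarrow>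
     (\<forall>\<^sub>F n in sequentially. Y n \<in> borel_measurable P) \<and>
     (\<forall>e>0. (\<lambda>n. measure P {w \<in> space P. \<bar>Y n w\<bar> > ereal e}) \<longlonglongrightarrow> 0)"

text \<open>The library's \<open>ln\<close> on the reals maps \<open>0\<close> to \<open>0\<close>, but a prior density may vanish;
  here \<open>log 0 = -\<infinity>\<close>.\<close>

definition elog :: "real \<Rightarrow> ereal" where
  "elog x = (if x > 0 then ereal (ln x) else -\<infinity>)"

record ('k1::finite, 'k2::finite, 'p1::finite, 'p2::finite,
    'r1::finite, 'r2::finite, 'r3::finite, 'r4::finite) sem =
  Lam1 :: "real^'k1^'p1"
  Lam2 :: "real^'k2^'p2"
  Bmat :: "real^'k2^'k2"
  Gam :: "real^'k1^'k2"
  S1 :: "real^'r1^'k1"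
  S2 :: "real^'r2^'p1"
  S3 :: "real^'r3^'p2"
  S4 :: "real^'r4^'k2"

definition Psi ::
  "('k1::finite, 'k2::finite, 'p1::finite, 'p2::finite,
    'r1::finite, 'r2::finite, 'r3::finite, 'r4::finite) sem \<Rightarrow> real^'k2^'k2" where
  "Psi A = mat 1 - Bmat A"

definition Sig_xi ::
  "('k1::finite, 'k2::finite, 'p1::finite, 'p2::finite,
    'r1::finite, 'r2::finite, 'r3::finite, 'r4::finite) sem \<Rightarrow> real^'k1^'k1" where
  "Sig_xi A = S1 A ** transpose (S1 A)"

definition Sig_delta ::
  "('k1::finite, 'k2::finite, 'p1::finite, 'p2::finite,
    'r1::finite, 'r2::finite, 'r3::finite, 'r4::finite) sem \<Rightarrow> real^'p1^'p1" where
  "Sig_delta A = S2 A ** transpose (S2 A)"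

definition Sig_eps ::
  "('k1::finite, 'k2::finite, 'p1::finite, 'p2::finite,
    'r1::finite, 'r2::finite, 'r3::finite, 'r4::finite) sem \<Rightarrow> real^'p2^'p2" where
  "Sig_eps A = S3 A ** transpose (S3 A)"

definition Sig_zeta ::
  "('k1::finite, 'k2::finite, 'p1::finite, 'p2::finite,
    'r1::finite, 'r2::finite, 'r3::finite, 'r4::finite) sem \<Rightarrow> real^'k2^'k2" where
  "Sig_zeta A = S4 A ** transpose (S4 A)"

definition admissible ::
  "('k1::finite, 'k2::finite, 'p1::finite, 'p2::finite,
    'r1::finite, 'r2::finite, 'r3::finite, 'r4::finite) sem \<Rightarrow> bool" where
  "admissible A \<longleftrightarrow>
     (\<forall>i. Bmat A $ i $ i = 0) \<and>
     rank (Lam1 A) = CARD('k1) \<and>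
     invertible (Psi A) \<and>
     pos_def (Sig_delta A) \<and> pos_def (Sig_eps A)"

definition Sig11 ::
  "('k1::finite, 'k2::finite, 'p1::finite, 'p2::finite,
    'r1::finite, 'r2::finite, 'r3::finite, 'r4::finite) sem \<Rightarrow> real^'p1^'p1" where
  "Sig11 A = Lam1 A ** Sig_xi A ** transpose (Lam1 A) + Sig_delta A"

definition Sig12 ::
  "('k1::finite, 'k2::finite, 'p1::finite, 'p2::finite,
    'r1::finite, 'r2::finite, 'r3::finite, 'r4::finite) sem \<Rightarrow> real^'p2^'p1" where
  "Sig12 A = Lam1 A ** Sig_xi A ** transpose (Gam A) ** transpose (matrix_inv (Psi A))
     ** transpose (Lam2 A)"

definition Sig22 ::
  "('k1::finite, 'k2::finite, 'p1::finite, 'p2::finite,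
    'r1::finite, 'r2::finite, 'r3::finite, 'r4::finite) sem \<Rightarrow> real^'p2^'p2" where
  "Sig22 A = Lam2 A ** matrix_inv (Psi A) ** (Gam A ** Sig_xi A ** transpose (Gam A) + Sig_zeta A)
     ** transpose (matrix_inv (Psi A)) ** transpose (Lam2 A) + Sig_eps A"

definition sem_cov ::
  "('k1::finite, 'k2::finite, 'p1::finite, 'p2::finite,
    'r1::finite, 'r2::finite, 'r3::finite, 'r4::finite) sem \<Rightarrow> real^('p1 + 'p2)^('p1 + 'p2)" where
  "sem_cov A = block_mat (Sig11 A) (Sig12 A) (transpose (Sig12 A)) (Sig22 A)"

text \<open>The increment over \<open>[(i - 1) T / n, i T / n]\<close>, for \<open>i \<ge> 1\<close>.\<close>

definition increment ::
  "(real \<Rightarrow> 'w \<Rightarrow> real^'p) \<Rightarrow> real \<Rightarrow> nat \<Rightarrow> nat \<Rightarrow> 'w \<Rightarrow> real^'p" where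
  "increment X T n i w = X (real i * (T / real n)) w - X ((real i - 1) * (T / real n)) w"

definition quasi_lik ::
  "(real \<Rightarrow> 'w \<Rightarrow> real^'p) \<Rightarrow> real \<Rightarrow> (real^'q \<Rightarrow> real^'p^'p) \<Rightarrow> nat \<Rightarrow> 'w \<Rightarrow> real^'q \<Rightarrow> real" where
  "quasi_lik X T Sig n w \<theta> =
     (let h = T / real n in
      \<Prod>i=1..n. 1 / ((2 * pi * h) powr (real CARD('p) / 2) * sqrt (det (Sig \<theta>))) *
        exp (- (1 / (2 * h)) * mat_dot (matrix_inv (Sig \<theta>)) (outer_sq (increment X T n i w))))"

definition quasi_loglik ::
  "(real \<Rightarrow> 'w \<Rightarrow> real^'p) \<Rightarrow> real \<Rightarrow> (real^'q \<Rightarrow> real^'p^'p) \<Rightarrow> nat \<Rightarrow> 'w \<Rightarrow> real^'q \<Rightarrow> real" where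
  "quasi_loglik X T Sig n w \<theta> =
     ln ((2 * pi * (T / real n)) powr (real n * real CARD('p) / 2) * quasi_lik X T Sig n w \<theta>)"

definition prior_density :: "(real^'q) set \<Rightarrow> (real^'q \<Rightarrow> real) \<Rightarrow> bool" where
  "prior_density \<Theta> \<pi> \<longleftrightarrow>
     (\<forall>\<theta>\<in>\<Theta>. 0 \<le> \<pi> \<theta>) \<and> set_integrable lborel \<Theta> \<pi> \<and> (LINT \<theta>:\<Theta>|lborel. \<pi> \<theta>) = 1"

definition cond_A ::
  "'w measure \<Rightarrow> (real^'d \<Rightarrow> real^'d) \<Rightarrow> (real \<Rightarrow> 'w \<Rightarrow> real^'d) \<Rightarrow> bool" where
  "cond_A P b Z \<longleftrightarrow>
     (\<exists>L. L-lipschitz_on UNIV b) \<and>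
     (\<forall>l::real. l > 0 \<longrightarrow> (SUP t\<in>{0..}. \<integral>\<^sup>+ w. ennreal (norm (Z t w) powr l) \<partial>P) < \<infinity>) \<and>
     Ck_up 4 b"

definition local_params :: "(real^'q) set \<Rightarrow> real^'q \<Rightarrow> nat \<Rightarrow> (real^'q) set" where
  "local_params \<Theta> \<theta>0 n = {u. \<theta>0 + (1 / sqrt (real n)) *\<^sub>R u \<in> \<Theta>}"

definition cond_B :: "(real^'q) set \<Rightarrow> real^'q \<Rightarrow> (nat \<Rightarrow> real^'q \<Rightarrow> real) \<Rightarrow> bool" where
  "cond_B \<Theta> \<theta>0 \<pi> \<longleftrightarrow>
     (\<exists>c>0. \<forall>n\<ge>1. c \<le> \<pi> n \<theta>0) \<and>
     (\<exists>C. \<forall>\<theta>\<in>\<Theta>. \<forall>n\<ge>1. \<pi> n \<theta> \<le> C) \<and>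
     (\<forall>L>0. (\<lambda>n. SUP u\<in>{u. norm u < L} \<inter> local_params \<Theta> \<theta>0 n.
        \<bar>\<pi> n (\<theta>0 + (1 / sqrt (real n)) *\<^sub>R u) - \<pi> n \<theta>0\<bar>) \<longlonglongrightarrow> 0)"

definition contrast_Y :: "(real^'q \<Rightarrow> real^'p^'p) \<Rightarrow> real^'q \<Rightarrow> real^'q \<Rightarrow> real" where
  "contrast_Y Sig \<theta>0 \<theta> =
     - (1/2) * mat_dot (matrix_inv (Sig \<theta>) - matrix_inv (Sig \<theta>0)) (Sig \<theta>0)
     - (1/2) * ln (det (Sig \<theta>) / det (Sig \<theta>0))"

definition cond_C1 :: "(real^'q) set \<Rightarrow> (real^'q \<Rightarrow> real^'p^'p) \<Rightarrow> real^'q \<Rightarrow> bool" where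
  "cond_C1 \<Theta> Sig \<theta>0 \<longleftrightarrow>
     (\<exists>\<kappa>>0. \<forall>\<theta>\<in>\<Theta>. contrast_Y Sig \<theta>0 \<theta> \<le> - \<kappa> * (norm (\<theta> - \<theta>0))\<^sup>2) \<and>
     rank (jacobian (\<lambda>\<theta>. vech (Sig \<theta>)) (at \<theta>0)) = CARD('q)"

end

(*
Put Q_n = (1/T) sum_i (Delta_i X)(Delta_i X)^T. Then H_n(theta) = n (g0(theta) + Q_n . g(theta)) with
g0 = -(1/2) ln det Sigma and g = -(1/2) Sigma^{-1}, so all randomness enters through Q_n.

The driving noise of X is K W with K K^T = Sigma_0, and the drift is Lipschitz along each path on [0,T];
second moments of the increments of W therefore make sqrt n (Q_n - Sigma_0) tight. No stochastic
calculus is needed because the diffusion matrices are constant.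

On {sqrt n |Q_n - Sigma_0| <= L} the claim is deterministic. Condition [C1](a) and the Lipschitz
continuity of Sigma^{-1} give |theta_hat - theta_0| = O(n^{-1/2}) and, after the substitution
theta = theta_hat + u / sqrt n, a Gaussian majorant in u for the integrand. Second-order Taylor expansion
at theta_hat and dominated convergence then produce the Gaussian integral. Uniformity in the sample
point follows by contradiction along sequences.
*)
theory Submission
  imports Defs
begin

section \<open>Linear change of variables and Gaussian integrals\<close>

text \<open>Realizations are treated as points of a Euclidean space, so the law of the sample enters
  only through tightness and the hypothesis on the prior. Condition [C1](a) has a further role:
  evaluated at \<theta>0 + u / sqrt n it bounds the limiting information matrix below by 2 \<kappa>,
  so the limiting Gaussian integral is non-degenerate. The approximation is proved with log
  \<pi>(\<theta>0), because [B] controls the prior around \<theta>0; the passage to the estimator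
  comes at the very end. The factor n^(-q/2) of the substitution cancels against det(-n Hess) = n^q
  det(-Hess). Two obstacles shape the probabilistic part. The drift is controlled by a constant that
  depends on the path, the noise in mean square, so almost sure and moment bounds must be merged
  into one tightness statement. And each Wiener process separately has increments independent of the
  filtration, so mixed products of different processes call for the independence of whole
  paths.\<close>

lemma sum_Basis_vec:
  fixes F :: "real^'q \<Rightarrow> 'b::comm_monoid_add"
  shows "(\<Sum>b\<in>Basis. F b) = (\<Sum>i\<in>UNIV. F (axis i 1))"
proof -
  have "(\<Sum>b\<in>Basis. F b) = (\<Sum>b\<in>(\<lambda>i. axis i 1) ` UNIV. F b)"
    by (rule sum.cong) (auto simp: Basis_vec_def)
  also have "\<dots> = (\<Sum>i\<in>UNIV. F (axis i 1))"
    by (subst sum.reindex) (auto simp: inj_on_def axis_eq_axis)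
  finally show ?thesis .
qed

lemma axis_Basis: "axis i (1::real) \<in> Basis"
  by (auto simp: Basis_vec_def)

lemma prod_Basis_vec:
  fixes F :: "real^'q \<Rightarrow> 'b::comm_monoid_mult"
  shows "(\<Prod>b\<in>Basis. F b) = (\<Prod>i\<in>UNIV. F (axis i 1))"
proof -
  have "(\<Prod>b\<in>Basis. F b) = (\<Prod>b\<in>(\<lambda>i. axis i 1) ` UNIV. F b)"
    by (rule prod.cong) (auto simp: Basis_vec_def)
  also have "\<dots> = (\<Prod>i\<in>UNIV. F (axis i 1))"
    by (subst prod.reindex) (auto simp: inj_on_def axis_eq_axis)
  finally show ?thesis .
qed

lemma det_shear:
  fixes m n :: "'n::finite"
  assumes "m \<noteq> n"
  shows "det (matrix (\<lambda>v::real^'n. \<chi> i. if i = m then v $ m + v $ n else v $ i)) = 1"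
proof -
  let ?h = "\<lambda>v::real^'n. \<chi> i. if i = m then v $ m + v $ n else v $ i"
  have "matrix ?h = (\<chi> k. if k = m then row m (mat 1) + 1 *s row n (mat 1) else row k (mat 1))"
    by (auto simp: vec_eq_iff matrix_def row_def mat_def axis_def)
  then show ?thesis
    using det_row_operation[OF assms, of "mat 1 :: real^'n^'n" 1] by simp
qed

lemma borel_measurable_vec_lambda_PiM [measurable]:
  "(vec_lambda :: ('n::finite \<Rightarrow> real) \<Rightarrow> real^'n) \<in> (\<Pi>\<^sub>M i\<in>UNIV. lborel) \<rightarrow>\<^sub>M borel"
proof -
  have "vec_lambda f = (\<Sum>i\<in>UNIV. f i *\<^sub>R axis i (1::real))" for f :: "'n \<Rightarrow> real"
    using basis_expansion[of "vec_lambda f"] by (simp add: scalar_mult_eq_scaleR)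
  then have eq: "vec_lambda = (\<lambda>f::'n \<Rightarrow> real. \<Sum>i\<in>UNIV. f i *\<^sub>R axis i (1::real))" by blast
  show ?thesis unfolding eq by measurable
qed

text \<open>Both measures give every box its volume, which characterizes Lebesgue measure. Written
  as a product over coordinates, it allows integration in one coordinate at a time.\<close>

lemma lborel_vec_eq:
  "(lborel :: (real^'n) measure) = distr (\<Pi>\<^sub>M i\<in>UNIV. lborel) borel vec_lambda"
proof (rule lborel_eqI)
  interpret product_sigma_finite "\<lambda>_::'n. lborel :: real measure" ..
  fix l u :: "real^'n" assume lu: "\<And>b. b \<in> Basis \<Longrightarrow> l \<bullet> b \<le> u \<bullet> b"
  have le: "l $ i \<le> u $ i" for i
    using lu[OF axis_Basis, of i] by (simp add: inner_axis)
  have eq: "vec_lambda -` box l u \<inter> space (\<Pi>\<^sub>M i\<in>UNIV. lborel) = (\<Pi>\<^sub>E i\<in>UNIV. {l $ i<..<u $ i})"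
    by (auto simp: mem_box_cart space_PiM PiE_def Pi_iff)
  have "emeasure (distr (\<Pi>\<^sub>M i\<in>UNIV. lborel) borel vec_lambda) (box l u) = (\<Prod>i\<in>UNIV. emeasure lborel {l $ i<..<u $ i})"
    by (subst emeasure_distr) (simp_all add: eq emeasure_PiM)
  also have "\<dots> = ennreal (\<Prod>b\<in>Basis. (u - l) \<bullet> b)"
    unfolding prod_Basis_vec using le by (simp add: inner_axis prod_ennreal)
  finally show "emeasure (distr (\<Pi>\<^sub>M i\<in>UNIV. lborel) borel vec_lambda) (box l u) = ennreal (\<Prod>b\<in>Basis. (u - l) \<bullet> b)" .
qed simp

text \<open>By Fubini in coordinate \<open>m\<close>: with the other coordinates frozen the shear is
  a translation of that coordinate by the constant \<open>f n\<close>, because \<open>n\<close>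
  differs from \<open>m\<close>, and Lebesgue measure on the line is translation invariant.\<close>

lemma nn_integral_shear:
  fixes g :: "real^'n \<Rightarrow> ennreal" and m n :: 'n
  assumes mn: "m \<noteq> n" and g [measurable]: "g \<in> borel_measurable borel"
  shows "(\<integral>\<^sup>+x. g (\<chi> i. if i = m then x $ m + x $ n else x $ i) \<partial>lborel) = (\<integral>\<^sup>+x. g x \<partial>lborel)"
proof -
  let ?I = "UNIV - {m}" and ?h = "\<lambda>v::real^'n. \<chi> i. if i = m then v $ m + v $ n else v $ i"
  interpret product_sigma_finite "\<lambda>_::'n. lborel :: real measure" ..
  have ins: "insert m ?I = UNIV" by auto
  have nn: "(\<integral>\<^sup>+x. k x \<partial>lborel) =
      (\<integral>\<^sup>+f. \<integral>\<^sup>+y. k (vec_lambda (f(m := y))) \<partial>lborel \<partial>(\<Pi>\<^sub>M i\<in>?I. lborel))"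
    if k [measurable]: "k \<in> borel_measurable borel" for k :: "real^'n \<Rightarrow> ennreal"
  proof -
    have "(\<integral>\<^sup>+x. k x \<partial>lborel) = (\<integral>\<^sup>+f. k (vec_lambda f) \<partial>(\<Pi>\<^sub>M i\<in>insert m ?I. lborel))"
      unfolding ins by (subst lborel_vec_eq, subst nn_integral_distr) auto
    also have "\<dots> = (\<integral>\<^sup>+f. \<integral>\<^sup>+y. k (vec_lambda (f(m := y))) \<partial>lborel \<partial>(\<Pi>\<^sub>M i\<in>?I. lborel))"
    proof (rule product_nn_integral_insert)
      show "(\<lambda>f. k (vec_lambda f)) \<in> borel_measurable (\<Pi>\<^sub>M i\<in>insert m ?I. lborel)" unfolding ins by measurable
    qed auto
    finally show ?thesis .
  qed
  have hb: "?h \<in> borel_measurable borel"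
    by (intro borel_measurable_continuous_onI continuous_on_vec_lambda)
       (rename_tac i, case_tac "i = m", auto intro!: continuous_intros)
  have h: "?h (vec_lambda (f(m := y))) = vec_lambda (f(m := f n + 1 * y))" for f y
    using mn by (simp add: vec_eq_iff)
  have "(\<integral>\<^sup>+x. g (?h x) \<partial>lborel) =
      (\<integral>\<^sup>+f. \<integral>\<^sup>+y. g (?h (vec_lambda (f(m := y)))) \<partial>lborel \<partial>(\<Pi>\<^sub>M i\<in>?I. lborel))"
    by (rule nn) (use hb in measurable)
  also have "\<dots> = (\<integral>\<^sup>+f. \<integral>\<^sup>+y. g (vec_lambda (f(m := y))) \<partial>lborel \<partial>(\<Pi>\<^sub>M i\<in>?I. lborel))"
    unfolding h
  proof (rule nn_integral_cong)
    fix f :: "'n \<Rightarrow> real" assume "f \<in> space (\<Pi>\<^sub>M i\<in>?I. lborel)"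
    then have "(\<lambda>y. f(m := y)) \<in> lborel \<rightarrow>\<^sub>M (\<Pi>\<^sub>M i\<in>insert m ?I. lborel)"
      by measurable
    then have [measurable]: "(\<lambda>y. g (vec_lambda (f(m := y)))) \<in> borel_measurable borel"
      unfolding ins by measurable
    show "(\<integral>\<^sup>+y. g (vec_lambda (f(m := f n + 1 * y))) \<partial>lborel) = (\<integral>\<^sup>+y. g (vec_lambda (f(m := y))) \<partial>lborel)"
      using nn_integral_real_affine[of "\<lambda>y. g (vec_lambda (f(m := y)))" 1 "f n"] by simp
  qed
  also have "\<dots> = (\<integral>\<^sup>+x. g x \<partial>lborel)"
    by (rule nn[symmetric]) simp
  finally show ?thesis .
qed

text \<open>Exchanging two coordinates maps boxes to boxes of the same volume, so the image of
  Lebesgue measure is Lebesgue measure again.\<close>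

lemma nn_integral_swap:
  fixes g :: "real^'n \<Rightarrow> ennreal" and m n :: 'n
  assumes g [measurable]: "g \<in> borel_measurable borel"
  shows "(\<integral>\<^sup>+x. g (\<chi> i. x $ Transposition.transpose m n i) \<partial>lborel) = (\<integral>\<^sup>+x. g x \<partial>lborel)"
proof -
  let ?h = "\<lambda>v::real^'n. \<chi> i. v $ Transposition.transpose m n i"
  have hb [measurable]: "?h \<in> borel_measurable borel"
    by (intro borel_measurable_continuous_onI continuous_on_vec_lambda) (auto intro!: continuous_intros)
  have "lborel = distr lborel borel ?h"
  proof (rule lborel_eqI)
    fix l u :: "real^'n" assume le: "\<And>b. b \<in> Basis \<Longrightarrow> l \<bullet> b \<le> u \<bullet> b"
    have le': "l $ i \<le> u $ i" for i
      using le[of "axis i 1"] by (auto simp: Basis_vec_def inner_axis)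
    have eq: "?h -` box l u = box (?h l) (?h u)"
      by (auto simp: mem_box_cart) (metis transpose_involutory)+
    have "emeasure (distr lborel borel ?h) (box l u) = emeasure lborel (box (?h l) (?h u))"
      by (subst emeasure_distr) (auto simp: eq)
    also have "\<dots> = (\<Prod>b\<in>Basis. (?h u - ?h l) \<bullet> b)"
    proof (rule emeasure_lborel_box)
      fix b :: "real^'n" assume "b \<in> Basis"
      then show "?h l \<bullet> b \<le> ?h u \<bullet> b" using le' by (auto simp: Basis_vec_def inner_axis)
    qed
    also have "(\<Prod>b\<in>Basis. (?h u - ?h l) \<bullet> b) = (\<Prod>i\<in>UNIV. (u - l) $ Transposition.transpose m n i)"
      unfolding prod_Basis_vec by (simp add: inner_axis)
    also have "\<dots> = (\<Prod>i\<in>UNIV. (u - l) $ i)"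
      using prod.permute [OF permutes_swap_id, where S=UNIV and g="\<lambda>i. (u - l)$i", of m n] by (simp add: o_def)
    finally show "emeasure (distr lborel borel ?h) (box l u) = (\<Prod>b\<in>Basis. (u - l) \<bullet> b)"
      unfolding prod_Basis_vec by (simp add: inner_axis)
  qed simp
  then have "(\<integral>\<^sup>+x. g x \<partial>lborel) = (\<integral>\<^sup>+x. g x \<partial>distr lborel borel ?h)" by simp
  also have "\<dots> = (\<integral>\<^sup>+x. g (?h x) \<partial>lborel)" by (rule nn_integral_distr) auto
  finally show ?thesis by simp
qed

lemma nn_integral_stretch:
  fixes g :: "real^'n \<Rightarrow> ennreal" and c :: "'n \<Rightarrow> real"
  assumes g [measurable]: "g \<in> borel_measurable borel" and c: "\<And>i. c i \<noteq> 0"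
  shows "ennreal (\<Prod>i\<in>UNIV. \<bar>c i\<bar>) * (\<integral>\<^sup>+x. g (\<chi> i. c i * x $ i) \<partial>lborel) = (\<integral>\<^sup>+x. g x \<partial>lborel)"
proof -
  \<comment> \<open>The affine rule indexes its coefficients by basis vectors; \<open>d\<close>
    carries the coefficient of coordinate \<open>i\<close> over to \<open>axis i 1\<close>, where
    the choice is unique by injectivity of \<open>axis\<close>.\<close>
  define d where "d = (\<lambda>b::real^'n. c (SOME i. b = axis i 1))"
  have d: "d (axis i 1) = c i" for i
    unfolding d_def by (rule arg_cong[of _ _ c]) (auto simp: axis_eq_axis)
  have Bas: "Basis = (\<lambda>i. axis i (1::real) :: real^'n) ` UNIV" by (auto simp: Basis_vec_def)
  have inj: "inj (\<lambda>i. axis i (1::real) :: real^'n)" by (auto simp: inj_on_def axis_eq_axis)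
  let ?T = "\<lambda>x::real^'n. 0 + (\<Sum>j\<in>Basis. (d j * (x \<bullet> j)) *\<^sub>R j)"
  have T: "?T x = (\<chi> i. c i * x $ i)" for x
  proof -
    have "(\<Sum>j\<in>Basis. (d j * (x \<bullet> j)) *\<^sub>R j) $ k = c k * x $ k" for k
    proof -
      have "(\<Sum>j\<in>Basis. (d j * (x \<bullet> j)) *\<^sub>R j) $ k = (\<Sum>i\<in>UNIV. (c i * x $ i) *\<^sub>R axis i 1 $ k)"
        unfolding Bas sum.reindex[OF inj] by (simp add: d inner_axis)
      also have "\<dots> = (\<Sum>i\<in>UNIV. if i = k then c i * x $ i else 0)"
        by (rule sum.cong) (auto simp: axis_def)
      finally show ?thesis by simp
    qed
    then show ?thesis by (simp add: vec_eq_iff)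
  qed
  have "lborel = density (distr lborel borel ?T) (\<lambda>_. ennreal (\<Prod>j\<in>Basis. \<bar>d j\<bar>))"
    by (rule lborel_affine_euclidean) (auto simp: Bas d c)
  moreover have "(\<Prod>j\<in>Basis. \<bar>d j\<bar>) = (\<Prod>i\<in>UNIV. \<bar>c i\<bar>)"
    unfolding Bas prod.reindex[OF inj] by (simp add: d)
  ultimately have lb: "lborel = density (distr lborel borel (\<lambda>x. \<chi> i. c i * x $ i)) (\<lambda>_. ennreal (\<Prod>i\<in>UNIV. \<bar>c i\<bar>))"
    by (simp only: T)
  have hb [measurable]: "(\<lambda>x. \<chi> i. c i * x $ i) \<in> borel_measurable (borel :: (real^'n) measure)"
    by (intro borel_measurable_continuous_onI continuous_on_vec_lambda) (auto intro!: continuous_intros)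
  have "(\<integral>\<^sup>+x. g x \<partial>lborel) = (\<integral>\<^sup>+x. g x \<partial>density (distr lborel borel (\<lambda>x. \<chi> i. c i * x $ i)) (\<lambda>_. ennreal (\<Prod>i\<in>UNIV. \<bar>c i\<bar>)))"
    using lb by simp
  also have "\<dots> = ennreal (\<Prod>i\<in>UNIV. \<bar>c i\<bar>) * (\<integral>\<^sup>+x. g (\<chi> i. c i * x $ i) \<partial>lborel)"
    by (simp add: nn_integral_density nn_integral_distr nn_integral_cmult)
  finally show ?thesis by simp
qed

text \<open>The change of variables of \<open>HOL-Analysis\<close> is stated for well-ordered index types only.\<close>

lemma nn_integral_linear:
  fixes f :: "real^'n \<Rightarrow> real^'n" and g :: "real^'n \<Rightarrow> ennreal"
  assumes lin: "linear f" and det: "det (matrix f) \<noteq> 0" and g: "g \<in> borel_measurable borel"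
  shows "ennreal \<bar>det (matrix f)\<bar> * (\<integral>\<^sup>+x. g (f x) \<partial>lborel) = (\<integral>\<^sup>+x. g x \<partial>lborel)"
proof -
  \<comment> \<open>\<open>g\<close> is quantified inside the induction: for a composition the
    hypothesis on \<open>h\<close> is applied to \<open>\<lambda>x. g (f x)\<close>.\<close>
  have "\<forall>g\<in>borel_measurable borel. det (matrix f) \<noteq> 0 \<longrightarrow>
      ennreal \<bar>det (matrix f)\<bar> * (\<integral>\<^sup>+x. g (f x) \<partial>lborel) = (\<integral>\<^sup>+x. g x \<partial>lborel)"
  proof (rule induct_linear_elementary[OF lin]; intro ballI impI)
    fix f h :: "real^'n \<Rightarrow> real^'n" and g :: "real^'n \<Rightarrow> ennreal"
    assume f: "linear f" and h: "linear h" and g: "g \<in> borel_measurable borel"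
      and Pf [rule_format]: "\<forall>g\<in>borel_measurable borel. det (matrix f) \<noteq> 0 \<longrightarrow>
        ennreal \<bar>det (matrix f)\<bar> * (\<integral>\<^sup>+x. g (f x) \<partial>lborel) = (\<integral>\<^sup>+x. g x \<partial>lborel)"
      and Ph [rule_format]: "\<forall>g\<in>borel_measurable borel. det (matrix h) \<noteq> 0 \<longrightarrow>
        ennreal \<bar>det (matrix h)\<bar> * (\<integral>\<^sup>+x. g (h x) \<partial>lborel) = (\<integral>\<^sup>+x. g x \<partial>lborel)"
      and det: "det (matrix (f \<circ> h)) \<noteq> 0"
    have eq: "det (matrix (f \<circ> h)) = det (matrix f) * det (matrix h)"
      by (simp add: matrix_compose[OF h f] det_mul)
    have fb: "f \<in> borel_measurable borel"
      using f by (intro borel_measurable_continuous_onI linear_continuous_on linear_conv_bounded_linear[THEN iffD1])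
    have "(\<lambda>x. g (f x)) \<in> borel_measurable borel" using measurable_compose[OF fb g] .
    then show "ennreal \<bar>det (matrix (f \<circ> h))\<bar> * (\<integral>\<^sup>+x. g ((f \<circ> h) x) \<partial>lborel) = (\<integral>\<^sup>+x. g x \<partial>lborel)"
      using Pf[OF g] Ph[of "\<lambda>x. g (f x)"] det unfolding eq
      by (simp add: abs_mult ennreal_mult mult.assoc)
  next
    fix f :: "real^'n \<Rightarrow> real^'n" and i and g :: "real^'n \<Rightarrow> ennreal"
    assume "linear f" "\<And>x. f x $ i = 0" "det (matrix f) \<noteq> 0"
    \<comment> \<open>The image lies in a hyperplane, so \<open>f\<close> is not surjective and,
      being an endomorphism of a finite-dimensional space, not injective; its determinant would
      vanish.\<close>
    then have "\<not> inj f"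
      by (metis (full_types) linear_injective_imp_surjective one_neq_zero surjE vec_component)
    with \<open>linear f\<close> \<open>det (matrix f) \<noteq> 0\<close>
    show "ennreal \<bar>det (matrix f)\<bar> * (\<integral>\<^sup>+x. g (f x) \<partial>lborel) = (\<integral>\<^sup>+x. g x \<partial>lborel)"
      using det_nz_iff_inj by blast
  next
    fix c :: "'n \<Rightarrow> real" and g :: "real^'n \<Rightarrow> ennreal"
    assume g: "g \<in> borel_measurable borel"
      and det: "det (matrix (\<lambda>x::real^'n. \<chi> i. c i * x $ i)) \<noteq> 0"
    have eq: "det (matrix (\<lambda>x::real^'n. \<chi> i. c i * x $ i)) = (\<Prod>i\<in>UNIV. c i)"
      by (simp add: axis_def matrix_def det_diagonal)
    show "ennreal \<bar>det (matrix (\<lambda>x::real^'n. \<chi> i. c i * x $ i))\<bar> * (\<integral>\<^sup>+x. g (\<chi> i. c i * x $ i) \<partial>lborel) = (\<integral>\<^sup>+x. g x \<partial>lborel)"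
      using nn_integral_stretch[OF g, of c] det unfolding eq by (simp add: abs_prod)
  next
    fix m n :: 'n and g :: "real^'n \<Rightarrow> ennreal"
    assume g: "g \<in> borel_measurable borel"
    let ?h = "\<lambda>v::real^'n. \<chi> i. v $ Transposition.transpose m n i"
    assume "m \<noteq> n"
    have "(\<chi> i j. if Transposition.transpose m n i = j then 1 else 0) = (\<chi> i j. if j = Transposition.transpose m n i then 1 else (0::real))"
      by (auto intro!: Cart_lambda_cong)
    then have "matrix ?h = transpose(\<chi> i j. mat 1 $ i $ Transposition.transpose m n j)"
      by (auto simp: matrix_eq transpose_def axis_def mat_def matrix_def)
    then have 1: "\<bar>det (matrix ?h)\<bar> = 1"
      by (simp add: det_permute_columns permutes_swap_id sign_swap_id abs_mult)
    show "ennreal \<bar>det (matrix ?h)\<bar> * (\<integral>\<^sup>+x. g (?h x) \<partial>lborel) = (\<integral>\<^sup>+x. g x \<partial>lborel)"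
      using nn_integral_swap[OF g] 1 by simp
  next
    fix m n :: 'n and g :: "real^'n \<Rightarrow> ennreal"
    assume g: "g \<in> borel_measurable borel" and mn: "m \<noteq> n"
    let ?h = "\<lambda>v::real^'n. \<chi> i. if i = m then v $ m + v $ n else v $ i"
    show "ennreal \<bar>det (matrix ?h)\<bar> * (\<integral>\<^sup>+x. g (?h x) \<partial>lborel) = (\<integral>\<^sup>+x. g x \<partial>lborel)"
      using nn_integral_shear[OF mn g] det_shear[OF mn] by simp
  qed
  with g det show ?thesis by blast
qed

text \<open>The segment from the identity to \<open>A\<close> consists of matrices with a positive
  quadratic form, hence invertible ones, so the determinant keeps along it the sign it has at the
  identity.\<close>

lemma pos_def_imp_det_pos:
  fixes A :: "real^'n^'n"
  assumes "pos_def A"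
  shows "det A > 0"
proof (rule ccontr)
  assume neg: "\<not> det A > 0"
  define f where "f = (\<lambda>t::real. det (t *\<^sub>R A + (1 - t) *\<^sub>R mat 1))"
  have cont: "continuous_on {0..1} f"
    unfolding f_def det_def by (intro continuous_intros)
  have "f 0 = 1" "f 1 = det A" by (auto simp: f_def)
  then have "\<exists>t. 0 \<le> t \<and> t \<le> 1 \<and> f t = 0"
    using neg by (intro IVT2') (auto simp: cont)
  then obtain t where t: "0 \<le> t" "t \<le> 1" "f t = 0" by blast
  then obtain x where x: "x \<noteq> 0" "(t *\<^sub>R A + (1 - t) *\<^sub>R mat 1) *v x = 0"
    unfolding f_def by (metis invertible_det_nz invertible_left_inverse matrix_left_invertible_ker)
  have "x \<bullet> ((t *\<^sub>R A + (1 - t) *\<^sub>R mat 1) *v x) = t * (x \<bullet> (A *v x)) + (1 - t) * (x \<bullet> x)"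
    by (simp add: matrix_vector_mult_add_rdistrib scaleR_matrix_vector_assoc[symmetric] inner_simps)
  moreover have "\<dots> > 0"
  proof (cases "t = 0")
    case False
    then have "t * (x \<bullet> (A *v x)) > 0" using t x assms by (auto simp: pos_def_def)
    moreover have "(1 - t) * (x \<bullet> x) \<ge> 0" using t by simp
    ultimately show ?thesis by linarith
  qed (use x in simp)
  ultimately show False using x by simp
qed

lemma inner_congruence:
  fixes A M :: "real^'n^'n"
  shows "x \<bullet> ((transpose M ** A ** M) *v y) = (M *v x) \<bullet> (A *v (M *v y))"
proof -
  have "(transpose M ** A ** M) *v y = (A *v (M *v y)) v* M"
    by (simp only: matrix_vector_mul_assoc[symmetric] transpose_matrix_vector)
  then show ?thesis by (simp only: dot_lmul_matrix inner_commute[of x] inner_commute[of "M *v x"])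
qed

text \<open>Gram-Schmidt for the inner product x . A y; the columns of \<open>M\<close> are an
  orthonormal basis for it.\<close>

lemma pos_def_congruence_identity:
  fixes A :: "real^'n^'n"
  assumes A: "pos_def A"
  obtains M :: "real^'n^'n" where "transpose M ** A ** M = mat 1"
proof -
  have sym: "x \<bullet> (A *v y) = y \<bullet> (A *v x)" for x y
    using A unfolding pos_def_def by (metis dot_lmul_matrix inner_commute transpose_matrix_vector)
  have "\<exists>f. \<forall>i\<in>S. \<forall>j\<in>S. f i \<bullet> (A *v f j) = (if i = j then 1 else 0)" for S :: "'n set"
    using finite[of S]
  proof (induction S rule: finite_induct)
    case (insert s S)
    then obtain f where f: "\<And>i j. i \<in> S \<Longrightarrow> j \<in> S \<Longrightarrow> f i \<bullet> (A *v f j) = (if i = j then 1 else 0)"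
      by blast
    let ?V = "(\<lambda>j. A *v f j) ` S"
    \<comment> \<open>There are fewer than n vectors \<open>A *v f j\<close>, so some nonzero
      \<open>x\<close> is Euclidean-orthogonal to all of them; this is orthogonality to every
      \<open>f j\<close> in the inner product of \<open>A\<close>.\<close>
    have "card S < CARD('n)" using insert by (metis card_mono card_seteq finite UNIV_I not_le top_greatest)
    then have "dim ?V < DIM(real^'n)"
      using dim_le_card'[of ?V] card_image_le[of S "\<lambda>j. A *v f j"] by simp
    then obtain x where x: "x \<noteq> 0" "\<And>y. y \<in> span ?V \<Longrightarrow> orthogonal x y"
      using orthogonal_to_subspace_exists by blast
    have xA: "x \<bullet> (A *v x) > 0" using A x by (auto simp: pos_def_def)
    have xf: "x \<bullet> (A *v f j) = 0" if "j \<in> S" for j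
      using x(2)[of "A *v f j"] that by (auto simp: orthogonal_def intro: span_base)
    define y where "y = (1 / sqrt (x \<bullet> (A *v x))) *\<^sub>R x"
    have yy: "y \<bullet> (A *v y) = 1"
      using xA by (simp add: y_def matrix_vector_mult_scaleR)
    have yf: "y \<bullet> (A *v f j) = 0" if "j \<in> S" for j
      using xf[OF that] by (simp add: y_def)
    have fy: "f j \<bullet> (A *v y) = 0" if "j \<in> S" for j
      using yf[OF that] sym by simp
    have "\<forall>i\<in>insert s S. \<forall>j\<in>insert s S. (f(s := y)) i \<bullet> (A *v (f(s := y)) j) = (if i = j then 1 else 0)"
      using insert(2) f yy yf fy by auto
    then show ?case by blast
  qed simp
  from this[of UNIV] obtain f :: "'n \<Rightarrow> real^'n" where f: "\<And>i j. f i \<bullet> (A *v f j) = (if i = j then 1 else 0)"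
    by auto
  define M where "M = (\<chi> i j. f j $ i)"
  have col: "M *v axis j 1 = f j" for j
    by (simp add: M_def vec_eq_iff matrix_vector_mult_basis column_def)
  have "(transpose M ** A ** M) $ i $ j = mat 1 $ i $ j" for i j
  proof -
    have "(transpose M ** A ** M) $ i $ j = axis i 1 \<bullet> ((transpose M ** A ** M) *v axis j 1)"
      unfolding matrix_vector_mult_basis by (simp add: column_def inner_axis')
    also have "\<dots> = (M *v axis i 1) \<bullet> (A *v (M *v axis j 1))"
      by (rule inner_congruence)
    also have "\<dots> = mat 1 $ i $ j" by (simp add: col f mat_def)
    finally show ?thesis .
  qed
  then have "transpose M ** A ** M = mat 1" by (simp add: vec_eq_iff)
  then show ?thesis by (rule that)
qed

lemma nn_integral_std_gaussian:
  "(\<integral>\<^sup>+z. ennreal (exp (- (z \<bullet> z) / 2)) \<partial>(lborel :: (real^'n) measure)) = ennreal ((2 * pi) powr (real CARD('n) / 2))"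
proof -
  have 1: "(\<integral>\<^sup>+x. ennreal (exp (- x\<^sup>2 / 2)) \<partial>lborel) = ennreal (sqrt (2 * pi))"
  proof -
    have eq: "exp (- x\<^sup>2 / 2) = sqrt (2 * pi) * std_normal_density x" for x
      by (simp add: std_normal_density_def)
    have "(\<integral>\<^sup>+x. ennreal (exp (- x\<^sup>2 / 2)) \<partial>lborel) = ennreal (sqrt (2 * pi)) * (\<integral>\<^sup>+x. ennreal (std_normal_density x) \<partial>lborel)"
      unfolding eq by (simp add: ennreal_mult nn_integral_cmult)
    also have "(\<integral>\<^sup>+x. ennreal (std_normal_density x) \<partial>lborel) = 1"
      by (subst nn_integral_eq_integral) auto
    finally show ?thesis by simp
  qed
  have "ennreal (exp (- (z \<bullet> z) / 2)) = (\<Prod>b\<in>Basis. ennreal (exp (- (z \<bullet> b)\<^sup>2 / 2)))" for z :: "real^'n"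
    unfolding euclidean_inner[of z z]
    by (simp add: prod_ennreal exp_sum[symmetric] sum_negf sum_divide_distrib power2_eq_square)
  then have "(\<integral>\<^sup>+z. ennreal (exp (- (z \<bullet> z) / 2)) \<partial>(lborel :: (real^'n) measure))
     = (\<Prod>b\<in>(Basis :: (real^'n) set). (\<integral>\<^sup>+x. ennreal (exp (- x\<^sup>2 / 2)) \<partial>lborel))"
    by (simp only:) (rule nn_integral_lborel_prod, auto)
  also have "\<dots> = ennreal (sqrt (2 * pi) ^ CARD('n))"
    unfolding 1 by (simp add: ennreal_power)
  also have "sqrt (2 * pi) ^ CARD('n) = (2 * pi) powr (real CARD('n) / 2)"
    by (simp add: powr_half_sqrt[symmetric] powr_realpow[symmetric] powr_powr)
  finally show ?thesis .
qed

text \<open>The substitution u = M z with M^T A M = 1 turns the exponent into that of the standard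
  Gaussian, and taking determinants in that identity gives |det M| = 1 / sqrt (det A).\<close>

lemma has_bochner_integral_gaussian:
  fixes A :: "real^'n^'n"
  assumes A: "pos_def A"
  shows "has_bochner_integral lborel (\<lambda>u. exp (- (u \<bullet> (A *v u)) / 2))
    ((2 * pi) powr (real CARD('n) / 2) / sqrt (det A))"
proof -
  obtain M :: "real^'n^'n" where M: "transpose M ** A ** M = mat 1"
    using pos_def_congruence_identity[OF A] .
  have "det (transpose M ** A ** M) = 1" unfolding M by simp
  then have detM: "(det M)\<^sup>2 * det A = 1"
    by (simp add: det_mul power2_eq_square ac_simps)
  then have nz: "det M \<noteq> 0" by auto
  have dA: "det A > 0" by (rule pos_def_imp_det_pos[OF A])
  have "\<bar>det M\<bar> = sqrt ((det M)\<^sup>2)" by simp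
  also have "(det M)\<^sup>2 = 1 / det A" using detM dA by (simp add: field_simps)
  finally have absdet: "\<bar>det M\<bar> = 1 / sqrt (det A)" by (simp add: real_sqrt_divide)
  have quad: "(M *v z) \<bullet> (A *v (M *v z)) = z \<bullet> z" for z
  proof -
    have "(M *v z) \<bullet> (A *v (M *v z)) = z \<bullet> ((transpose M ** A ** M) *v z)"
      by (rule inner_congruence[symmetric])
    then show ?thesis unfolding M by simp
  qed
  have meas [measurable]: "(\<lambda>u. exp (- (u \<bullet> (A *v u)) / 2)) \<in> borel_measurable borel"
    by (intro borel_measurable_continuous_onI continuous_on_exp continuous_on_divide continuous_on_minus
        continuous_on_inner continuous_on_id continuous_on_const linear_continuous_on
        matrix_vector_mul_bounded_linear) auto
  have "(\<integral>\<^sup>+u. ennreal (exp (- (u \<bullet> (A *v u)) / 2)) \<partial>lborel)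
     = ennreal \<bar>det (matrix ((*v) M))\<bar> * (\<integral>\<^sup>+z. ennreal (exp (- ((M *v z) \<bullet> (A *v (M *v z))) / 2)) \<partial>lborel)"
    by (rule nn_integral_linear[symmetric, OF matrix_vector_mul_linear]) (simp add: nz, use meas in measurable)
  also have "\<dots> = ennreal (1 / sqrt (det A)) * ennreal ((2 * pi) powr (real CARD('n) / 2))"
    unfolding quad nn_integral_std_gaussian by (simp add: absdet)
  also have "\<dots> = ennreal ((2 * pi) powr (real CARD('n) / 2) / sqrt (det A))"
    using dA by (simp add: ennreal_mult[symmetric])
  finally show ?thesis
    using dA meas by (intro has_bochner_integral_nn_integral) auto
qed


section \<open>Functions of class \<open>C\<^sup>k\<close>\<close>

lemma dir_deriv_eq:
  assumes "(f has_derivative f') (at x)"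
  shows "dir_deriv f v x = f' v"
  using frechet_derivative_at[OF assms] by (simp add: dir_deriv_def)

lemma dir_deriv_has_derivative:
  assumes "f differentiable (at x)"
  shows "(f has_derivative (\<lambda>v. dir_deriv f v x)) (at x)"
  using assms by (simp add: dir_deriv_def frechet_derivative_works)

lemma dir_deriv_expand:
  fixes f :: "'a::euclidean_space \<Rightarrow> 'b::real_normed_vector"
  assumes "f differentiable (at x)"
  shows "dir_deriv f v x = (\<Sum>b\<in>Basis. (v \<bullet> b) *\<^sub>R dir_deriv f b x)"
proof -
  have lin: "linear (\<lambda>v. dir_deriv f v x)"
    using dir_deriv_has_derivative[OF assms] by (rule has_derivative_linear)
  have "dir_deriv f v x = dir_deriv f (\<Sum>b\<in>Basis. (v \<bullet> b) *\<^sub>R b) x"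
    by (simp add: euclidean_representation)
  also have "\<dots> = (\<Sum>b\<in>Basis. (v \<bullet> b) *\<^sub>R dir_deriv f b x)"
    by (simp add: linear_sum[OF lin] linear_cmul[OF lin])
  finally show ?thesis .
qed

text \<open>Derivatives at points of an open set depend only on the values there. This lets formulas
  valid only on \<open>U\<close>, such as Cramer's rule, replace a function.\<close>

lemma Ck_on_cong_imp:
  assumes U: "open U"
  shows "Ck_on k U f \<Longrightarrow> (\<And>x. x \<in> U \<Longrightarrow> f x = g x) \<Longrightarrow> Ck_on k U g"
proof (induction k arbitrary: f g)
  case 0
  then show ?case using continuous_on_cong[of U U f g] by simp
next
  case (Suc k)
  have d: "(g has_derivative (\<lambda>v. dir_deriv f v x)) (at x)" if "x \<in> U" for x
    using Suc.prems that
    by (intro has_derivative_transform_within_open[OF dir_deriv_has_derivative U that]) auto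
  show ?case
    unfolding Ck_on.simps
  proof (intro conjI ballI)
    fix x assume "x \<in> U" then show "g differentiable at x"
      using d unfolding differentiable_def by blast
  next
    fix b :: 'a assume b: "b \<in> Basis"
    show "Ck_on k U (dir_deriv g b)"
      by (rule Suc.IH[of "dir_deriv f b"]) (use Suc.prems b dir_deriv_eq[OF d] in auto)
  qed
qed

text \<open>Most closure properties below come from this rule by induction on \<open>k\<close>: the
  derivative is exhibited explicitly, and its coefficients are of class \<open>k\<close> by the
  induction hypothesis.\<close>

lemma Ck_on_SucI:
  assumes U: "open U" and d: "\<And>x. x \<in> U \<Longrightarrow> (f has_derivative f' x) (at x)"
    and C: "\<And>b. b \<in> Basis \<Longrightarrow> Ck_on k U (\<lambda>x. f' x b)"
  shows "Ck_on (Suc k) U f"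
  unfolding Ck_on.simps
proof (intro conjI ballI)
  fix x assume "x \<in> U" then show "f differentiable at x"
    using d unfolding differentiable_def by blast
next
  fix b :: 'a assume b: "b \<in> Basis"
  show "Ck_on k U (dir_deriv f b)"
    by (rule Ck_on_cong_imp[OF U C[OF b]]) (simp add: dir_deriv_eq[OF d])
qed

lemma Ck_on_imp_continuous_on: "Ck_on k U f \<Longrightarrow> continuous_on U f"
  by (cases k) (auto intro!: continuous_at_imp_continuous_on differentiable_imp_continuous_within)

lemma Ck_on_SucD: "Ck_on (Suc k) U f \<Longrightarrow> Ck_on k U f"
proof (induction k arbitrary: f)
  case 0
  then show ?case using Ck_on_imp_continuous_on[of "Suc 0" U f] by simp
next
  case (Suc k)
  then show ?case by (simp only: Ck_on.simps) blast
qed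

lemma Ck_on_subset: "Ck_on k U f \<Longrightarrow> V \<subseteq> U \<Longrightarrow> Ck_on k V f"
  by (induction k arbitrary: f) (auto intro: continuous_on_subset)

lemma Ck_on_const: "Ck_on k U (\<lambda>x. c)"
proof (induction k arbitrary: c)
  case (Suc k)
  have "dir_deriv (\<lambda>x. c) b = (\<lambda>x. 0)" for b :: 'a
    by (rule ext, rule dir_deriv_eq) (rule has_derivative_const)
  then show ?case using Suc[of 0] by simp
qed simp

lemma Ck_on_linear:
  assumes U: "open U" and L: "bounded_linear L"
  shows "Ck_on k U f \<Longrightarrow> Ck_on k U (\<lambda>x. L (f x))"
proof (induction k arbitrary: f)
  case 0
  then show ?case by (simp add: bounded_linear.continuous_on[OF L])
next
  case (Suc k)
  have d: "((\<lambda>x. L (f x)) has_derivative (\<lambda>v. L (dir_deriv f v x))) (at x)" if "x \<in> U" for x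
    using Suc.prems that by (intro bounded_linear.has_derivative[OF L] dir_deriv_has_derivative) auto
  show ?case
  proof (rule Ck_on_SucI[OF U d])
    fix b :: 'a assume b: "b \<in> Basis"
    show "Ck_on k U (\<lambda>x. L (dir_deriv f b x))"
      using Suc b by auto
  qed
qed

lemma Ck_on_add:
  assumes U: "open U"
  shows "Ck_on k U f \<Longrightarrow> Ck_on k U g \<Longrightarrow> Ck_on k U (\<lambda>x. f x + g x)"
proof (induction k arbitrary: f g)
  case 0
  then show ?case by (simp add: continuous_on_add)
next
  case (Suc k)
  have d: "((\<lambda>x. f x + g x) has_derivative (\<lambda>v. dir_deriv f v x + dir_deriv g v x)) (at x)"
    if "x \<in> U" for x
    using Suc.prems that by (intro has_derivative_add dir_deriv_has_derivative) auto
  show ?case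
  proof (rule Ck_on_SucI[OF U d])
    fix b :: 'a assume b: "b \<in> Basis"
    show "Ck_on k U (\<lambda>x. dir_deriv f b x + dir_deriv g b x)"
      using Suc b by auto
  qed
qed

lemma Ck_on_sum:
  assumes U: "open U" and "\<And>i. i \<in> I \<Longrightarrow> Ck_on k U (f i)"
  shows "Ck_on k U (\<lambda>x. \<Sum>i\<in>I. f i x)"
  using assms(2) by (induction I rule: infinite_finite_induct) (auto intro: Ck_on_const Ck_on_add[OF U])

text \<open>In the product rule each factor also appears undifferentiated, where order
  \<open>k\<close> is enough; \<open>Ck_on_SucD\<close> lowers the order.\<close>

lemma Ck_on_mult:
  fixes f g :: "'a::euclidean_space \<Rightarrow> real"
  assumes U: "open U"
  shows "Ck_on k U f \<Longrightarrow> Ck_on k U g \<Longrightarrow> Ck_on k U (\<lambda>x. f x * g x)"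
proof (induction k arbitrary: f g)
  case 0
  then show ?case by (simp add: continuous_on_mult)
next
  case (Suc k)
  have d: "((\<lambda>x. f x * g x) has_derivative (\<lambda>v. f x * dir_deriv g v x + dir_deriv f v x * g x)) (at x)"
    if "x \<in> U" for x
    using Suc.prems that by (intro has_derivative_mult dir_deriv_has_derivative) auto
  show ?case
  proof (rule Ck_on_SucI[OF U d])
    fix b :: 'a assume b: "b \<in> Basis"
    show "Ck_on k U (\<lambda>x. f x * dir_deriv g b x + dir_deriv f b x * g x)"
      using Suc.prems b by (intro Ck_on_add[OF U] Suc.IH) (auto intro: Ck_on_SucD)
  qed
qed

lemma Ck_on_prod:
  fixes f :: "'i \<Rightarrow> 'a::euclidean_space \<Rightarrow> real"
  assumes U: "open U" and "\<And>i. i \<in> I \<Longrightarrow> Ck_on k U (f i)"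
  shows "Ck_on k U (\<lambda>x. \<Prod>i\<in>I. f i x)"
  using assms(2) by (induction I rule: infinite_finite_induct) (auto intro: Ck_on_const Ck_on_mult[OF U])

lemma Ck_on_inverse:
  fixes f :: "'a::euclidean_space \<Rightarrow> real"
  assumes U: "open U" and nz: "\<And>x. x \<in> U \<Longrightarrow> f x \<noteq> 0"
  shows "Ck_on k U f \<Longrightarrow> Ck_on k U (\<lambda>x. inverse (f x))"
proof (induction k)
  case 0
  then show ?case using nz by (auto intro: continuous_on_inverse)
next
  case (Suc k)
  have d: "((\<lambda>x. inverse (f x)) has_derivative (\<lambda>v. - (inverse (f x) * dir_deriv f v x * inverse (f x)))) (at x)"
    if "x \<in> U" for x
    using Suc.prems that nz by (intro Deriv.has_derivative_inverse dir_deriv_has_derivative) auto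
  show ?case
  proof (rule Ck_on_SucI[OF U d])
    fix b :: 'a assume b: "b \<in> Basis"
    have "Ck_on k U (\<lambda>x. - 1 * (inverse (f x) * dir_deriv f b x * inverse (f x)))"
      using Suc.prems b by (intro Ck_on_mult[OF U] Ck_on_const Suc.IH) (auto intro: Ck_on_SucD)
    then show "Ck_on k U (\<lambda>x. - (inverse (f x) * dir_deriv f b x * inverse (f x)))" by simp
  qed
qed

text \<open>A single differentiation suffices, without induction: the derivative is the reciprocal
  of \<open>f\<close> times a derivative of \<open>f\<close>, and reciprocals are already
  covered.\<close>

lemma Ck_on_ln:
  fixes f :: "'a::euclidean_space \<Rightarrow> real"
  assumes U: "open U" and pos: "\<And>x. x \<in> U \<Longrightarrow> f x > 0"
  shows "Ck_on k U f \<Longrightarrow> Ck_on k U (\<lambda>x. ln (f x))"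
proof (cases k)
  case 0
  assume "Ck_on k U f"
  then show ?thesis using pos 0 by (auto intro!: continuous_on_ln) (metis less_irrefl)
next
  case (Suc l)
  assume f: "Ck_on k U f"
  have d: "((\<lambda>x. ln (f x)) has_derivative (\<lambda>v. inverse (f x) * dir_deriv f v x)) (at x)"
    if "x \<in> U" for x
  proof -
    have "(f has_derivative (\<lambda>v. dir_deriv f v x)) (at x)"
      using f that Suc by (intro dir_deriv_has_derivative) auto
    then show ?thesis using pos[OF that]
      by (auto intro!: derivative_eq_intros simp: field_simps)
  qed
  have nz: "f x \<noteq> 0" if "x \<in> U" for x using pos[OF that] by simp
  show ?thesis
    unfolding Suc
  proof (rule Ck_on_SucI[OF U d])
    fix b :: 'a assume b: "b \<in> Basis"
    show "Ck_on l U (\<lambda>x. inverse (f x) * dir_deriv f b x)"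
      using f b Suc by (intro Ck_on_mult[OF U] Ck_on_inverse[OF U nz]) (auto intro: Ck_on_SucD)
  qed
qed

lemma Ck_on_matrix_entry:
  fixes A :: "'a::euclidean_space \<Rightarrow> real^'n^'m"
  assumes "open U" "Ck_on k U A"
  shows "Ck_on k U (\<lambda>x. A x $ i $ j)"
  using assms
  by (intro Ck_on_linear[OF _ bounded_linear_vec_nth] Ck_on_linear[OF _ bounded_linear_vec_nth])

lemma matrix_eq_sum_axis:
  fixes A :: "real^'n^'m"
  shows "A = (\<Sum>i\<in>UNIV. \<Sum>j\<in>UNIV. (A $ i $ j) *\<^sub>R axis i (axis j 1))"
proof -
  have "(\<Sum>i\<in>UNIV. \<Sum>j\<in>UNIV. (A $ i $ j) *\<^sub>R axis i (axis j 1)) $ a $ b = A $ a $ b" for a b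
  proof -
    have "(\<Sum>i\<in>UNIV. \<Sum>j\<in>UNIV. (A $ i $ j) *\<^sub>R axis i (axis j 1)) $ a $ b
        = (\<Sum>i\<in>UNIV. \<Sum>j\<in>UNIV. if i = a then (if j = b then A $ i $ j else 0) else 0)"
      unfolding sum_component by (intro sum.cong) (auto simp: axis_def)
    also have "\<dots> = (\<Sum>i\<in>UNIV. if i = a then A $ i $ b else 0)"
      by (rule sum.cong) auto
    finally show ?thesis by simp
  qed
  then show ?thesis by (simp add: vec_eq_iff)
qed

lemma Ck_on_matrixI:
  fixes A :: "'a::euclidean_space \<Rightarrow> real^'n^'m"
  assumes U: "open U" and A: "\<And>i j. Ck_on k U (\<lambda>x. A x $ i $ j)"
  shows "Ck_on k U A"
proof -
  have eq: "A = (\<lambda>x. \<Sum>i\<in>UNIV. \<Sum>j\<in>UNIV. (A x $ i $ j) *\<^sub>R axis i (axis j 1))"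
    by (rule ext) (rule matrix_eq_sum_axis)
  show ?thesis
    by (subst eq) (intro Ck_on_sum[OF U] Ck_on_linear[OF U bounded_linear_scaleR_left] A)
qed

lemma Ck_on_det:
  fixes A :: "'a::euclidean_space \<Rightarrow> real^'n^'n"
  assumes U: "open U" and A: "\<And>i j. Ck_on k U (\<lambda>x. A x $ i $ j)"
  shows "Ck_on k U (\<lambda>x. det (A x))"
  unfolding det_def
  by (intro Ck_on_sum[OF U] Ck_on_mult[OF U] Ck_on_const Ck_on_prod[OF U] A)

section \<open>Smoothness of the matrix inverse\<close>

lemma matrix_mult_matrix_inv:
  fixes A :: "real^'n^'n"
  assumes "invertible A"
  shows "A ** matrix_inv A = mat 1" "matrix_inv A ** A = mat 1"
proof -
  have "A ** matrix_inv A = mat 1 \<and> matrix_inv A ** A = mat 1"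
    using assms unfolding invertible_def matrix_inv_def by (rule someI_ex)
  then show "A ** matrix_inv A = mat 1" "matrix_inv A ** A = mat 1" by auto
qed

text \<open>Column \<open>j\<close> of the inverse solves A x = e_j, so Cramer's rule writes each
  entry as a quotient of determinants; smoothness of the inverse then reduces to that of
  determinants and reciprocals.\<close>

lemma matrix_inv_cramer:
  fixes A :: "real^'n^'n"
  assumes "det A \<noteq> 0"
  shows "matrix_inv A $ i $ j = det (\<chi> k l. if l = i then axis j 1 $ k else A $ k $ l) / det A"
proof -
  have "A *v (matrix_inv A *v axis j 1) = axis j 1"
    using assms by (simp add: matrix_vector_mul_assoc matrix_mult_matrix_inv invertible_det_nz)
  then have "matrix_inv A *v axis j 1 = (\<chi> k. det (\<chi> k' l. if l = k then axis j 1 $ k' else A $ k' $ l) / det A)"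
    by (rule iffD1[OF cramer[OF assms]])
  then have "(matrix_inv A *v axis j 1) $ i = det (\<chi> k l. if l = i then axis j 1 $ k else A $ k $ l) / det A"
    by simp
  then show ?thesis
    unfolding matrix_vector_mult_basis by (simp add: column_def)
qed

lemma Ck_on_matrix_inv:
  fixes A :: "'a::euclidean_space \<Rightarrow> real^'n^'n"
  assumes U: "open U" and A: "Ck_on k U A" and nz: "\<And>x. x \<in> U \<Longrightarrow> det (A x) \<noteq> 0"
  shows "Ck_on k U (\<lambda>x. matrix_inv (A x))"
proof (rule Ck_on_matrixI[OF U])
  fix i j
  have ent: "Ck_on k U (\<lambda>x. A x $ i $ j)" for i j by (rule Ck_on_matrix_entry[OF U A])
  have *: "Ck_on k U (\<lambda>x. det (\<chi> k l. if l = i then axis j 1 $ k else A x $ k $ l) * inverse (det (A x)))"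
  proof (intro Ck_on_mult[OF U] Ck_on_inverse[OF U nz] Ck_on_det[OF U] ent)
    fix a b
    show "Ck_on k U (\<lambda>x. (\<chi> k l. if l = i then axis j 1 $ k else A x $ k $ l) $ a $ b)"
      by (cases "b = i") (auto intro: Ck_on_const ent)
  qed
  have eq: "matrix_inv (A x) $ i $ j = det (\<chi> k l. if l = i then axis j 1 $ k else A x $ k $ l) * inverse (det (A x))" if "x \<in> U" for x
    by (rule trans[OF matrix_inv_cramer[OF nz[OF that]] divide_inverse])
  show "Ck_on k U (\<lambda>x. matrix_inv (A x) $ i $ j)"
    by (rule Ck_on_cong_imp[OF U *]) (rule eq[symmetric])
qed

section \<open>Second-order Taylor expansion along a segment\<close>

lemma inner_hessian:
  fixes f :: "real^'q \<Rightarrow> real"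
  shows "u \<bullet> (hessian f x *v u) =
    (\<Sum>i\<in>UNIV. \<Sum>j\<in>UNIV. u $ i * u $ j * dir_deriv (dir_deriv f (axis j 1)) (axis i 1) x)"
proof -
  have "u $ i * (hessian f x *v u) $ i = (\<Sum>j\<in>UNIV. u $ i * u $ j * dir_deriv (dir_deriv f (axis j 1)) (axis i 1) x)" for i
    unfolding matrix_vector_mult_def hessian_def
    by (simp add: sum_distrib_left mult.assoc mult.left_commute[of "dir_deriv _ _ _"] mult.commute[of "dir_deriv _ _ _"])
  then show ?thesis by (simp add: inner_vec_def)
qed

text \<open>The one-variable Maclaurin formula of order two, applied to the restriction of
  \<open>f\<close> to the segment.\<close>

lemma taylor_hessian:
  fixes f :: "real^'q \<Rightarrow> real"
  assumes f: "Ck_on 2 U f" and seg: "\<And>s. 0 \<le> s \<Longrightarrow> s \<le> 1 \<Longrightarrow> x + s *\<^sub>R u \<in> U"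
  obtains s where "0 < s" "s < 1"
    "f (x + u) = f x + dir_deriv f u x + (u \<bullet> (hessian f (x + s *\<^sub>R u) *v u)) / 2"
proof -
  have fd: "f differentiable (at y)" if "y \<in> U" for y
    using f that by (simp add: numeral_2_eq_2)
  have gd: "dir_deriv f (axis j 1) differentiable (at y)" if "y \<in> U" for y j
    using f that by (simp add: numeral_2_eq_2 axis_Basis)
  define D where "D = (\<lambda>(m::nat) s. if m = 0 then f (x + s *\<^sub>R u) else if m = 1
    then (\<Sum>j\<in>UNIV. u $ j * dir_deriv f (axis j 1) (x + s *\<^sub>R u))
    else u \<bullet> (hessian f (x + s *\<^sub>R u) *v u))"
  have line: "((\<lambda>s. x + s *\<^sub>R u) has_derivative (\<lambda>t. t *\<^sub>R u)) (at s)" for s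
    by (auto intro!: derivative_eq_intros)
  have along: "((\<lambda>s. h (x + s *\<^sub>R u)) has_real_derivative
      (\<Sum>i\<in>UNIV. u $ i * dir_deriv h (axis i 1) (x + s *\<^sub>R u))) (at s)"
    if "h differentiable (at (x + s *\<^sub>R u))" for h :: "real^'q \<Rightarrow> real" and s
  proof -
    have "((\<lambda>s. h (x + s *\<^sub>R u)) has_derivative (\<lambda>t. dir_deriv h (t *\<^sub>R u) (x + s *\<^sub>R u))) (at s)"
      by (rule has_derivative_compose[of "\<lambda>s. x + s *\<^sub>R u" "\<lambda>t. t *\<^sub>R u" s UNIV h
            "\<lambda>v. dir_deriv h v (x + s *\<^sub>R u)", OF line dir_deriv_has_derivative[OF that]])
    moreover have "dir_deriv h (t *\<^sub>R u) (x + s *\<^sub>R u) =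
        (\<Sum>i\<in>UNIV. u $ i * dir_deriv h (axis i 1) (x + s *\<^sub>R u)) * t" for t
      by (subst dir_deriv_expand[OF that]) (simp add: sum_Basis_vec inner_axis sum_distrib_left ac_simps)
    ultimately show ?thesis
      by (simp add: has_field_derivative_def mult_commute_abs)
  qed
  have "\<exists>t. 0 < t \<and> t < 1 \<and> f (x + 1 *\<^sub>R u) = (\<Sum>m<2. D m 0 / fact m * 1 ^ m) + D 2 t / fact 2 * 1 ^ 2"
  proof (rule Maclaurin)
    show "D 0 = (\<lambda>s. f (x + s *\<^sub>R u))" by (simp add: D_def)
    show "\<forall>m t. m < 2 \<and> 0 \<le> t \<and> t \<le> 1 \<longrightarrow> (D m has_real_derivative D (Suc m) t) (at t)"
    proof (intro allI impI)
      fix m :: nat and t :: real assume mt: "m < 2 \<and> 0 \<le> t \<and> t \<le> 1"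
      then have tU: "x + t *\<^sub>R u \<in> U" using seg by blast
      have "((\<lambda>s. \<Sum>j\<in>UNIV. u $ j * dir_deriv f (axis j 1) (x + s *\<^sub>R u)) has_real_derivative
        (\<Sum>j\<in>UNIV. u $ j * (\<Sum>i\<in>UNIV. u $ i * dir_deriv (dir_deriv f (axis j 1)) (axis i 1) (x + t *\<^sub>R u)))) (at t)"
        by (intro DERIV_sum DERIV_cmult along gd tU)
      \<comment> \<open>Only the two sums are exchanged, so that the partial derivatives match the
        order fixed in \<open>hessian\<close>.\<close>
      also have "(\<Sum>j\<in>UNIV. u $ j * (\<Sum>i\<in>UNIV. u $ i * dir_deriv (dir_deriv f (axis j 1)) (axis i 1) (x + t *\<^sub>R u)))
        = u \<bullet> (hessian f (x + t *\<^sub>R u) *v u)"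
        unfolding inner_hessian sum_distrib_left by (subst sum.swap) (simp add: ac_simps)
      finally have 1: "(D 1 has_real_derivative D 2 t) (at t)"
        by (simp add: D_def)
      have 0: "(D 0 has_real_derivative D 1 t) (at t)"
        using along[OF fd[OF tU]] by (simp add: D_def)
      from mt have "m = 0 \<or> m = 1" by auto
      with 0 1 show "(D m has_real_derivative D (Suc m) t) (at t)" by (auto simp: numeral_2_eq_2)
    qed
  qed auto
  then obtain t where t: "0 < t" "t < 1" "f (x + 1 *\<^sub>R u) = (\<Sum>m<2. D m 0 / fact m * 1 ^ m) + D 2 t / fact 2 * 1 ^ 2"
    by blast
  have "x \<in> U" using seg[of 0] by simp
  then have "D 1 0 = dir_deriv f u x"
    by (subst dir_deriv_expand[OF fd]) (simp_all add: sum_Basis_vec D_def inner_axis)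
  then have "f (x + u) = f x + dir_deriv f u x + (u \<bullet> (hessian f (x + t *\<^sub>R u) *v u)) / 2"
    using t(3) by (simp add: numeral_2_eq_2 D_def)
  with t show ?thesis by (intro that[of t]) auto
qed


section \<open>Laplace approximation for a quadratically separated contrast\<close>

lemma det_scaleR:
  fixes A :: "real^'n^'n"
  shows "det (c *\<^sub>R A) = c ^ CARD('n) * det A"
proof -
  have "c *\<^sub>R A = (\<chi> i. c *s A $ i)" by (simp add: vec_eq_iff)
  then show ?thesis using det_rows_mul[of "\<lambda>_. c" "\<lambda>i. A $ i"] by simp
qed

lemma pos_def_scaleR:
  assumes "pos_def A" "c > 0"
  shows "pos_def (c *\<^sub>R A)"
proof -
  have "transpose (c *\<^sub>R A) = c *\<^sub>R transpose A" by (simp add: transpose_def vec_eq_iff)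
  moreover have "x \<bullet> ((c *\<^sub>R A) *v x) = c * (x \<bullet> (A *v x))" for x
    by (simp add: scaleR_matrix_vector_assoc[symmetric])
  ultimately show ?thesis using assms by (simp add: pos_def_def)
qed

lemma pos_def_mat_1: "pos_def (mat 1)"
  by (simp add: pos_def_def)

lemma tendsto_quadratic_form:
  fixes A :: "'k \<Rightarrow> real^'n^'n"
  assumes "(A \<longlongrightarrow> B) F"
  shows "((\<lambda>k. u \<bullet> (A k *v u)) \<longlongrightarrow> u \<bullet> (B *v u)) F"
proof -
  have "((\<lambda>k. u $ i * (\<Sum>j\<in>UNIV. A k $ i $ j * u $ j)) \<longlongrightarrow> u $ i * (\<Sum>j\<in>UNIV. B $ i $ j * u $ j)) F" for i
    by (intro tendsto_mult tendsto_sum tendsto_const tendsto_vec_nth assms)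
  then show ?thesis
    unfolding inner_vec_def matrix_vector_mult_def by (simp add: tendsto_sum)
qed

lemma tendsto_det:
  fixes A :: "'k \<Rightarrow> real^'n^'n"
  assumes "(A \<longlongrightarrow> B) F"
  shows "((\<lambda>k. det (A k)) \<longlongrightarrow> det B) F"
  unfolding det_def by (intro tendsto_sum tendsto_mult tendsto_const tendsto_prod tendsto_vec_nth assms)

text \<open>The Gaussian integral for the matrix 2 a times the identity; with a = \<kappa> / 4 it
  supplies the majorant for dominated convergence.\<close>

lemma integrable_exp_neg_norm_square:
  fixes a :: real
  assumes "a > 0"
  shows "integrable lborel (\<lambda>u::real^'n. exp (- a * (norm u)\<^sup>2))"
proof -
  have "pos_def ((2 * a) *\<^sub>R (mat 1 :: real^'n^'n))"
    using assms by (intro pos_def_scaleR pos_def_mat_1) simp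
  from has_bochner_integral_gaussian[OF this]
  have "integrable lborel (\<lambda>u::real^'n. exp (- (u \<bullet> (((2 * a) *\<^sub>R mat 1) *v u)) / 2))"
    by (rule integrable.intros)
  then show ?thesis
    by (simp add: scaleR_matrix_vector_assoc[symmetric] power2_norm_eq_inner)
qed

lemma integral_lborel_affine:
  fixes h :: "real^'n \<Rightarrow> real"
  assumes h [measurable]: "h \<in> borel_measurable borel" and c: "c > 0"
  shows "(\<integral>x. h x \<partial>lborel) = c ^ CARD('n) * (\<integral>u. h (t + c *\<^sub>R u) \<partial>lborel)"
proof -
  have "(\<integral>x. h x \<partial>lborel) = (\<integral>x. h x \<partial>density (distr lborel borel (\<lambda>x. t + c *\<^sub>R x)) (\<lambda>_. ennreal (\<bar>c\<bar>^DIM(real^'n))))"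
    using lborel_affine[of c t] c by simp
  also have "\<dots> = c ^ CARD('n) * (\<integral>u. h (t + c *\<^sub>R u) \<partial>lborel)"
    using c by (subst integral_density) (simp_all add: integral_distr)
  finally show ?thesis .
qed

text \<open>Isolates what the Laplace argument uses of the model: a contrast affine in a statistic
  that ranges over any Euclidean space, and its quadratic separation [C1](a) on all of
  \<open>\<Theta>\<close> at the population value \<open>Q0\<close>. The open set \<open>U\<close>
  gives room for derivatives at boundary points of \<open>\<Theta>\<close>.\<close>

locale quadratic_contrast =
  fixes \<Theta> U :: "(real^'q) set" and g0 :: "real^'q \<Rightarrow> real" and g :: "real^'q \<Rightarrow> 'v::euclidean_space"
    and \<theta>0 :: "real^'q" and Q0 :: 'v and \<kappa> :: real
  assumes U: "open U" "\<Theta> \<subseteq> U" and compact: "compact \<Theta>" and convex: "convex \<Theta>"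
    and interior: "\<theta>0 \<in> interior \<Theta>"
    and g0: "Ck_on 2 U g0" and g: "Ck_on 2 U g"
    and \<kappa>: "\<kappa> > 0"
    and contrast: "\<And>\<theta>. \<theta> \<in> \<Theta> \<Longrightarrow> (g0 \<theta> + Q0 \<bullet> g \<theta>) - (g0 \<theta>0 + Q0 \<bullet> g \<theta>0) \<le> - \<kappa> * (norm (\<theta> - \<theta>0))\<^sup>2"
begin

definition f :: "'v \<Rightarrow> real^'q \<Rightarrow> real" where
  "f Q \<theta> = g0 \<theta> + Q \<bullet> g \<theta>"

lemma Ck_on_f: "Ck_on 2 U (f Q)"
  unfolding f_def by (intro Ck_on_add[OF U(1)] g0 Ck_on_linear[OF U(1) bounded_linear_inner_right g])

lemma differentiable:
  assumes "\<theta> \<in> U" "b \<in> Basis"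
  shows "g0 differentiable (at \<theta>)" "g differentiable (at \<theta>)"
    "dir_deriv g0 b differentiable (at \<theta>)" "dir_deriv g b differentiable (at \<theta>)"
  using g0 g assms by (auto simp: numeral_2_eq_2)

lemma f_differentiable: "\<theta> \<in> U \<Longrightarrow> f Q differentiable (at \<theta>)"
  using Ck_on_f[of Q] by (simp add: numeral_2_eq_2)

lemma dir_deriv_f:
  assumes "\<theta> \<in> U"
  shows "dir_deriv (f Q) v \<theta> = dir_deriv g0 v \<theta> + Q \<bullet> dir_deriv g v \<theta>"
  unfolding f_def
  by (rule dir_deriv_eq) (intro has_derivative_add has_derivative_inner_right dir_deriv_has_derivative
      differentiable[OF assms axis_Basis])

lemma dir_deriv2_f:
  assumes th: "\<theta> \<in> U" and b: "b \<in> Basis"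
  shows "dir_deriv (dir_deriv (f Q) b) v \<theta> = dir_deriv (dir_deriv g0 b) v \<theta> + Q \<bullet> dir_deriv (dir_deriv g b) v \<theta>"
proof (rule dir_deriv_eq)
  have "((\<lambda>\<theta>. dir_deriv g0 b \<theta> + Q \<bullet> dir_deriv g b \<theta>) has_derivative
      (\<lambda>v. dir_deriv (dir_deriv g0 b) v \<theta> + Q \<bullet> dir_deriv (dir_deriv g b) v \<theta>)) (at \<theta>)"
    by (intro has_derivative_add has_derivative_inner_right dir_deriv_has_derivative
      differentiable[OF th b])
  then show "(dir_deriv (f Q) b has_derivative
      (\<lambda>v. dir_deriv (dir_deriv g0 b) v \<theta> + Q \<bullet> dir_deriv (dir_deriv g b) v \<theta>)) (at \<theta>)"
    by (rule has_derivative_transform_within_open[OF _ U(1) th]) (simp add: dir_deriv_f)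
qed

text \<open>By \<open>dir_deriv2_f\<close> every entry is affine in the statistic with coefficients
  continuous in \<theta>, so the Hessian is jointly continuous in both arguments.\<close>

lemma tendsto_hessian:
  assumes Q: "(Q \<longlongrightarrow> Q') F" and t: "(t \<longlongrightarrow> \<theta>) F" and th: "\<theta> \<in> U"
  shows "((\<lambda>k. hessian (f (Q k)) (t k)) \<longlongrightarrow> hessian (f Q') \<theta>) F"
proof -
  have ev: "eventually (\<lambda>k. t k \<in> U) F"
    using topological_tendstoD[OF t U(1) th] .
  have "((\<lambda>k. hessian (f (Q k)) (t k) $ i $ j) \<longlongrightarrow> hessian (f Q') \<theta> $ i $ j) F" for i j
  proof -
    have c: "isCont (dir_deriv (dir_deriv g0 (axis j 1)) (axis i 1)) \<theta>"
      "isCont (dir_deriv (dir_deriv g (axis j 1)) (axis i 1)) \<theta>"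
      using g0 g th axis_Basis[of i] axis_Basis[of j] U(1)
      by (auto simp: numeral_2_eq_2 continuous_on_eq_continuous_at)
    have "((\<lambda>k. dir_deriv (dir_deriv g0 (axis j 1)) (axis i 1) (t k)
        + Q k \<bullet> dir_deriv (dir_deriv g (axis j 1)) (axis i 1) (t k)) \<longlongrightarrow> hessian (f Q') \<theta> $ i $ j) F"
      by (auto simp: hessian_def dir_deriv2_f[OF th axis_Basis]
          intro!: tendsto_intros Q isCont_tendsto_compose[OF c(1) t] isCont_tendsto_compose[OF c(2) t])
    then show ?thesis
    proof (rule Lim_transform_eventually)
      show "eventually (\<lambda>k. dir_deriv (dir_deriv g0 (axis j 1)) (axis i 1) (t k)
        + Q k \<bullet> dir_deriv (dir_deriv g (axis j 1)) (axis i 1) (t k) = hessian (f (Q k)) (t k) $ i $ j) F"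
        using ev by eventually_elim (simp add: hessian_def dir_deriv2_f[OF _ axis_Basis])
    qed
  qed
  then show ?thesis by (intro vec_tendstoI)
qed

text \<open>Mean value inequality: the partial derivatives are continuous and hence bounded on the
  compact set, and convexity keeps the segment to \<open>\<theta>0\<close> inside it.\<close>

lemma g_lipschitz:
  obtains K where "K \<ge> 0" "\<And>\<theta>. \<theta> \<in> \<Theta> \<Longrightarrow> norm (g \<theta> - g \<theta>0) \<le> K * norm (\<theta> - \<theta>0)"
proof -
  have "\<exists>B. \<forall>\<theta>\<in>\<Theta>. norm (dir_deriv g b \<theta>) \<le> B" if "b \<in> Basis" for b
  proof -
    have "continuous_on \<Theta> (dir_deriv g b)"
      using g that by (intro continuous_on_subset[OF Ck_on_imp_continuous_on[of 1] U(2)]) (auto simp: numeral_2_eq_2)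
    then have "bounded (dir_deriv g b ` \<Theta>)"
      using compact by (intro compact_imp_bounded compact_continuous_image)
    then show ?thesis unfolding bounded_iff by blast
  qed
  then obtain B where B: "\<And>b \<theta>. b \<in> Basis \<Longrightarrow> \<theta> \<in> \<Theta> \<Longrightarrow> norm (dir_deriv g b \<theta>) \<le> B b" by metis
  have th0: "\<theta>0 \<in> \<Theta>" using interior interior_subset by blast
  have B0: "B b \<ge> 0" if "b \<in> Basis" for b
    using B[OF that th0] norm_ge_zero order_trans by blast
  define K where "K = sum B Basis"
  have "K \<ge> 0" unfolding K_def by (intro sum_nonneg B0)
  moreover have "norm (g \<theta> - g \<theta>0) \<le> K * norm (\<theta> - \<theta>0)" if "\<theta> \<in> \<Theta>" for \<theta>
  proof (rule differentiable_bound[where f'="\<lambda>x v. dir_deriv g v x", OF convex _ _ that th0])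
    fix x assume x: "x \<in> \<Theta>"
    then have xU: "x \<in> U" using U by blast
    show "(g has_derivative (\<lambda>v. dir_deriv g v x)) (at x within \<Theta>)"
      by (rule has_derivative_at_withinI) (intro dir_deriv_has_derivative differentiable[OF xU axis_Basis])
    show "onorm (\<lambda>v. dir_deriv g v x) \<le> K"
    proof (rule onorm_le)
      fix v
      have "norm (dir_deriv g v x) = norm (\<Sum>b\<in>Basis. (v \<bullet> b) *\<^sub>R dir_deriv g b x)"
        by (subst dir_deriv_expand) (auto intro: differentiable[OF xU axis_Basis])
      also have "\<dots> \<le> (\<Sum>b\<in>Basis. norm v * B b)"
      proof (rule sum_norm_le)
        fix b :: "real^'q" assume b: "b \<in> Basis"
        show "norm ((v \<bullet> b) *\<^sub>R dir_deriv g b x) \<le> norm v * B b"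
          using Basis_le_norm[OF b, of v] B[OF b x] by (auto intro!: mult_mono)
      qed
      also have "\<dots> = K * norm v" by (simp add: K_def sum_distrib_left mult.commute)
      finally show "norm (dir_deriv g v x) \<le> K * norm v" .
    qed
  qed
  ultimately show ?thesis by (rule that)
qed

text \<open>The information matrix: the limit of minus the Hessian at the maximizer when the
  statistic tends to \<open>Q0\<close>, and the precision matrix of the limiting Gaussian.\<close>

definition info :: "real^'q^'q" where
  "info = - hessian (f Q0) \<theta>0"

text \<open>A maximizer over \<open>\<Theta>\<close> may sit on the boundary; the open set
  \<open>S\<close> records that it is interior before the first-order condition is used.\<close>

lemma dir_deriv_zero_at_max:
  assumes "open S" "x \<in> S" "S \<subseteq> \<Theta>" "\<And>y. y \<in> S \<Longrightarrow> f Q y \<le> f Q x"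
  shows "dir_deriv (f Q) v x = 0"
proof -
  have "(f Q has_derivative (\<lambda>v. dir_deriv (f Q) v x)) (at x)"
    using assms U by (intro dir_deriv_has_derivative f_differentiable) auto
  from differential_zero_maxmin[OF assms(2,1) this] assms(4)
  have "(\<lambda>v. dir_deriv (f Q) v x) = (\<lambda>v. 0)" by blast
  then show ?thesis by (rule fun_cong)
qed

text \<open>The basic inequality of M-estimation. Since \<open>t\<close> does at least as well as
  \<open>\<theta>0\<close> at \<open>Q\<close>, the quadratic loss at \<open>Q0\<close> is at most
  (Q - Q0) . (g t - g \<theta>0), which is linear in the distance by the Lipschitz bound; one factor
  of the distance cancels.\<close>

lemma maximizer_rate:
  assumes K: "K \<ge> 0" "\<And>\<theta>. \<theta> \<in> \<Theta> \<Longrightarrow> norm (g \<theta> - g \<theta>0) \<le> K * norm (\<theta> - \<theta>0)"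
    and t: "t \<in> \<Theta>" "f Q \<theta>0 \<le> f Q t"
  shows "\<kappa> * norm (t - \<theta>0) \<le> K * norm (Q - Q0)"
proof (cases "t = \<theta>0")
  case False
  have "\<kappa> * (norm (t - \<theta>0))\<^sup>2 \<le> (g0 \<theta>0 + Q0 \<bullet> g \<theta>0) - (g0 t + Q0 \<bullet> g t)"
    using contrast[OF t(1)] by simp
  also have "\<dots> \<le> (Q - Q0) \<bullet> (g t - g \<theta>0)"
    using t(2) by (simp add: f_def inner_simps)
  also have "\<dots> \<le> norm (Q - Q0) * norm (g t - g \<theta>0)" by (rule norm_cauchy_schwarz)
  also have "\<dots> \<le> norm (Q - Q0) * (K * norm (t - \<theta>0))"
    by (intro mult_left_mono K(2) t) auto
  finally have "(\<kappa> * norm (t - \<theta>0)) * norm (t - \<theta>0) \<le> (K * norm (Q - Q0)) * norm (t - \<theta>0)"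
    by (simp add: power2_eq_square ac_simps)
  then show ?thesis by (rule mult_right_le_imp_le) (use False in simp)
qed (use K in simp)

lemma maximizer_root_n_rate:
  fixes n :: nat
  assumes K: "K \<ge> 0" "\<And>\<theta>. \<theta> \<in> \<Theta> \<Longrightarrow> norm (g \<theta> - g \<theta>0) \<le> K * norm (\<theta> - \<theta>0)"
    and t: "t \<in> \<Theta>" "f Q \<theta>0 \<le> f Q t" and L: "sqrt (real n) * norm (Q - Q0) \<le> L"
  shows "sqrt (real n) * norm (t - \<theta>0) \<le> K * L / \<kappa>"
proof -
  have "\<kappa> * (sqrt (real n) * norm (t - \<theta>0)) = sqrt (real n) * (\<kappa> * norm (t - \<theta>0))" by simp
  also have "\<dots> \<le> sqrt (real n) * (K * norm (Q - Q0))"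
    by (intro mult_left_mono maximizer_rate[OF K t]) auto
  also have "\<dots> = K * (sqrt (real n) * norm (Q - Q0))" by simp
  also have "\<dots> \<le> K * L" by (intro mult_left_mono L K)
  finally show ?thesis using \<kappa> by (simp add: field_simps)
qed

text \<open>With a = sqrt n |\<theta> - \<theta>0| the rescaled contrast is at most -\<kappa> a^2 +
  K L a. Completing the square gives up half of the quadratic term, and passing from a to u by |u|
  <= a + K L / \<kappa> gives up another half, hence \<kappa> / 4; the two additive constants are
  the costs of these steps.\<close>

lemma rescaled_upper_bound:
  fixes n :: nat
  assumes K: "K \<ge> 0" "\<And>\<theta>. \<theta> \<in> \<Theta> \<Longrightarrow> norm (g \<theta> - g \<theta>0) \<le> K * norm (\<theta> - \<theta>0)"
    and t: "t \<in> \<Theta>" "f Q \<theta>0 \<le> f Q t" and n: "n \<ge> 1"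
    and L: "sqrt (real n) * norm (Q - Q0) \<le> L"
    and th: "t + (1 / sqrt (real n)) *\<^sub>R u \<in> \<Theta>"
  shows "real n * (f Q (t + (1 / sqrt (real n)) *\<^sub>R u) - f Q t)
    \<le> - (\<kappa> / 4) * (norm u)\<^sup>2 + ((K * L)\<^sup>2 / (2 * \<kappa>) + \<kappa> * (K * L / \<kappa>)\<^sup>2 / 2)"
proof -
  let ?\<theta> = "t + (1 / sqrt (real n)) *\<^sub>R u"
  define a where "a = sqrt (real n) * norm (?\<theta> - \<theta>0)"
  define R where "R = K * L / \<kappa>"
  have sn: "sqrt (real n) > 0" "(sqrt (real n))\<^sup>2 = real n" using n by auto
  have R: "sqrt (real n) * norm (t - \<theta>0) \<le> R"
    unfolding R_def by (rule maximizer_root_n_rate[OF K t L])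
  \<comment> \<open>Recentering at \<open>\<theta>0\<close>, where [C1](a) applies, is free because
    \<open>f Q \<theta>0 \<le> f Q t\<close>.\<close>
  have "real n * (f Q ?\<theta> - f Q t) \<le> real n * (f Q ?\<theta> - f Q \<theta>0)"
    using t by (intro mult_left_mono) auto
  also have "f Q ?\<theta> - f Q \<theta>0 = ((g0 ?\<theta> + Q0 \<bullet> g ?\<theta>) - (g0 \<theta>0 + Q0 \<bullet> g \<theta>0)) + (Q - Q0) \<bullet> (g ?\<theta> - g \<theta>0)"
    by (simp add: f_def inner_simps)
  also have "real n * \<dots> \<le> real n * (- \<kappa> * (norm (?\<theta> - \<theta>0))\<^sup>2 + norm (Q - Q0) * (K * norm (?\<theta> - \<theta>0)))"
  proof (intro mult_left_mono add_mono contrast th)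
    have "(Q - Q0) \<bullet> (g ?\<theta> - g \<theta>0) \<le> norm (Q - Q0) * norm (g ?\<theta> - g \<theta>0)" by (rule norm_cauchy_schwarz)
    also have "\<dots> \<le> norm (Q - Q0) * (K * norm (?\<theta> - \<theta>0))"
      by (intro mult_left_mono K(2) th) auto
    finally show "(Q - Q0) \<bullet> (g ?\<theta> - g \<theta>0) \<le> norm (Q - Q0) * (K * norm (?\<theta> - \<theta>0))" .
  qed simp
  also have "\<dots> = - \<kappa> * a\<^sup>2 + K * (sqrt (real n) * norm (Q - Q0)) * a"
  proof -
    have "real n * x = sqrt (real n) * (sqrt (real n) * x)" for x
      using sn(2) by (simp add: power2_eq_square flip: mult.assoc)
    then show ?thesis using sn(2) by (simp add: a_def power_mult_distrib algebra_simps)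
  qed
  also have "\<dots> \<le> - \<kappa> * a\<^sup>2 + K * L * a"
    using K L sn by (intro add_left_mono mult_right_mono mult_left_mono) (auto simp: a_def)
  also have "\<dots> \<le> - (\<kappa> / 2) * a\<^sup>2 + (K * L)\<^sup>2 / (2 * \<kappa>)"
  proof -
    have "0 \<le> (\<kappa> * a - K * L)\<^sup>2 / (2 * \<kappa>)" using \<kappa> by simp
    also have "\<dots> = \<kappa> * a\<^sup>2 / 2 - K * L * a + (K * L)\<^sup>2 / (2 * \<kappa>)"
      using \<kappa> by (simp add: power2_eq_square field_simps)
    finally show ?thesis by simp
  qed
  also have "- (\<kappa> / 2) * a\<^sup>2 \<le> - (\<kappa> / 4) * (norm u)\<^sup>2 + \<kappa> * R\<^sup>2 / 2"
  proof -
    have "norm u = sqrt (real n) * norm (?\<theta> - t)" using sn by simp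
    also have "\<dots> \<le> sqrt (real n) * (norm (?\<theta> - \<theta>0) + norm (t - \<theta>0))"
      using norm_triangle_ineq4[of "?\<theta> - \<theta>0" "t - \<theta>0"] by (intro mult_left_mono) auto
    also have "\<dots> \<le> a + R" using R by (simp add: a_def distrib_left)
    finally have "(norm u)\<^sup>2 \<le> (a + R)\<^sup>2" by (intro power_mono) auto
    also have "\<dots> \<le> 2 * a\<^sup>2 + 2 * R\<^sup>2" using sum_squares_bound[of a R] by (simp add: power2_sum)
    finally have "\<kappa> / 4 * (norm u)\<^sup>2 \<le> \<kappa> / 4 * (2 * a\<^sup>2 + 2 * R\<^sup>2)"
      using \<kappa> by (intro mult_left_mono) auto
    then show ?thesis by (simp add: algebra_simps)
  qed
  finally show ?thesis by (simp add: R_def)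
qed

text \<open>Taylor expansion at \<open>t k\<close>: the linear term vanishes as soon as
  \<open>t k\<close> is interior, the factor n cancels the two factors 1 / sqrt n of the quadratic
  term, and the Hessian at the intermediate point converges to minus \<open>info\<close>.\<close>

lemma rescaled_pointwise_limit:
  assumes N: "filterlim N at_top sequentially" and N1: "\<And>k. N k \<ge> (1::nat)"
    and Q: "Q \<longlonglongrightarrow> Q0" and tlim: "t \<longlonglongrightarrow> \<theta>0"
    and max: "\<And>k \<theta>. \<theta> \<in> \<Theta> \<Longrightarrow> f (Q k) \<theta> \<le> f (Q k) (t k)"
  shows "(\<lambda>k. t k + (1 / sqrt (real (N k))) *\<^sub>R u) \<longlonglongrightarrow> \<theta>0"
    "(\<lambda>k. real (N k) * (f (Q k) (t k + (1 / sqrt (real (N k))) *\<^sub>R u) - f (Q k) (t k)))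
      \<longlonglongrightarrow> - (u \<bullet> (info *v u)) / 2"
proof -
  obtain r where r: "r > 0" "ball \<theta>0 r \<subseteq> \<Theta>"
    using interior by (auto simp: mem_interior)
  define \<epsilon> where "\<epsilon> = (\<lambda>k. 1 / sqrt (real (N k)))"
  have e0: "\<epsilon> \<longlonglongrightarrow> 0"
  proof -
    have "filterlim (\<lambda>k. sqrt (real (N k))) at_top sequentially"
      by (intro filterlim_compose[OF sqrt_at_top] filterlim_compose[OF filterlim_real_sequentially] N)
    then show ?thesis unfolding \<epsilon>_def
      by (rule real_tendsto_divide_at_top[OF tendsto_const])
  qed
  have eu: "(\<lambda>k. \<epsilon> k *\<^sub>R u) \<longlonglongrightarrow> 0" using tendsto_scaleR[OF e0 tendsto_const[of u]] by simp
  have thlim: "(\<lambda>k. t k + \<epsilon> k *\<^sub>R u) \<longlonglongrightarrow> \<theta>0" using tendsto_add[OF tlim eu] by simp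
  then show "(\<lambda>k. t k + (1 / sqrt (real (N k))) *\<^sub>R u) \<longlonglongrightarrow> \<theta>0" by (simp add: \<epsilon>_def)
  let ?good = "\<lambda>k. t k \<in> ball \<theta>0 r \<and> t k + \<epsilon> k *\<^sub>R u \<in> ball \<theta>0 r"
  have good: "eventually ?good sequentially"
    using r(1) by (intro eventually_conj topological_tendstoD[OF tlim] topological_tendstoD[OF thlim]) auto
  \<comment> \<open>For the finitely many \<open>k\<close> that are not good the intermediate point
    gets the dummy value 0, so that \<open>s\<close> becomes a sequence defined everywhere.\<close>
  have "\<forall>k. \<exists>s. 0 \<le> s \<and> s \<le> 1 \<and> (?good k \<longrightarrow> real (N k) * (f (Q k) (t k + \<epsilon> k *\<^sub>R u) - f (Q k) (t k))
      = (u \<bullet> (hessian (f (Q k)) (t k + s *\<^sub>R (\<epsilon> k *\<^sub>R u)) *v u)) / 2)"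
  proof
    fix k
    show "\<exists>s. 0 \<le> s \<and> s \<le> 1 \<and> (?good k \<longrightarrow> real (N k) * (f (Q k) (t k + \<epsilon> k *\<^sub>R u) - f (Q k) (t k))
      = (u \<bullet> (hessian (f (Q k)) (t k + s *\<^sub>R (\<epsilon> k *\<^sub>R u)) *v u)) / 2)"
    proof (cases "?good k")
      case True
      have seg: "t k + s *\<^sub>R (\<epsilon> k *\<^sub>R u) \<in> U" if "0 \<le> s" "s \<le> 1" for s
      proof -
        have "(1 - s) *\<^sub>R t k + s *\<^sub>R (t k + \<epsilon> k *\<^sub>R u) \<in> ball \<theta>0 r"
          using True that by (intro convexD[OF convex_ball]) auto
        then show ?thesis using r U by (auto simp: algebra_simps)
      qed
      have zero: "dir_deriv (f (Q k)) v (t k) = 0" for v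
        by (rule dir_deriv_zero_at_max[of "ball \<theta>0 r"]) (use True r max in auto)
      obtain s where s: "0 < s" "s < 1"
        and ts: "f (Q k) (t k + \<epsilon> k *\<^sub>R u) = f (Q k) (t k) + dir_deriv (f (Q k)) (\<epsilon> k *\<^sub>R u) (t k) +
          ((\<epsilon> k *\<^sub>R u) \<bullet> (hessian (f (Q k)) (t k + s *\<^sub>R (\<epsilon> k *\<^sub>R u)) *v (\<epsilon> k *\<^sub>R u))) / 2"
        using taylor_hessian[OF Ck_on_f seg] by blast
      have "real (N k) * (\<epsilon> k * \<epsilon> k) = 1"
        using N1[of k] by (simp add: \<epsilon>_def)
      then have "real (N k) * (f (Q k) (t k + \<epsilon> k *\<^sub>R u) - f (Q k) (t k))
        = (u \<bullet> (hessian (f (Q k)) (t k + s *\<^sub>R (\<epsilon> k *\<^sub>R u)) *v u)) / 2"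
        unfolding ts zero by (simp add: matrix_vector_mult_scaleR flip: mult.assoc)
      then show ?thesis using s by (intro exI[of _ s]) auto
    qed (auto intro: exI[of _ 0])
  qed
  then obtain s where s: "\<And>k. 0 \<le> s k" "\<And>k. s k \<le> 1"
    "\<And>k. ?good k \<Longrightarrow> real (N k) * (f (Q k) (t k + \<epsilon> k *\<^sub>R u) - f (Q k) (t k))
      = (u \<bullet> (hessian (f (Q k)) (t k + s k *\<^sub>R (\<epsilon> k *\<^sub>R u)) *v u)) / 2"
    by metis
  have "(\<lambda>k. s k *\<^sub>R (\<epsilon> k *\<^sub>R u)) \<longlonglongrightarrow> 0"
  proof (rule Lim_null_comparison)
    have "norm (s k *\<^sub>R (\<epsilon> k *\<^sub>R u)) \<le> norm (\<epsilon> k *\<^sub>R u)" for k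
    proof -
      have "norm (s k *\<^sub>R (\<epsilon> k *\<^sub>R u)) = s k * norm (\<epsilon> k *\<^sub>R u)" using s(1)[of k] by (simp add: abs_mult)
      also have "\<dots> \<le> norm (\<epsilon> k *\<^sub>R u)" using s(1,2)[of k] by (intro mult_left_le_one_le) auto
      finally show ?thesis .
    qed
    then show "\<forall>\<^sub>F k in sequentially. norm (s k *\<^sub>R (\<epsilon> k *\<^sub>R u)) \<le> norm (\<epsilon> k *\<^sub>R u)" by simp
    show "(\<lambda>k. norm (\<epsilon> k *\<^sub>R u)) \<longlonglongrightarrow> 0" using tendsto_norm[OF eu] by simp
  qed
  from tendsto_add[OF tlim this] have "(\<lambda>k. t k + s k *\<^sub>R (\<epsilon> k *\<^sub>R u)) \<longlonglongrightarrow> \<theta>0" by simp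
  then have "(\<lambda>k. hessian (f (Q k)) (t k + s k *\<^sub>R (\<epsilon> k *\<^sub>R u))) \<longlonglongrightarrow> hessian (f Q0) \<theta>0"
    by (rule tendsto_hessian[OF Q]) (use interior interior_subset U in auto)
  then have "(\<lambda>k. (u \<bullet> (hessian (f (Q k)) (t k + s k *\<^sub>R (\<epsilon> k *\<^sub>R u)) *v u)) / 2)
      \<longlonglongrightarrow> (u \<bullet> (hessian (f Q0) \<theta>0 *v u)) / 2"
    by (intro tendsto_divide tendsto_quadratic_form tendsto_const) auto
  then have "(\<lambda>k. real (N k) * (f (Q k) (t k + \<epsilon> k *\<^sub>R u) - f (Q k) (t k)))
      \<longlonglongrightarrow> (u \<bullet> (hessian (f Q0) \<theta>0 *v u)) / 2"
  proof (rule Lim_transform_eventually)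
    show "\<forall>\<^sub>F k in sequentially. (u \<bullet> (hessian (f (Q k)) (t k + s k *\<^sub>R (\<epsilon> k *\<^sub>R u)) *v u)) / 2
       = real (N k) * (f (Q k) (t k + \<epsilon> k *\<^sub>R u) - f (Q k) (t k))"
      using good by eventually_elim (rule s(3)[symmetric])
  qed
  moreover have "- (u \<bullet> (info *v u)) = u \<bullet> (hessian (f Q0) \<theta>0 *v u)"
    unfolding info_def by (simp add: matrix_vector_mult_def inner_vec_def sum_negf)
  ultimately show "(\<lambda>k. real (N k) * (f (Q k) (t k + (1 / sqrt (real (N k))) *\<^sub>R u) - f (Q k) (t k)))
      \<longlonglongrightarrow> - (u \<bullet> (info *v u)) / 2"
    by (simp add: \<epsilon>_def)
qed

text \<open>The contrast inequality at \<theta>0 + u / sqrt n, multiplied by n, has right side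
  -\<kappa> |u|^2; by the pointwise limit for the constant sequences \<open>Q0\<close> and
  \<open>\<theta>0\<close>, its left side tends to minus half the quadratic form of
  \<open>info\<close>.\<close>

lemma info_lower_bound: "u \<bullet> (info *v u) \<ge> 2 * \<kappa> * (norm u)\<^sup>2"
proof -
  have max: "f Q0 \<theta> \<le> f Q0 \<theta>0" if "\<theta> \<in> \<Theta>" for \<theta>
  proof -
    have "f Q0 \<theta> - f Q0 \<theta>0 \<le> - \<kappa> * (norm (\<theta> - \<theta>0))\<^sup>2"
      using contrast[OF that] by (simp add: f_def)
    moreover have "\<kappa> * (norm (\<theta> - \<theta>0))\<^sup>2 \<ge> 0" using \<kappa> by simp
    ultimately show ?thesis by simp
  qed
  let ?y = "\<lambda>k. \<theta>0 + (1 / sqrt (real (Suc k))) *\<^sub>R u"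
  have y: "?y \<longlonglongrightarrow> \<theta>0"
    and lim: "(\<lambda>k. real (Suc k) * (f Q0 (?y k) - f Q0 \<theta>0)) \<longlonglongrightarrow> - (u \<bullet> (info *v u)) / 2"
    using rescaled_pointwise_limit[OF filterlim_Suc _ tendsto_const tendsto_const max, of u] by simp_all
  have "eventually (\<lambda>k. real (Suc k) * (f Q0 (?y k) - f Q0 \<theta>0) \<le> - \<kappa> * (norm u)\<^sup>2) sequentially"
    using topological_tendstoD[OF y open_interior interior]
  proof eventually_elim
    fix k assume "?y k \<in> interior \<Theta>"
    then have "f Q0 (?y k) - f Q0 \<theta>0 \<le> - \<kappa> * (norm (?y k - \<theta>0))\<^sup>2"
      using contrast[of "?y k"] interior_subset by (auto simp: f_def)
    then have "real (Suc k) * (f Q0 (?y k) - f Q0 \<theta>0) \<le> real (Suc k) * (- \<kappa> * (norm (?y k - \<theta>0))\<^sup>2)"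
      by (intro mult_left_mono) auto
    also have "\<dots> = - \<kappa> * (norm u)\<^sup>2" by (simp add: power_divide)
    finally show "real (Suc k) * (f Q0 (?y k) - f Q0 \<theta>0) \<le> - \<kappa> * (norm u)\<^sup>2" .
  qed
  then have "- (u \<bullet> (info *v u)) / 2 \<le> - \<kappa> * (norm u)\<^sup>2"
    by (rule tendsto_upperbound[OF lim]) simp
  then show ?thesis by simp
qed

lemma pos_def_info:
  assumes "transpose info = info"
  shows "pos_def info"
  unfolding pos_def_def
proof (intro conjI allI impI assms)
  fix x :: "real^'q" assume "x \<noteq> 0"
  then have "2 * \<kappa> * (norm x)\<^sup>2 > 0" using \<kappa> by simp
  then show "x \<bullet> (info *v x) > 0" using info_lower_bound[of x] by (rule less_le_trans)
qed

text \<open>[B](b) is uniform over |u| < L, so it may be evaluated at the moving argument v = sqrt n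
  (y - \<theta>0); the lower bound on \<pi>(\<theta>0) from [B](a) turns the difference into a
  ratio.\<close>

lemma prior_ratio_limit:
  assumes N: "filterlim N at_top sequentially" and N1: "\<And>k. N k \<ge> (1::nat)"
    and B: "cond_B \<Theta> \<theta>0 \<pi>" and nonneg: "\<And>n \<theta>. n \<ge> 1 \<Longrightarrow> \<theta> \<in> \<Theta> \<Longrightarrow> 0 \<le> \<pi> n \<theta>"
    and y: "\<And>k. sqrt (real (N k)) * norm (y k - \<theta>0) \<le> R"
    and yin: "eventually (\<lambda>k. y k \<in> \<Theta>) sequentially"
  shows "(\<lambda>k. \<pi> (N k) (y k) / \<pi> (N k) \<theta>0) \<longlonglongrightarrow> 1"
proof -
  from B obtain c C where c: "c > 0" "\<And>n. n \<ge> 1 \<Longrightarrow> c \<le> \<pi> n \<theta>0"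
    and C: "\<And>n \<theta>. n \<ge> 1 \<Longrightarrow> \<theta> \<in> \<Theta> \<Longrightarrow> \<pi> n \<theta> \<le> C"
    and lim: "\<And>L. L > 0 \<Longrightarrow> (\<lambda>n. SUP u\<in>{u. norm u < L} \<inter> local_params \<Theta> \<theta>0 n.
        \<bar>\<pi> n (\<theta>0 + (1 / sqrt (real n)) *\<^sub>R u) - \<pi> n \<theta>0\<bar>) \<longlonglongrightarrow> 0"
    unfolding cond_B_def by blast
  \<comment> \<open>The supremum in [B](b) runs over an open ball; the extra 1 makes that ball
    contain every \<open>v\<close> of norm at most \<open>R\<close>.\<close>
  define L where "L = \<bar>R\<bar> + 1"
  define S where "S = (\<lambda>n. SUP u\<in>{u. norm u < L} \<inter> local_params \<Theta> \<theta>0 n.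
        \<bar>\<pi> n (\<theta>0 + (1 / sqrt (real n)) *\<^sub>R u) - \<pi> n \<theta>0\<bar>)"
  have "S \<longlonglongrightarrow> 0" unfolding S_def by (rule lim) (simp add: L_def)
  then have S: "(\<lambda>k. S (N k) / c) \<longlonglongrightarrow> 0"
    using tendsto_divide[OF filterlim_compose[OF \<open>S \<longlonglongrightarrow> 0\<close> N] tendsto_const[of c]] c by simp
  have th0: "\<theta>0 \<in> \<Theta>" using interior interior_subset by blast
  have "(\<lambda>k. \<pi> (N k) (y k) / \<pi> (N k) \<theta>0 - 1) \<longlonglongrightarrow> 0"
  proof (rule Lim_null_comparison[OF _ S])
    show "\<forall>\<^sub>F k in sequentially. norm (\<pi> (N k) (y k) / \<pi> (N k) \<theta>0 - 1) \<le> S (N k) / c"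
      using yin
    proof eventually_elim
      fix k assume yk: "y k \<in> \<Theta>"
      let ?n = "N k"
      define v where "v = sqrt (real ?n) *\<^sub>R (y k - \<theta>0)"
      have sn: "sqrt (real ?n) > 0" using N1[of k] by simp
      have th: "\<theta>0 + (1 / sqrt (real ?n)) *\<^sub>R v = y k" using sn by (simp add: v_def)
      have "norm v \<le> R" using y[of k] by (simp add: v_def)
      then have v: "v \<in> {u. norm u < L} \<inter> local_params \<Theta> \<theta>0 ?n"
        using th yk by (auto simp: L_def local_params_def)
      have "\<bar>\<pi> ?n (\<theta>0 + (1 / sqrt (real ?n)) *\<^sub>R v) - \<pi> ?n \<theta>0\<bar> \<le> S ?n"
        unfolding S_def
      proof (rule cSUP_upper[OF v])
        \<comment> \<open>A real supremum is an upper bound only for a bounded family; here 0 \<le>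
          \<pi> \<le> C bounds the differences.\<close>
        show "bdd_above ((\<lambda>u. \<bar>\<pi> ?n (\<theta>0 + (1 / sqrt (real ?n)) *\<^sub>R u) - \<pi> ?n \<theta>0\<bar>) ` ({u. norm u < L} \<inter> local_params \<Theta> \<theta>0 ?n))"
        proof (rule bdd_aboveI2)
          fix u assume "u \<in> {u. norm u < L} \<inter> local_params \<Theta> \<theta>0 ?n"
          then have "\<theta>0 + (1 / sqrt (real ?n)) *\<^sub>R u \<in> \<Theta>" by (simp add: local_params_def)
          then show "\<bar>\<pi> ?n (\<theta>0 + (1 / sqrt (real ?n)) *\<^sub>R u) - \<pi> ?n \<theta>0\<bar> \<le> C"
            using C[OF N1[of k]] nonneg[OF N1[of k]] th0 by (smt (verit))
        qed
      qed
      then have le: "\<bar>\<pi> ?n (y k) - \<pi> ?n \<theta>0\<bar> \<le> S ?n" by (simp only: th)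
      have pc: "c \<le> \<pi> ?n \<theta>0" using c N1 by blast
      then have "norm (\<pi> ?n (y k) / \<pi> ?n \<theta>0 - 1) = \<bar>\<pi> ?n (y k) - \<pi> ?n \<theta>0\<bar> / \<pi> ?n \<theta>0"
        using c by (simp add: field_simps abs_div)
      also have "\<dots> \<le> S ?n / c" using le pc c by (intro frac_le) auto
      finally show "norm (\<pi> ?n (y k) / \<pi> ?n \<theta>0 - 1) \<le> S ?n / c" .
    qed
  qed
  from tendsto_add[OF this tendsto_const[of 1]] show ?thesis by simp
qed

section \<open>Laplace approximation along sequences of samples\<close>

definition evidence :: "(real^'q \<Rightarrow> real) \<Rightarrow> nat \<Rightarrow> 'v \<Rightarrow> real" where
  "evidence p n Q = (LINT \<theta>:\<Theta>|lborel. exp (real n * f Q \<theta>) * p \<theta>)"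

text \<open>The prior is evaluated at \<open>\<theta>0\<close>, where [B](a) keeps it away from 0;
  at the maximizer it may vanish. The two logarithms are exchanged only in the final
  theorem.\<close>

definition laplace_error :: "(real^'q \<Rightarrow> real) \<Rightarrow> nat \<Rightarrow> 'v \<Rightarrow> real^'q \<Rightarrow> real" where
  "laplace_error p n Q t = ln (evidence p n Q) - (real n * f Q t + real CARD('q) / 2 * ln (2 * pi)
     - 1 / 2 * ln (det (- (real n *\<^sub>R hessian (f Q) t))) + ln (p \<theta>0))"

text \<open>The Hessians are symmetric on the event \<open>J\<close> by the definition of \<open>pos_def\<close>, so symmetry is assumed
  here and Schwarz's theorem is not needed; the limiting information matrix inherits it.\<close>

lemma laplace_sequence:
  assumes N: "filterlim N at_top sequentially" and N1: "\<And>k. N k \<ge> (1::nat)"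
    and B: "cond_B \<Theta> \<theta>0 \<pi>" and prior: "\<And>n. n \<ge> 1 \<Longrightarrow> prior_density \<Theta> (\<pi> n)"
    and L: "\<And>k. sqrt (real (N k)) * norm (Q k - Q0) \<le> L"
    and t: "\<And>k. t k \<in> \<Theta>" and max: "\<And>k \<theta>. \<theta> \<in> \<Theta> \<Longrightarrow> f (Q k) \<theta> \<le> f (Q k) (t k)"
    and sym: "\<And>k. transpose (hessian (f (Q k)) (t k)) = hessian (f (Q k)) (t k)"
  shows "eventually (\<lambda>k. evidence (\<pi> (N k)) (N k) (Q k) > 0 \<and>
      det (- (real (N k) *\<^sub>R hessian (f (Q k)) (t k))) > 0) sequentially"
    "(\<lambda>k. laplace_error (\<pi> (N k)) (N k) (Q k) (t k)) \<longlonglongrightarrow> 0"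
proof -
  obtain K where K: "K \<ge> 0" "\<And>\<theta>. \<theta> \<in> \<Theta> \<Longrightarrow> norm (g \<theta> - g \<theta>0) \<le> K * norm (\<theta> - \<theta>0)"
    using g_lipschitz by blast
  have th0: "\<theta>0 \<in> \<Theta>" "\<theta>0 \<in> U" using interior interior_subset U by auto
  have nonneg: "\<And>n \<theta>. n \<ge> 1 \<Longrightarrow> \<theta> \<in> \<Theta> \<Longrightarrow> 0 \<le> \<pi> n \<theta>"
    using prior by (simp add: prior_density_def)
  from B obtain c C where c: "c > 0" "\<And>n. n \<ge> 1 \<Longrightarrow> c \<le> \<pi> n \<theta>0"
    and C: "\<And>n \<theta>. n \<ge> 1 \<Longrightarrow> \<theta> \<in> \<Theta> \<Longrightarrow> \<pi> n \<theta> \<le> C"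
    unfolding cond_B_def by blast
  have p0: "\<pi> (N k) \<theta>0 > 0" for k using c N1[of k] by (meson less_le_trans)
  have max0: "f (Q k) \<theta>0 \<le> f (Q k) (t k)" for k using max th0 by blast
  have sN: "sqrt (real (N k)) > 0" for k using N1[of k] by simp
  have rate: "sqrt (real (N k)) * norm (t k - \<theta>0) \<le> K * L / \<kappa>" for k
    by (rule maximizer_root_n_rate[OF K t max0 L])
  have sqrt_inf: "filterlim (\<lambda>k. sqrt (real (N k))) at_top sequentially"
    by (intro filterlim_compose[OF sqrt_at_top] filterlim_compose[OF filterlim_real_sequentially] N)
  have to0: "x \<longlonglongrightarrow> a" if "\<And>k. sqrt (real (N k)) * norm (x k - a) \<le> M" for x :: "nat \<Rightarrow> 'c::real_normed_vector" and a M
  proof -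
    have "(\<lambda>k. x k - a) \<longlonglongrightarrow> 0"
    proof (rule Lim_null_comparison)
      have "norm (x k - a) \<le> M / sqrt (real (N k))" for k
        using that[of k] sN[of k] by (simp add: pos_le_divide_eq mult.commute)
      then show "\<forall>\<^sub>F k in sequentially. norm (x k - a) \<le> M / sqrt (real (N k))" by simp
      show "(\<lambda>k. M / sqrt (real (N k))) \<longlonglongrightarrow> 0"
        by (rule real_tendsto_divide_at_top[OF tendsto_const sqrt_inf])
    qed
    then show ?thesis by (simp add: LIM_zero_iff)
  qed
  have Qlim: "Q \<longlonglongrightarrow> Q0" by (rule to0[OF L])
  have tlim: "t \<longlonglongrightarrow> \<theta>0" by (rule to0[OF rate])

  define H where "H = (\<lambda>k. hessian (f (Q k)) (t k))"
  have Hlim: "H \<longlonglongrightarrow> - info"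
    unfolding H_def info_def using tendsto_hessian[OF Qlim tlim th0(2)] by simp
  have "transpose info $ i $ j = info $ i $ j" for i j
  proof -
    have l: "(\<lambda>k. H k $ i $ j) \<longlonglongrightarrow> (- info) $ i $ j" for i j
      by (intro tendsto_vec_nth Hlim)
    have "H k $ i $ j = H k $ j $ i" for k
      using sym[of k] unfolding H_def transpose_def by (metis vec_lambda_beta)
    then have "(\<lambda>k. H k $ i $ j) \<longlonglongrightarrow> (- info) $ j $ i" using l[of j i] by simp
    from LIMSEQ_unique[OF l this] have "(- info) $ i $ j = (- info) $ j $ i" .
    then show ?thesis by (simp add: transpose_def)
  qed
  then have pd: "pos_def info" by (intro pos_def_info) (simp add: vec_eq_iff)
  then have dpos: "det info > 0" by (rule pos_def_imp_det_pos)
  have "(\<lambda>k. - H k) \<longlonglongrightarrow> info" using tendsto_minus[OF Hlim] by simp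
  then have detlim: "(\<lambda>k. det (- H k)) \<longlonglongrightarrow> det info" by (rule tendsto_det)

  define y where "y = (\<lambda>k u. t k + (1 / sqrt (real (N k))) *\<^sub>R u)"
  define E where "E = (\<lambda>k u. real (N k) * (f (Q k) (y k u) - f (Q k) (t k)))"
  \<comment> \<open>The integrand in the local variable u, divided by exp (n f(t)) \<pi>(\<theta>0).
    The indicator extends it by 0, so that all integrals run over the whole space.\<close>
  define G where "G = (\<lambda>k u. indicator \<Theta> (y k u) * (exp (E k u) * (\<pi> (N k) (y k u) / \<pi> (N k) \<theta>0)))"
  define C2 where "C2 = (K * L)\<^sup>2 / (2 * \<kappa>) + \<kappa> * (K * L / \<kappa>)\<^sup>2 / 2"
  define h where "h = (\<lambda>k \<theta>. indicator \<Theta> \<theta> *\<^sub>R (exp (real (N k) * f (Q k) \<theta>) * \<pi> (N k) \<theta>))"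
  have \<Theta>b: "\<Theta> \<in> sets borel" using compact by (simp add: borel_compact)
  \<comment> \<open>Integrability on \<open>\<Theta>\<close> makes the product of
    \<open>\<pi>\<close> with the indicator measurable; the indicator is idempotent, so each factor
    receives its own copy.\<close>
  have hm [measurable]: "h k \<in> borel_measurable borel" for k
  proof -
    have "continuous_on \<Theta> (f (Q k))"
      using continuous_on_subset[OF Ck_on_imp_continuous_on[OF Ck_on_f] U(2)] .
    then have "(\<lambda>\<theta>. indicator \<Theta> \<theta> *\<^sub>R exp (real (N k) * f (Q k) \<theta>)) \<in> borel_measurable borel"
      by (intro borel_measurable_continuous_on_indicator \<Theta>b continuous_intros)
    moreover have "(\<lambda>\<theta>. indicator \<Theta> \<theta> *\<^sub>R \<pi> (N k) \<theta>) \<in> borel_measurable borel"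
      using prior[OF N1[of k]] unfolding prior_density_def set_integrable_def by auto
    ultimately have "(\<lambda>\<theta>. (indicator \<Theta> \<theta> *\<^sub>R exp (real (N k) * f (Q k) \<theta>)) * (indicator \<Theta> \<theta> *\<^sub>R \<pi> (N k) \<theta>)) \<in> borel_measurable borel"
      by (rule borel_measurable_times)
    also have "(\<lambda>\<theta>. (indicator \<Theta> \<theta> *\<^sub>R exp (real (N k) * f (Q k) \<theta>)) * (indicator \<Theta> \<theta> *\<^sub>R \<pi> (N k) \<theta>)) = h k"
      by (auto simp: h_def indicator_def)
    finally show ?thesis .
  qed
  have ym [measurable]: "y k \<in> borel_measurable borel" for k
    unfolding y_def by (intro borel_measurable_continuous_onI continuous_intros)
  have hy: "h k (y k u) = exp (real (N k) * f (Q k) (t k)) * \<pi> (N k) \<theta>0 * G k u" for k u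
    using p0[of k] by (simp add: h_def G_def E_def exp_diff right_diff_distrib)
  have Gh: "G k u = h k (y k u) / (exp (real (N k) * f (Q k) (t k)) * \<pi> (N k) \<theta>0)" for k u
    unfolding hy using p0[of k] by simp
  have Gm [measurable]: "G k \<in> borel_measurable lborel" for k
    unfolding Gh by measurable
  have Itrans: "evidence (\<pi> (N k)) (N k) (Q k)
      = (1 / sqrt (real (N k))) ^ CARD('q) * (exp (real (N k) * f (Q k) (t k)) * \<pi> (N k) \<theta>0 * (\<integral>u. G k u \<partial>lborel))" for k
  proof -
    have "evidence (\<pi> (N k)) (N k) (Q k) = (\<integral>\<theta>. h k \<theta> \<partial>lborel)"
      by (simp add: evidence_def set_lebesgue_integral_def h_def)
    also have "\<dots> = (1 / sqrt (real (N k))) ^ CARD('q) * (\<integral>u. h k (y k u) \<partial>lborel)"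
      unfolding y_def using sN by (intro integral_lborel_affine) auto
    finally show ?thesis by (simp add: hy)
  qed

  \<comment> \<open>\<open>C / c\<close> bounds the ratio of priors by [B](a), and \<open>C2\<close>
    is the additive constant of \<open>rescaled_upper_bound\<close>.\<close>
  have Gbound: "norm (G k u) \<le> C / c * exp C2 * exp (- (\<kappa> / 4) * (norm u)\<^sup>2)" for k u
  proof (cases "y k u \<in> \<Theta>")
    case True
    have "E k u \<le> - (\<kappa> / 4) * (norm u)\<^sup>2 + C2"
      using rescaled_upper_bound[OF K t max0 N1 L, of k u] True unfolding E_def y_def C2_def by simp
    then have e: "exp (E k u) \<le> exp C2 * exp (- (\<kappa> / 4) * (norm u)\<^sup>2)"
      by (simp add: exp_add[symmetric] add.commute)
    have p: "0 \<le> \<pi> (N k) (y k u)" "\<pi> (N k) (y k u) \<le> C" "c \<le> \<pi> (N k) \<theta>0"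
      using nonneg[OF N1[of k] True] C[OF N1[of k] True] c(2)[OF N1[of k]] by auto
    then have "\<pi> (N k) (y k u) / \<pi> (N k) \<theta>0 \<le> C / c"
      using c(1) by (intro frac_le) auto
    then have "exp (E k u) * (\<pi> (N k) (y k u) / \<pi> (N k) \<theta>0) \<le> (exp C2 * exp (- (\<kappa> / 4) * (norm u)\<^sup>2)) * (C / c)"
      using p p0[of k] by (intro mult_mono e) auto
    then show ?thesis using True p p0[of k] by (simp add: G_def ac_simps)
  next
    case False
    have "C \<ge> 0" using C[OF N1[of 0] th0(1)] p0[of 0] by simp
    then show ?thesis using False c(1) by (simp add: G_def)
  qed
  have ylim: "(\<lambda>k. y k u) \<longlonglongrightarrow> \<theta>0" for u
    unfolding y_def by (rule rescaled_pointwise_limit(1)[OF N N1 Qlim tlim max])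
  have Elim: "(\<lambda>k. E k u) \<longlonglongrightarrow> - (u \<bullet> (info *v u)) / 2" for u
    unfolding y_def E_def by (rule rescaled_pointwise_limit(2)[OF N N1 Qlim tlim max])
  have yin: "eventually (\<lambda>k. y k u \<in> \<Theta>) sequentially" for u
    using topological_tendstoD[OF ylim[of u] open_interior interior]
    by eventually_elim (use interior_subset in blast)
  have Glim: "(\<lambda>k. G k u) \<longlonglongrightarrow> exp (- (u \<bullet> (info *v u)) / 2)" for u
  proof -
    have "(\<lambda>k. \<pi> (N k) (y k u) / \<pi> (N k) \<theta>0) \<longlonglongrightarrow> 1"
    proof (rule prior_ratio_limit[OF N N1 B nonneg _ yin])
      fix k
      have "norm (y k u - \<theta>0) \<le> norm (t k - \<theta>0) + norm ((1 / sqrt (real (N k))) *\<^sub>R u)"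
        unfolding y_def by (metis add_diff_eq add.commute norm_triangle_ineq)
      then have "sqrt (real (N k)) * norm (y k u - \<theta>0)
          \<le> sqrt (real (N k)) * (norm (t k - \<theta>0) + norm ((1 / sqrt (real (N k))) *\<^sub>R u))"
        by (intro mult_left_mono) auto
      also have "\<dots> \<le> K * L / \<kappa> + norm u"
        using rate[of k] sN[of k] by (simp add: distrib_left)
      finally show "sqrt (real (N k)) * norm (y k u - \<theta>0) \<le> K * L / \<kappa> + norm u" .
    qed
    then have "(\<lambda>k. exp (E k u) * (\<pi> (N k) (y k u) / \<pi> (N k) \<theta>0)) \<longlonglongrightarrow> exp (- (u \<bullet> (info *v u)) / 2) * 1"
      by (intro tendsto_mult tendsto_exp Elim)
    moreover have "\<forall>\<^sub>F k in sequentially. exp (E k u) * (\<pi> (N k) (y k u) / \<pi> (N k) \<theta>0) = G k u"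
      using yin[of u] by eventually_elim (simp add: G_def)
    ultimately show ?thesis by (simp add: Lim_transform_eventually)
  qed
  define Z where "Z = (\<lambda>k. \<integral>u. G k u \<partial>lborel)"
  define Z0 where "Z0 = (2 * pi) powr (real CARD('q) / 2) / sqrt (det info)"
  note gauss = has_bochner_integral_gaussian[OF pd]
  have "Z \<longlonglongrightarrow> (\<integral>u. exp (- (u \<bullet> (info *v u)) / 2) \<partial>lborel)"
    unfolding Z_def
  proof (rule integral_dominated_convergence[where w="\<lambda>u. C / c * exp C2 * exp (- (\<kappa> / 4) * (norm u)\<^sup>2)"])
    show "(\<lambda>u. exp (- (u \<bullet> (info *v u)) / 2)) \<in> borel_measurable lborel"
      using has_bochner_integral_iff gauss by blast
    show "integrable lborel (\<lambda>u::real^'q. C / c * exp C2 * exp (- (\<kappa> / 4) * (norm u)\<^sup>2))"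
      using \<kappa> by (intro integrable_mult_right integrable_exp_neg_norm_square) simp
  qed (use Gm Glim Gbound in auto)
  then have Zlim: "Z \<longlonglongrightarrow> Z0"
    unfolding Z0_def using has_bochner_integral_integral_eq[OF gauss] by simp
  have Zeq: "(\<integral>u. G k u \<partial>lborel) = Z k" for k by (simp add: Z_def)
  have Z0: "Z0 > 0" unfolding Z0_def using dpos by simp
  have Zpos: "eventually (\<lambda>k. Z k > 0) sequentially" by (rule order_tendstoD(1)[OF Zlim Z0])
  have Dpos: "eventually (\<lambda>k. det (- H k) > 0) sequentially" by (rule order_tendstoD(1)[OF detlim dpos])
  \<comment> \<open>Half the logarithm of n^q offsets the Jacobian n^(-q/2) in
    \<open>Itrans\<close>.\<close>
  have detN: "det (- (real (N k) *\<^sub>R hessian (f (Q k)) (t k))) = real (N k) ^ CARD('q) * det (- H k)" for k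
    using det_scaleR[of "real (N k)" "- H k"] by (simp add: H_def)
  show "eventually (\<lambda>k. evidence (\<pi> (N k)) (N k) (Q k) > 0 \<and>
      det (- (real (N k) *\<^sub>R hessian (f (Q k)) (t k))) > 0) sequentially"
    using Zpos Dpos
  proof eventually_elim
    case (elim k)
    then show ?case
      using p0[of k] N1[of k] unfolding Itrans detN Zeq
      by (intro conjI mult_pos_pos zero_less_power) auto
  qed
  \<comment> \<open>For large \<open>k\<close> this is exactly the Laplace error after all
    cancellations: an integral and a determinant, each compared with its limit.\<close>
  have "(\<lambda>k. ln (Z k) - ln Z0 + 1 / 2 * (ln (det (- H k)) - ln (det info))) \<longlonglongrightarrow> (ln Z0 - ln Z0) + 1 / 2 * (ln (det info) - ln (det info))"
    using Z0 dpos by (intro tendsto_intros Zlim detlim) auto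
  then have lim: "(\<lambda>k. ln (Z k) - ln Z0 + 1 / 2 * (ln (det (- H k)) - ln (det info))) \<longlonglongrightarrow> 0" by simp
  have lnZ0: "ln Z0 = real CARD('q) / 2 * ln (2 * pi) - 1 / 2 * ln (det info)"
    unfolding Z0_def using dpos by (simp add: ln_div ln_powr ln_sqrt)
  show "(\<lambda>k. laplace_error (\<pi> (N k)) (N k) (Q k) (t k)) \<longlonglongrightarrow> 0"
  proof (rule Lim_transform_eventually[OF lim])
    show "\<forall>\<^sub>F k in sequentially. ln (Z k) - ln Z0 + 1 / 2 * (ln (det (- H k)) - ln (det info)) =
      laplace_error (\<pi> (N k)) (N k) (Q k) (t k)"
      using Zpos Dpos
    proof eventually_elim
      case (elim k)
      have Np: "real (N k) > 0" using N1[of k] by simp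
      have "ln (evidence (\<pi> (N k)) (N k) (Q k))
          = - (real CARD('q) / 2 * ln (real (N k))) + (real (N k) * f (Q k) (t k) + ln (\<pi> (N k) \<theta>0) + ln (Z k))"
        unfolding Itrans Zeq using elim p0[of k] Np
        by (simp add: ln_mult ln_div ln_realpow ln_sqrt power_divide)
      moreover have "ln (det (- (real (N k) *\<^sub>R hessian (f (Q k)) (t k)))) = real CARD('q) * ln (real (N k)) + ln (det (- H k))"
        unfolding detN using elim Np by (simp add: ln_mult ln_realpow)
      ultimately show ?case by (simp add: laplace_error_def lnZ0 algebra_simps)
    qed
  qed
qed

end


section \<open>Moments of Gaussian increments\<close>

text \<open>Independence is given for families of sets and is passed to the preimages under
  \<open>X\<close> and \<open>Y\<close>. These already form sigma-algebras, so they coincide with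
  the generated ones in the definition of independent variables.\<close>

lemma (in prob_space) indep_set_expectation_mult:
  fixes X Y :: "'a \<Rightarrow> real"
  assumes indep: "indep_set A B"
    and XA: "\<And>S. S \<in> sets borel \<Longrightarrow> X -` S \<inter> space M \<in> A"
    and YB: "\<And>S. S \<in> sets borel \<Longrightarrow> Y -` S \<inter> space M \<in> B"
    and X: "integrable M X" and Y: "integrable M Y"
  shows "integrable M (\<lambda>w. X w * Y w)" "expectation (\<lambda>w. X w * Y w) = expectation X * expectation Y"
proof -
  have gen: "sigma_sets (space M) {Z -` S \<inter> space M |S. S \<in> sets borel} = {Z -` S \<inter> space M |S. S \<in> sets borel}"
    for Z :: "'a \<Rightarrow> real"
    using sets_vimage_algebra[of "space M" Z borel] sets_vimage_algebra2[of Z "space M" borel] by simp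
  have "indep_set {X -` S \<inter> space M |S. S \<in> sets borel} {Y -` S \<inter> space M |S. S \<in> sets borel}"
    using indep unfolding indep_set_def
    by (rule indep_sets_mono_sets) (use XA YB in \<open>auto split: bool.splits\<close>)
  then have "indep_var borel X borel Y"
    unfolding indep_var_eq gen using X Y by auto
  from indep_var_integrable[OF this X Y] indep_var_lebesgue_integral[OF this X Y]
  show "integrable M (\<lambda>w. X w * Y w)" "expectation (\<lambda>w. X w * Y w) = expectation X * expectation Y" .
qed

lemma integrable_mult_of_squares:
  fixes X Y :: "'a \<Rightarrow> real"
  assumes [measurable]: "X \<in> borel_measurable M" "Y \<in> borel_measurable M"
    and X: "integrable M (\<lambda>w. (X w)\<^sup>2)" and Y: "integrable M (\<lambda>w. (Y w)\<^sup>2)"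
  shows "integrable M (\<lambda>w. X w * Y w)"
proof (rule Bochner_Integration.integrable_bound[OF Bochner_Integration.integrable_add[OF X Y]])
  have "\<bar>x * y\<bar> \<le> x\<^sup>2 + y\<^sup>2" for x y :: real
  proof -
    have "2 * (\<bar>x\<bar> * \<bar>y\<bar>) \<le> x\<^sup>2 + y\<^sup>2"
      using sum_squares_bound[of "\<bar>x\<bar>" "\<bar>y\<bar>"] by simp
    moreover have "0 \<le> \<bar>x\<bar> * \<bar>y\<bar>" by simp
    ultimately show ?thesis unfolding abs_mult by linarith
  qed
  then show "AE w in M. norm (X w * Y w) \<le> norm ((X w)\<^sup>2 + (Y w)\<^sup>2)" by auto
qed measurable

text \<open>Fubini for product functions, transported from the product measure by
  \<open>lborel_vec_eq\<close>.\<close>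

lemma has_bochner_integral_lborel_vec_prod:
  fixes \<phi> :: "'r::finite \<Rightarrow> real \<Rightarrow> real"
  assumes int: "\<And>i. integrable lborel (\<phi> i)"
  shows "has_bochner_integral lborel (\<lambda>x::real^'r. \<Prod>i\<in>UNIV. \<phi> i (x $ i)) (\<Prod>i\<in>UNIV. \<integral>x. \<phi> i x \<partial>lborel)"
proof -
  interpret product_sigma_finite "\<lambda>_::'r. lborel :: real measure" ..
  have [measurable]: "\<phi> i \<in> borel_measurable borel" for i
    using borel_measurable_integrable[OF int[of i]] by simp
  have meas: "(\<lambda>x::real^'r. \<Prod>i\<in>UNIV. \<phi> i (x $ i)) \<in> borel_measurable borel"
    by measurable
  have "has_bochner_integral (\<Pi>\<^sub>M i\<in>UNIV. lborel) (\<lambda>f. \<Prod>i\<in>UNIV. \<phi> i (f i)) (\<Prod>i\<in>UNIV. \<integral>x. \<phi> i x \<partial>lborel)"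
    unfolding has_bochner_integral_iff
    by (intro conjI product_integrable_prod product_integral_prod int) auto
  then show ?thesis
    using meas unfolding lborel_vec_eq has_bochner_integral_iff
    by (simp add: integrable_distr_eq integral_distr)
qed

lemma normal_integrals:
  assumes s: "s > 0"
  shows "has_bochner_integral lborel (\<lambda>x. normal_density 0 (sqrt s) x) 1"
    "has_bochner_integral lborel (\<lambda>x. normal_density 0 (sqrt s) x * x) 0"
    "has_bochner_integral lborel (\<lambda>x. normal_density 0 (sqrt s) x * x\<^sup>2) s"
    "has_bochner_integral lborel (\<lambda>x. normal_density 0 (sqrt s) x * x ^ 4) (3 * s\<^sup>2)"
proof -
  have ss: "sqrt s > 0" using s by simp
  show "has_bochner_integral lborel (\<lambda>x. normal_density 0 (sqrt s) x) 1"
    using normal_moment_even[OF ss, of 0 0] by simp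
  show "has_bochner_integral lborel (\<lambda>x. normal_density 0 (sqrt s) x * x) 0"
    using normal_moment_odd[OF ss, of 0 0] by simp
  show "has_bochner_integral lborel (\<lambda>x. normal_density 0 (sqrt s) x * x\<^sup>2) s"
    using normal_moment_even[OF ss, of 0 1] s by simp
  show "has_bochner_integral lborel (\<lambda>x. normal_density 0 (sqrt s) x * x ^ 4) (3 * s\<^sup>2)"
    using normal_moment_even[OF ss, of 0 2] s by (simp add: fact_numeral power2_eq_square field_simps)
qed

text \<open>All three are cases of one product formula with exponent \<open>k\<close> at coordinate
  \<open>a\<close> and \<open>l\<close> at \<open>b\<close>. For equal coordinates the exponents add
  up, which turns two second moments into the fourth moment 3 s^2.\<close>

lemma gaussian_vec_moments:
  fixes a b :: "'r::finite"
  assumes s: "s > 0"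
  defines "p \<equiv> \<lambda>x::real^'r. \<Prod>i\<in>UNIV. normal_density 0 (sqrt s) (x $ i)"
  shows "has_bochner_integral lborel (\<lambda>x. p x * (x $ a * x $ b)) (if a = b then s else 0)"
    and "has_bochner_integral lborel (\<lambda>x. p x * ((x $ a)\<^sup>2 * (x $ b)\<^sup>2)) (if a = b then 3 * s\<^sup>2 else s\<^sup>2)"
    and "has_bochner_integral lborel (\<lambda>x. p x * x $ a) 0"
proof -
  let ?n = "normal_density 0 (sqrt s)"
  have prod_if: "(\<Prod>i\<in>UNIV. ?n (x $ i) * F i) = p x * (\<Prod>i\<in>UNIV. F i)" for x :: "real^'r" and F
    by (simp add: p_def prod.distrib)
  have single: "(\<Prod>i\<in>UNIV. if i = a then c i else 1) = c a" for c :: "'r \<Rightarrow> real" and a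
    by (simp add: prod.delta)
  have general: "has_bochner_integral lborel (\<lambda>x. p x * (x $ a ^ k * x $ b ^ l))
      (\<Prod>i\<in>UNIV. \<integral>y. ?n y * y ^ ((if i = a then k else 0) + (if i = b then l else 0)) \<partial>lborel)" for k l
  proof -
    have "integrable lborel (\<lambda>y. ?n y * y ^ m)" for m
      using integrable_normal_moment[of "sqrt s" 0 m] s by simp
    then have "has_bochner_integral lborel
      (\<lambda>x::real^'r. \<Prod>i\<in>UNIV. ?n (x $ i) * (x $ i) ^ ((if i = a then k else 0) + (if i = b then l else 0)))
      (\<Prod>i\<in>UNIV. \<integral>y. ?n y * y ^ ((if i = a then k else 0) + (if i = b then l else 0)) \<partial>lborel)"
      by (rule has_bochner_integral_lborel_vec_prod)
    moreover have "(\<Prod>i\<in>UNIV. (x $ i) ^ ((if i = a then k else 0) + (if i = b then l else 0))) = x $ a ^ k * x $ b ^ l" for x :: "real^'r"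
    proof -
      have "(\<Prod>i\<in>UNIV. (x $ i) ^ ((if i = a then k else 0) + (if i = b then l else 0)))
        = (\<Prod>i\<in>UNIV. (if i = a then (x $ i) ^ k else 1) * (if i = b then (x $ i) ^ l else 1))"
        by (rule prod.cong) (auto simp: power_add)
      also have "\<dots> = x $ a ^ k * x $ b ^ l" by (simp add: prod.distrib single)
      finally show ?thesis .
    qed
    ultimately show ?thesis by (simp add: prod_if)
  qed
  define m where "m = (\<lambda>k. \<integral>y. ?n y * y ^ k \<partial>lborel)"
  have m: "m 0 = 1" "m 1 = 0" "m 2 = s" "m 4 = 3 * s\<^sup>2"
    unfolding m_def
    using has_bochner_integral_integral_eq[OF normal_integrals(1)[OF s]]
      has_bochner_integral_integral_eq[OF normal_integrals(2)[OF s]]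
      has_bochner_integral_integral_eq[OF normal_integrals(3)[OF s]]
      has_bochner_integral_integral_eq[OF normal_integrals(4)[OF s]] by simp_all
  have v: "(\<Prod>i\<in>UNIV. m ((if i = a then k else 0) + (if i = b then l else 0)))
     = (if a = b then m (k + l) else m k * m l)" for k l
  proof -
    have "(\<Prod>i\<in>UNIV. m ((if i = a then k else 0) + (if i = b then l else 0)))
      = (\<Prod>i\<in>UNIV. (if i = a then (if a = b then m (k + l) else m k) else 1)
          * (if i = b then (if a = b then 1 else m l) else 1))"
      by (rule prod.cong) (auto simp: m(1))
    also have "\<dots> = (if a = b then m (k + l) else m k * m l)"
      by (simp add: prod.distrib single)
    finally show ?thesis .
  qed
  have four: "(2::nat) + 2 = 4" by simp
  have res: "has_bochner_integral lborel (\<lambda>x. p x * (x $ a ^ k * x $ b ^ l)) (if a = b then m (k + l) else m k * m l)" for k l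
    by (subst v[symmetric]) (use general[of k l] in \<open>simp only: m_def\<close>)
  show "has_bochner_integral lborel (\<lambda>x. p x * (x $ a * x $ b)) (if a = b then s else 0)"
    using res[of 1 1] by (simp only: power_one_right one_add_one m mult_zero_left)
  show "has_bochner_integral lborel (\<lambda>x. p x * ((x $ a)\<^sup>2 * (x $ b)\<^sup>2)) (if a = b then 3 * s\<^sup>2 else s\<^sup>2)"
    using res[of 2 2, unfolded four] by (simp only: m power2_eq_square[of s])
  show "has_bochner_integral lborel (\<lambda>x. p x * x $ a) 0"
    using res[of 1 0] by (simp only: power_one_right power_0 mult_1_right add_0_right m if_cancel)
qed

text \<open>\<open>c\<close> is the covariance per unit time.\<close>

definition incr_prod :: "(real \<Rightarrow> 'w \<Rightarrow> real) \<Rightarrow> (real \<Rightarrow> 'w \<Rightarrow> real) \<Rightarrow> real \<Rightarrow> real \<Rightarrow> real \<Rightarrow> 'w \<Rightarrow> real" where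
  "incr_prod u v c s t w = (u t w - u s w) * (v t w - v s w) - c * (t - s)"

text \<open>What the tightness argument uses of the Wiener property: compensated products of
  increments have second moment of order (t - s)^2 and are orthogonal over non-overlapping
  intervals. The constant 2 is the variance of the square of a standard normal variable and also
  covers the value 1 of two independent factors.\<close>

definition uncorrelated_products :: "'w measure \<Rightarrow> (real \<Rightarrow> 'w \<Rightarrow> real) \<Rightarrow> (real \<Rightarrow> 'w \<Rightarrow> real) \<Rightarrow> real \<Rightarrow> bool" where
  "uncorrelated_products P u v c \<longleftrightarrow>
    (\<forall>s t. 0 \<le> s \<and> s < t \<longrightarrow> incr_prod u v c s t \<in> borel_measurable P \<and>
      integrable P (\<lambda>w. (incr_prod u v c s t w)\<^sup>2) \<and>
      (\<integral>w. (incr_prod u v c s t w)\<^sup>2 \<partial>P) \<le> 2 * (t - s)\<^sup>2) \<and>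
    (\<forall>s t s' t'. 0 \<le> s \<and> s < t \<and> t \<le> s' \<and> s' < t' \<longrightarrow>
      (\<integral>w. incr_prod u v c s t w * incr_prod u v c s' t' w \<partial>P) = 0)"

section \<open>Moments and orthogonality of Wiener increments\<close>

lemma stochastic_basisD:
  assumes "stochastic_basis P F"
  shows "prob_space P" "complete_measure P" "\<And>t. 0 \<le> t \<Longrightarrow> subalgebra P (F t)"
    "\<And>s t. 0 \<le> s \<Longrightarrow> s \<le> t \<Longrightarrow> subalgebra (F t) (F s)"
    "\<And>t. 0 \<le> t \<Longrightarrow> space (F t) = space P"
proof -
  note conj = assms[unfolded stochastic_basis_def]
  show "prob_space P" using conj by (rule conjunct1)
  show "complete_measure P" using conj[THEN conjunct2] by (rule conjunct1)
  have all_sub: "\<forall>t\<ge>0. subalgebra P (F t)" using conj[THEN conjunct2, THEN conjunct2] by (rule conjunct1)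
  have mono: "\<forall>s t. 0 \<le> s \<and> s \<le> t \<longrightarrow> sets (F s) \<subseteq> sets (F t)"
    using conj[THEN conjunct2, THEN conjunct2, THEN conjunct2] by (rule conjunct1)
  have sub: "subalgebra P (F t)" if "0 \<le> t" for t using all_sub that by blast
  then show "\<And>t. 0 \<le> t \<Longrightarrow> subalgebra P (F t)" by blast
  have sp: "space (F t) = space P" if "0 \<le> t" for t using sub[OF that] by (simp add: subalgebra_def)
  then show "\<And>t. 0 \<le> t \<Longrightarrow> space (F t) = space P" by blast
  show "subalgebra (F t) (F s)" if "0 \<le> s" "s \<le> t" for s t
  proof -
    have "sets (F s) \<subseteq> sets (F t)" using mono that by blast
    then show ?thesis using sp[of s] sp[of t] that by (simp add: subalgebra_def)
  qed
qed

lemma wiener_measurable: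
  assumes "stochastic_basis P F" "wiener_process P F W" "0 \<le> s" "s \<le> t"
  shows "W s \<in> borel_measurable (F t)"
proof -
  have "W s \<in> borel_measurable (F s)" using assms unfolding wiener_process_def by blast
  then show ?thesis by (rule measurable_from_subalg[OF stochastic_basisD(4)[OF assms(1,3,4)]])
qed

lemma wiener_measurable_P:
  assumes "stochastic_basis P F" "wiener_process P F W" "0 \<le> s"
  shows "W s \<in> borel_measurable P"
  by (rule measurable_from_subalg[OF stochastic_basisD(3)[OF assms(1,3)] wiener_measurable[OF assms order_refl]])

lemma wiener_increment_moments:
  fixes W :: "real \<Rightarrow> 'w \<Rightarrow> real^'r"
  assumes W: "wiener_process P F W" and st: "0 \<le> s" "s < t"
  shows "has_bochner_integral P (\<lambda>w. (W t w $ a - W s w $ a) * (W t w $ b - W s w $ b)) (if a = b then t - s else 0)"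
    and "has_bochner_integral P (\<lambda>w. (W t w $ a - W s w $ a)\<^sup>2 * (W t w $ b - W s w $ b)\<^sup>2)
      (if a = b then 3 * (t - s)\<^sup>2 else (t - s)\<^sup>2)"
    and "has_bochner_integral P (\<lambda>w. W t w $ a - W s w $ a) 0"
proof -
  let ?p = "\<lambda>x::real^'r. \<Prod>i\<in>UNIV. normal_density 0 (sqrt (t - s)) (x $ i)"
  have D: "distributed P lborel (\<lambda>w. W t w - W s w) ?p"
    using W st unfolding wiener_process_def by blast
  have nn: "0 \<le> ?p x" for x by (intro prod_nonneg) simp
  have transfer: "has_bochner_integral P (\<lambda>w. g (W t w - W s w)) c"
    if g: "g \<in> borel_measurable borel" and i: "has_bochner_integral lborel (\<lambda>x. ?p x * g x) c" for g :: "real^'r \<Rightarrow> real" and c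
    using i distributed_integrable[OF D, of g] distributed_integral[OF D, of g] nn g
    by (simp add: has_bochner_integral_iff)
  have ts: "t - s > 0" using st by simp
  have [measurable]: "(\<lambda>x::real^'r. x $ i) \<in> borel_measurable borel" for i by (simp add: borel_measurable_nth)
  have "has_bochner_integral P (\<lambda>w. (W t w - W s w) $ a * (W t w - W s w) $ b) (if a = b then t - s else 0)"
    by (rule transfer[of "\<lambda>x. x $ a * x $ b"]) (simp, rule gaussian_vec_moments(1)[OF ts])
  then show "has_bochner_integral P (\<lambda>w. (W t w $ a - W s w $ a) * (W t w $ b - W s w $ b)) (if a = b then t - s else 0)"
    by simp
  have "has_bochner_integral P (\<lambda>w. ((W t w - W s w) $ a)\<^sup>2 * ((W t w - W s w) $ b)\<^sup>2) (if a = b then 3 * (t - s)\<^sup>2 else (t - s)\<^sup>2)"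
    by (rule transfer[of "\<lambda>x. (x $ a)\<^sup>2 * (x $ b)\<^sup>2"]) (simp, rule gaussian_vec_moments(2)[OF ts])
  then show "has_bochner_integral P (\<lambda>w. (W t w $ a - W s w $ a)\<^sup>2 * (W t w $ b - W s w $ b)\<^sup>2)
      (if a = b then 3 * (t - s)\<^sup>2 else (t - s)\<^sup>2)"
    by simp
  have "has_bochner_integral P (\<lambda>w. (W t w - W s w) $ a) 0"
    by (rule transfer[of "\<lambda>x. x $ a"]) (simp, rule gaussian_vec_moments(3)[OF ts])
  then show "has_bochner_integral P (\<lambda>w. W t w $ a - W s w $ a) 0" by simp
qed

text \<open>The increment is independent of \<open>F s\<close>, so any integrable
  \<open>F s\<close>-measurable factor splits off; this is an orthogonality whenever one of the
  means is zero.\<close>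

lemma wiener_increment_orthogonal:
  fixes W :: "real \<Rightarrow> 'w \<Rightarrow> real^'r" and Y :: "'w \<Rightarrow> real" and g :: "real^'r \<Rightarrow> real"
  assumes basis: "stochastic_basis P F" and W: "wiener_process P F W" and st: "0 \<le> s" "s < t"
    and Y: "Y \<in> borel_measurable (F s)" "integrable P Y"
    and g: "g \<in> borel_measurable borel" and gi: "integrable P (\<lambda>w. g (W t w - W s w))"
  shows "(\<integral>w. Y w * g (W t w - W s w) \<partial>P) = (\<integral>w. Y w \<partial>P) * (\<integral>w. g (W t w - W s w) \<partial>P)"
    (is "?L = ?R")
proof -
  interpret prob_space P by (rule stochastic_basisD(1)[OF basis])
  have sp: "space (F s) = space P" by (rule stochastic_basisD(5)[OF basis st(1)])
  have ind: "indep_set (sets (F s)) {(\<lambda>w. W t w - W s w) -` A \<inter> space P | A. A \<in> sets borel}"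
    using W st unfolding wiener_process_def by blast
  show ?thesis
  proof (rule indep_set_expectation_mult(2)[OF ind _ _ Y(2) gi])
    fix S :: "real set" assume S: "S \<in> sets borel"
    show "Y -` S \<inter> space P \<in> sets (F s)" using measurable_sets[OF Y(1) S] sp by simp
    have "(\<lambda>w. g (W t w - W s w)) -` S \<inter> space P = (\<lambda>w. W t w - W s w) -` (g -` S) \<inter> space P" by auto
    moreover have "g -` S \<in> sets borel" using measurable_sets[OF g S] by simp
    ultimately show "(\<lambda>w. g (W t w - W s w)) -` S \<inter> space P \<in> {(\<lambda>w. W t w - W s w) -` A \<inter> space P | A. A \<in> sets borel}"
      by blast
  qed
qed

text \<open>The later product is a function of an increment independent of \<open>F s'\<close> and
  has mean zero, while the earlier one is \<open>F s'\<close>-measurable. The second moment is 3 - 2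
  + 1 = 2 times (t - s)^2 for a = b and once (t - s)^2 otherwise.\<close>

lemma wiener_uncorrelated_products:
  fixes W :: "real \<Rightarrow> 'w \<Rightarrow> real^'r"
  assumes basis: "stochastic_basis P F" and W: "wiener_process P F W"
  shows "uncorrelated_products P (\<lambda>t w. W t w $ a) (\<lambda>t w. W t w $ b) (if a = b then 1 else 0)"
proof -
  interpret prob_space P by (rule stochastic_basisD(1)[OF basis])
  let ?c = "if a = b then 1 else 0 :: real"
  let ?Y = "incr_prod (\<lambda>t w. W t w $ a) (\<lambda>t w. W t w $ b) ?c"
  have nth: "(\<lambda>x::real^'r. x $ i) \<in> borel_measurable borel" for i by (simp add: borel_measurable_nth)
  have Fm: "?Y s t \<in> borel_measurable (F r)" if "0 \<le> s" "s < t" "t \<le> r" for s t r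
  proof -
    have [measurable]: "W s \<in> borel_measurable (F r)" "W t \<in> borel_measurable (F r)"
      using that by (auto intro!: wiener_measurable[OF basis W])
    have [measurable]: "(\<lambda>w. W s w $ i) \<in> borel_measurable (F r)" "(\<lambda>w. W t w $ i) \<in> borel_measurable (F r)" for i
      by (rule measurable_compose[OF _ nth], simp)+
    show ?thesis unfolding incr_prod_def by measurable
  qed
  have mean: "has_bochner_integral P (?Y s t) 0" if "0 \<le> s" "s < t" for s t
  proof -
    have "has_bochner_integral P (?Y s t) ((if a = b then t - s else 0) - ?c * (t - s))"
      unfolding incr_prod_def
      by (intro has_bochner_integral_diff wiener_increment_moments(1)[OF W that])
         (simp add: has_bochner_integral_iff prob_space)
    then show ?thesis by (auto split: if_splits)
  qed
  have sq: "has_bochner_integral P (\<lambda>w. (?Y s t w)\<^sup>2) (if a = b then 2 * (t - s)\<^sup>2 else (t - s)\<^sup>2)" if "0 \<le> s" "s < t" for s t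
  proof -
    \<comment> \<open>\<open>?c\<close> is 0 or 1, so its square is written as
      \<open>?c\<close>.\<close>
    have eq: "(?Y s t w)\<^sup>2 = (W t w $ a - W s w $ a)\<^sup>2 * (W t w $ b - W s w $ b)\<^sup>2
      - 2 * ?c * (t - s) * ((W t w $ a - W s w $ a) * (W t w $ b - W s w $ b)) + ?c * (t - s)\<^sup>2" for w
      unfolding incr_prod_def by (simp add: power2_eq_square algebra_simps)
    have "has_bochner_integral P (\<lambda>w. (?Y s t w)\<^sup>2) ((if a = b then 3 * (t - s)\<^sup>2 else (t - s)\<^sup>2)
      - 2 * ?c * (t - s) * (if a = b then t - s else 0) + ?c * (t - s)\<^sup>2)"
      unfolding eq
      by (intro has_bochner_integral_add has_bochner_integral_diff has_bochner_integral_mult_right wiener_increment_moments[OF W that])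
         (simp add: has_bochner_integral_iff prob_space)
    moreover have "(if a = b then 3 * (t - s)\<^sup>2 else (t - s)\<^sup>2)
      - 2 * ?c * (t - s) * (if a = b then t - s else 0) + ?c * (t - s)\<^sup>2 = (if a = b then 2 * (t - s)\<^sup>2 else (t - s)\<^sup>2)"
      by (simp add: power2_eq_square algebra_simps)
    ultimately show ?thesis by (simp only:)
  qed
  show ?thesis
    unfolding uncorrelated_products_def
  proof (intro conjI allI impI; elim conjE)
    fix s t :: real assume st: "0 \<le> s" "s < t"
    show "?Y s t \<in> borel_measurable P"
      using st by (intro measurable_from_subalg[OF stochastic_basisD(3)[OF basis] Fm[OF st order_refl]]) simp
    show "integrable P (\<lambda>w. (?Y s t w)\<^sup>2)" using sq[OF st] by (simp add: has_bochner_integral_iff)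
    show "(\<integral>w. (?Y s t w)\<^sup>2 \<partial>P) \<le> 2 * (t - s)\<^sup>2"
      using sq[OF st] by (auto simp: has_bochner_integral_iff)
  next
    fix s t s' t' :: real assume st: "0 \<le> s" "s < t" "t \<le> s'" "s' < t'"
    let ?g = "\<lambda>x::real^'r. x $ a * x $ b - ?c * (t' - s')"
    have gY: "(\<lambda>w. ?g (W t' w - W s' w)) = ?Y s' t'" by (auto simp: incr_prod_def)
    have s't': "0 \<le> s'" "s' < t'" using st by auto
    have "(\<integral>w. ?Y s t w * ?g (W t' w - W s' w) \<partial>P) = (\<integral>w. ?Y s t w \<partial>P) * (\<integral>w. ?g (W t' w - W s' w) \<partial>P)"
    proof (rule wiener_increment_orthogonal[OF basis W s't' Fm[OF st(1-3)]])
      show "integrable P (?Y s t)" using mean[OF st(1,2)] by (simp add: has_bochner_integral_iff)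
      show "?g \<in> borel_measurable borel" using nth by measurable
      show "integrable P (\<lambda>w. ?g (W t' w - W s' w))" unfolding gY using mean[OF s't'] by (simp add: has_bochner_integral_iff)
    qed
    also have "(\<integral>w. ?Y s t w \<partial>P) = 0" using mean[OF st(1,2)] by (simp add: has_bochner_integral_iff)
    finally show "(\<integral>w. ?Y s t w * ?Y s' t' w \<partial>P) = 0" unfolding fun_cong[OF gY] by simp
  qed
qed

lemma sets_process_sigma:
  "sets (sigma (space P) (process_sigma P W)) = process_sigma P W"
proof -
  have sub: "{W t -` A \<inter> space P |t A. 0 \<le> t \<and> A \<in> sets borel} \<subseteq> Pow (space P)" by auto
  have "process_sigma P W \<subseteq> Pow (space P)"
    unfolding process_sigma_def using sigma_sets_into_sp[OF sub] by blast
  then show ?thesis using sigma_sets_sigma_sets_eq[OF sub] by (simp add: process_sigma_def)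
qed

lemma process_sigma_measurable:
  fixes W :: "real \<Rightarrow> 'w \<Rightarrow> real^'r"
  assumes "0 \<le> t"
  shows "W t \<in> borel_measurable (sigma (space P) (process_sigma P W))"
proof (rule measurableI)
  fix A :: "(real^'r) set" assume "A \<in> sets borel"
  then have "W t -` A \<inter> space P \<in> process_sigma P W"
    unfolding process_sigma_def using assms by (intro sigma_sets.Basic) blast
  then show "W t -` A \<inter> space (sigma (space P) (process_sigma P W)) \<in> sets (sigma (space P) (process_sigma P W))"
    unfolding sets_process_sigma by (simp add: space_measure_of_conv)
qed simp

text \<open>Each process has increments independent of the filtration, but nothing is stated about
  the pair. Orthogonality therefore rests on the independence of whole paths: the expectation of the
  four increments splits into one factor per process, and the factor of \<open>W\<close> vanishes
  because its disjoint increments are uncorrelated.\<close>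

lemma independent_wiener_uncorrelated_products:
  fixes W :: "real \<Rightarrow> 'w \<Rightarrow> real^'r" and V :: "real \<Rightarrow> 'w \<Rightarrow> real^'s"
  assumes basis: "stochastic_basis P F" and W: "wiener_process P F W" and V: "wiener_process P F V"
    and ind: "prob_space.indep_set P (process_sigma P W) (process_sigma P V)"
  shows "uncorrelated_products P (\<lambda>t w. W t w $ a) (\<lambda>t w. V t w $ b) 0"
proof -
  interpret prob_space P by (rule stochastic_basisD(1)[OF basis])
  have nth: "(\<lambda>x::real^'d. x $ i) \<in> borel_measurable borel" for i :: "'d::finite"
    by (simp add: borel_measurable_nth)
  let ?u = "\<lambda>s t w. W t w $ a - W s w $ a" and ?v = "\<lambda>s t w. V t w $ b - V s w $ b"
  have um: "?u s t \<in> borel_measurable (sigma (space P) (process_sigma P W))" if "0 \<le> s" "0 \<le> t" for s t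
    by (intro borel_measurable_diff measurable_compose[OF process_sigma_measurable nth] that)
  have vm: "?v s t \<in> borel_measurable (sigma (space P) (process_sigma P V))" if "0 \<le> s" "0 \<le> t" for s t
    by (intro borel_measurable_diff measurable_compose[OF process_sigma_measurable nth] that)
  have uP: "?u s t \<in> borel_measurable P" if "0 \<le> s" "0 \<le> t" for s t
    by (intro borel_measurable_diff measurable_compose[OF wiener_measurable_P[OF basis W] nth] that)
  have vP: "?v s t \<in> borel_measurable P" if "0 \<le> s" "0 \<le> t" for s t
    by (intro borel_measurable_diff measurable_compose[OF wiener_measurable_P[OF basis V] nth] that)
  have product: "integrable P (\<lambda>w. f w * g w) \<and> expectation (\<lambda>w. f w * g w) = expectation f * expectation g"
    if f: "f \<in> borel_measurable (sigma (space P) (process_sigma P W))" "integrable P f"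
      and g: "g \<in> borel_measurable (sigma (space P) (process_sigma P V))" "integrable P g" for f g :: "'w \<Rightarrow> real"
  proof -
    have fS: "f -` S \<inter> space P \<in> process_sigma P W" if "S \<in> sets borel" for S
      using measurable_sets[OF f(1) that] unfolding sets_process_sigma by (simp add: space_measure_of_conv)
    have gS: "g -` S \<inter> space P \<in> process_sigma P V" if "S \<in> sets borel" for S
      using measurable_sets[OF g(1) that] unfolding sets_process_sigma by (simp add: space_measure_of_conv)
    show ?thesis using indep_set_expectation_mult[OF ind fS gS f(2) g(2)] by blast
  qed
  have u2: "has_bochner_integral P (\<lambda>w. (?u s t w)\<^sup>2) (t - s)" if "0 \<le> s" "s < t" for s t
    using wiener_increment_moments(1)[OF W that, of a a] by (simp add: power2_eq_square)
  have v2: "has_bochner_integral P (\<lambda>w. (?v s t w)\<^sup>2) (t - s)" if "0 \<le> s" "s < t" for s t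
    using wiener_increment_moments(1)[OF V that, of b b] by (simp add: power2_eq_square)
  have Y: "incr_prod (\<lambda>t w. W t w $ a) (\<lambda>t w. V t w $ b) 0 s t = (\<lambda>w. ?u s t w * ?v s t w)" for s t
    by (auto simp: incr_prod_def)
  show ?thesis
    unfolding uncorrelated_products_def Y
  proof (intro conjI allI impI; elim conjE)
    fix s t :: real assume st: "0 \<le> s" "s < t"
    then have t0: "0 \<le> t" by simp
    show "(\<lambda>w. ?u s t w * ?v s t w) \<in> borel_measurable P"
      by (intro borel_measurable_times uP vP st t0)
    have *: "integrable P (\<lambda>w. (?u s t w)\<^sup>2 * (?v s t w)\<^sup>2) \<and>
        expectation (\<lambda>w. (?u s t w)\<^sup>2 * (?v s t w)\<^sup>2) = expectation (\<lambda>w. (?u s t w)\<^sup>2) * expectation (\<lambda>w. (?v s t w)\<^sup>2)"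
      by (rule product) (use u2[OF st] v2[OF st] um[OF st(1) t0] vm[OF st(1) t0] in
          \<open>auto simp: has_bochner_integral_iff intro: borel_measurable_power\<close>)
    then show "integrable P (\<lambda>w. (?u s t w * ?v s t w)\<^sup>2)" by (simp add: power_mult_distrib)
    have "expectation (\<lambda>w. (?u s t w * ?v s t w)\<^sup>2) = (t - s)\<^sup>2"
      using * u2[OF st] v2[OF st] by (simp add: power_mult_distrib has_bochner_integral_iff power2_eq_square[of "t - s"])
    then show "expectation (\<lambda>w. (?u s t w * ?v s t w)\<^sup>2) \<le> 2 * (t - s)\<^sup>2" by simp
  next
    fix s t s' t' :: real assume st: "0 \<le> s" "s < t" "t \<le> s'" "s' < t'"
    then have nn: "0 \<le> t" "0 \<le> s'" "0 \<le> t'" by auto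
    have iu: "integrable P (\<lambda>w. ?u s t w * ?u s' t' w)"
      using u2[of s t] u2[of s' t'] st nn by (intro integrable_mult_of_squares uP) (auto simp: has_bochner_integral_iff)
    have iv: "integrable P (\<lambda>w. ?v s t w * ?v s' t' w)"
      using v2[of s t] v2[of s' t'] st nn by (intro integrable_mult_of_squares vP) (auto simp: has_bochner_integral_iff)
    have "expectation (\<lambda>w. ?u s t w * (\<lambda>x. x $ a) (W t' w - W s' w)) = expectation (?u s t) * expectation (\<lambda>w. (\<lambda>x. x $ a) (W t' w - W s' w))"
    proof (rule wiener_increment_orthogonal[OF basis W nn(2) st(4) _ _ nth])
      show "?u s t \<in> borel_measurable (F s')"
        using st nn by (intro borel_measurable_diff measurable_compose[OF wiener_measurable[OF basis W] nth]) auto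
      show "integrable P (?u s t)" "integrable P (\<lambda>w. (W t' w - W s' w) $ a)"
        using wiener_increment_moments(3)[OF W, of s t a] wiener_increment_moments(3)[OF W, of s' t' a] st nn
        by (auto simp: has_bochner_integral_iff)
    qed
    also have "expectation (?u s t) = 0"
      using wiener_increment_moments(3)[OF W st(1,2), of a] by (simp add: has_bochner_integral_iff)
    finally have zero: "expectation (\<lambda>w. ?u s t w * ?u s' t' w) = 0" by simp
    have "expectation (\<lambda>w. (?u s t w * ?u s' t' w) * (?v s t w * ?v s' t' w)) =
        expectation (\<lambda>w. ?u s t w * ?u s' t' w) * expectation (\<lambda>w. ?v s t w * ?v s' t' w)"
      using product[OF _ iu _ iv] um vm st nn by (auto intro!: borel_measurable_times)
    then show "expectation (\<lambda>w. ?u s t w * ?v s t w * (?u s' t' w * ?v s' t' w)) = 0"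
      unfolding zero by (simp add: ac_simps)
  qed
qed

lemma uncorrelated_products_commute:
  "uncorrelated_products P u v c \<longleftrightarrow> uncorrelated_products P v u c"
proof -
  have "incr_prod u v c = incr_prod v u c" by (simp add: incr_prod_def fun_eq_iff mult.commute)
  then show ?thesis by (simp add: uncorrelated_products_def)
qed

text \<open>Second-order substitute for being a standard Wiener process, chosen because it passes to
  stacked vectors by a check of pairs of coordinates.\<close>

definition std_increments :: "'w measure \<Rightarrow> (real \<Rightarrow> 'w \<Rightarrow> real^'r) \<Rightarrow> bool" where
  "std_increments P W \<longleftrightarrow>
    (\<forall>a b. uncorrelated_products P (\<lambda>t w. W t w $ a) (\<lambda>t w. W t w $ b) (if a = b then 1 else 0))"

definition cross_uncorrelated :: "'w measure \<Rightarrow> (real \<Rightarrow> 'w \<Rightarrow> real^'r) \<Rightarrow> (real \<Rightarrow> 'w \<Rightarrow> real^'s) \<Rightarrow> bool" where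
  "cross_uncorrelated P W V \<longleftrightarrow> (\<forall>a b. uncorrelated_products P (\<lambda>t w. W t w $ a) (\<lambda>t w. V t w $ b) 0)"

lemma vec_append_nth [simp]:
  "vec_append x y $ Inl a = x $ a" "vec_append x y $ Inr b = y $ b"
  by (simp_all add: vec_append_def)

lemma std_increments_append:
  assumes "std_increments P W" "std_increments P V" "cross_uncorrelated P W V"
  shows "std_increments P (\<lambda>t w. vec_append (W t w) (V t w))"
  unfolding std_increments_def
proof (intro allI)
  fix a b
  show "uncorrelated_products P (\<lambda>t w. vec_append (W t w) (V t w) $ a) (\<lambda>t w. vec_append (W t w) (V t w) $ b) (if a = b then 1 else 0)"
    using assms by (cases a; cases b)
      (auto simp: std_increments_def cross_uncorrelated_def uncorrelated_products_commute[of P "\<lambda>t w. V t w $ _" "\<lambda>t w. W t w $ _"])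
qed

lemma cross_uncorrelated_append:
  assumes "cross_uncorrelated P W V" "cross_uncorrelated P W V'"
  shows "cross_uncorrelated P W (\<lambda>t w. vec_append (V t w) (V' t w))"
  unfolding cross_uncorrelated_def
proof (intro allI)
  fix a b
  show "uncorrelated_products P (\<lambda>t w. W t w $ a) (\<lambda>t w. vec_append (V t w) (V' t w) $ b) 0"
    using assms by (cases b) (auto simp: cross_uncorrelated_def)
qed

lemma independent_processes4_std_increments:
  assumes basis: "stochastic_basis P F"
    and W: "wiener_process P F W1" "wiener_process P F W2" "wiener_process P F W3" "wiener_process P F W4"
    and ind: "independent_processes4 P W1 W2 W3 W4"
  shows "std_increments P (\<lambda>t w. vec_append (W1 t w) (vec_append (W2 t w) (vec_append (W3 t w) (W4 t w))))"
proof -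
  interpret prob_space P by (rule stochastic_basisD(1)[OF basis])
  let ?S = "[process_sigma P W1, process_sigma P W2, process_sigma P W3, process_sigma P W4]"
  have I: "indep_sets (\<lambda>j. ?S ! j) {..<4}" using ind by (simp add: independent_processes4_def)
  \<comment> \<open>Mutual independence of the four families yields each pair: the product rule is
    applied to the index set {i, j}.\<close>
  have pair: "indep_set (?S ! i) (?S ! j)" if "i < 4" "j < 4" "i \<noteq> j" for i j
    unfolding indep_sets2_eq
  proof (intro conjI ballI)
    show "?S ! i \<subseteq> events" "?S ! j \<subseteq> events" using I that by (auto simp: indep_sets_def)
    fix x y assume xy: "x \<in> ?S ! i" "y \<in> ?S ! j"
    have "prob (\<Inter>k\<in>{i, j}. if k = i then x else y) = (\<Prod>k\<in>{i, j}. prob (if k = i then x else y))"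
      using that xy by (intro indep_setsD[OF I]) auto
    then show "prob (x \<inter> y) = prob x * prob y" using that by (auto simp: Int_commute)
  qed
  have cross: "cross_uncorrelated P W V"
    if "wiener_process P F W" "wiener_process P F V" "indep_set (process_sigma P W) (process_sigma P V)"
    for W :: "real \<Rightarrow> 'a \<Rightarrow> real^'i" and V :: "real \<Rightarrow> 'a \<Rightarrow> real^'j"
    unfolding cross_uncorrelated_def
    by (intro allI independent_wiener_uncorrelated_products[OF basis that])
  have std: "std_increments P W" if "wiener_process P F W" for W :: "real \<Rightarrow> 'a \<Rightarrow> real^'i"
    unfolding std_increments_def by (intro allI wiener_uncorrelated_products[OF basis that])
  show ?thesis
    using pair[of 0 1] pair[of 0 2] pair[of 0 3] pair[of 1 2] pair[of 1 3] pair[of 2 3]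
    by (intro std_increments_append cross_uncorrelated_append std cross W) (simp_all add: numeral_2_eq_2 numeral_3_eq_3)
qed


section \<open>Tightness of the realized covariance\<close>

text \<open>The events that some \<open>Y n\<close> exceeds k decrease to a null set; continuity
  from above gives a level that serves all n at once.\<close>

lemma (in prob_space) tight_of_AE_bounded:
  fixes Y :: "nat \<Rightarrow> 'a \<Rightarrow> real"
  assumes Y [measurable]: "\<And>n. Y n \<in> borel_measurable M"
    and bdd: "AE w in M. \<exists>B. \<forall>n. Y n w \<le> B" and e: "e > 0"
  obtains L where "\<And>n. prob {w \<in> space M. Y n w > L} \<le> e"
proof -
  define A where "A = (\<lambda>k::nat. {w \<in> space M. \<exists>n. Y n w > real k})"
  have A [measurable]: "A k \<in> events" for k unfolding A_def by measurable
  have "decseq A"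
    unfolding decseq_def A_def by (auto intro: order.strict_trans1 of_nat_mono)
  then have lim: "(\<lambda>k. prob (A k)) \<longlonglongrightarrow> prob (\<Inter>k. A k)"
    by (intro finite_Lim_measure_decseq) auto
  have "AE w in M. w \<notin> (\<Inter>k. A k)"
    using bdd
  proof eventually_elim
    fix w assume "\<exists>B. \<forall>n. Y n w \<le> B"
    then obtain B where B: "\<And>n. Y n w \<le> B" by blast
    obtain k where "B \<le> real k" using real_arch_simple by blast
    then have "w \<notin> A k" using B unfolding A_def by (auto simp: not_less intro: order_trans)
    then show "w \<notin> (\<Inter>k. A k)" by blast
  qed
  then have "prob (\<Inter>k. A k) = 0" by (subst prob_eq_0) auto
  then have "eventually (\<lambda>k. prob (A k) < e) sequentially"
    using lim e by (intro order_tendstoD(2)[OF lim]) simp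
  then obtain k where k: "prob (A k) < e" using eventually_happens by fastforce
  show ?thesis
  proof (rule that[of "real k"])
    fix n
    have "prob {w \<in> space M. Y n w > real k} \<le> prob (A k)"
      by (rule finite_measure_mono[OF _ A]) (auto simp: A_def)
    then show "prob {w \<in> space M. Y n w > real k} \<le> e" using k by simp
  qed
qed

text \<open>Markov's inequality at the level (|C| + 1) / e, where the added 1 guarantees that the
  level is positive.\<close>

lemma (in prob_space) tight_of_integral_bounded:
  fixes Z :: "nat \<Rightarrow> 'a \<Rightarrow> real"
  assumes Z: "\<And>n. n \<ge> 1 \<Longrightarrow> integrable M (Z n)" "\<And>n w. 0 \<le> Z n w"
    and C: "\<And>n. n \<ge> 1 \<Longrightarrow> expectation (Z n) \<le> C" and e: "e > 0"
  obtains L where "\<And>n. n \<ge> 1 \<Longrightarrow> prob {w \<in> space M. Z n w > L} \<le> e"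
proof (rule that[of "(\<bar>C\<bar> + 1) / e"])
  fix n :: nat assume n: "n \<ge> 1"
  let ?L = "(\<bar>C\<bar> + 1) / e"
  have L: "?L > 0" using e by simp
  have [measurable]: "Z n \<in> borel_measurable M" using Z(1)[OF n] by simp
  have "prob {w \<in> space M. Z n w > ?L} \<le> prob {w \<in> space M. Z n w \<ge> ?L}"
    by (rule finite_measure_mono) auto
  also have "\<dots> \<le> expectation (Z n) / ?L"
    by (rule integral_Markov_inequality_measure[OF Z(1)[OF n], of "{}"]) (use Z(2) L in auto)
  also have "\<dots> \<le> (\<bar>C\<bar> + 1) / ?L" using C[OF n] L by (intro divide_right_mono) auto
  also have "\<dots> = e" using L e by simp
  finally show "prob {w \<in> space M. Z n w > ?L} \<le> e" .
qed

text \<open>Pythagoras: terms over disjoint intervals are orthogonal, so only the n diagonal terms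
  remain, each at most 2 h^2. The triangle inequality alone would lose a factor n and with it the
  root-n rate.\<close>

lemma uncorrelated_products_sum:
  fixes n :: nat and u v :: "real \<Rightarrow> 'w \<Rightarrow> real"
  assumes u: "uncorrelated_products P u v c" and h: "h > 0"
  defines "S \<equiv> \<lambda>w. \<Sum>i=1..n. incr_prod u v c ((real i - 1) * h) (real i * h) w"
  shows "S \<in> borel_measurable P" "integrable P (\<lambda>w. (S w)\<^sup>2)" "(\<integral>w. (S w)\<^sup>2 \<partial>P) \<le> 2 * real n * h\<^sup>2"
proof -
  let ?Y = "\<lambda>i. incr_prod u v c ((real i - 1) * h) (real i * h)"
  have ends: "0 \<le> (real i - 1) * h" "(real i - 1) * h < real i * h" "real i * h - (real i - 1) * h = h" if "i \<in> {1..n}" for i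
    using that h by (auto simp: algebra_simps)
  have m: "?Y i \<in> borel_measurable P" "integrable P (\<lambda>w. (?Y i w)\<^sup>2)" "(\<integral>w. (?Y i w)\<^sup>2 \<partial>P) \<le> 2 * h\<^sup>2" if "i \<in> {1..n}" for i
    using u ends[OF that] unfolding uncorrelated_products_def by metis+
  show "S \<in> borel_measurable P" unfolding S_def by (intro borel_measurable_sum m)
  have prod_int: "integrable P (\<lambda>w. ?Y i w * ?Y j w)" if "i \<in> {1..n}" "j \<in> {1..n}" for i j
    by (intro integrable_mult_of_squares m that)
  have orth: "(\<integral>w. ?Y i w * ?Y j w \<partial>P) = 0" if "i \<in> {1..n}" "j \<in> {1..n}" "i < j" for i j
  proof -
    have "real i \<le> real j - 1" using that by simp
    then have "real i * h \<le> (real j - 1) * h" using h by (intro mult_right_mono) auto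
    then show ?thesis
      using u ends[OF that(1)] ends[OF that(2)] unfolding uncorrelated_products_def by blast
  qed
  have orth': "(\<integral>w. ?Y i w * ?Y j w \<partial>P) = 0" if "i \<in> {1..n}" "j \<in> {1..n}" "i \<noteq> j" for i j
  proof (cases "i < j")
    case False
    then have "(\<integral>w. ?Y j w * ?Y i w \<partial>P) = 0" using that by (intro orth) auto
    then show ?thesis by (simp add: mult.commute)
  qed (use orth that in blast)
  have sq: "(S w)\<^sup>2 = (\<Sum>i=1..n. \<Sum>j=1..n. ?Y i w * ?Y j w)" for w
    unfolding S_def power2_eq_square sum_product ..
  show "integrable P (\<lambda>w. (S w)\<^sup>2)"
    unfolding sq by (intro Bochner_Integration.integrable_sum prod_int)
  have "(\<integral>w. (S w)\<^sup>2 \<partial>P) = (\<Sum>i=1..n. \<Sum>j=1..n. \<integral>w. ?Y i w * ?Y j w \<partial>P)"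
  proof -
    have "(\<integral>w. (S w)\<^sup>2 \<partial>P) = (\<Sum>i=1..n. \<integral>w. (\<Sum>j=1..n. ?Y i w * ?Y j w) \<partial>P)"
      unfolding sq by (intro Bochner_Integration.integral_sum Bochner_Integration.integrable_sum prod_int)
    also have "\<dots> = (\<Sum>i=1..n. \<Sum>j=1..n. \<integral>w. ?Y i w * ?Y j w \<partial>P)"
      by (intro sum.cong refl Bochner_Integration.integral_sum prod_int)
    finally show ?thesis .
  qed
  also have "\<dots> = (\<Sum>i=1..n. \<Sum>j=1..n. if j = i then \<integral>w. (?Y i w)\<^sup>2 \<partial>P else 0)"
    by (intro sum.cong refl) (auto simp: orth' power2_eq_square)
  also have "\<dots> = (\<Sum>i=1..n. \<integral>w. (?Y i w)\<^sup>2 \<partial>P)"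
    by (intro sum.cong refl) (subst sum.delta, auto)
  also have "\<dots> \<le> (\<Sum>i=1..n. 2 * h\<^sup>2)" by (intro sum_mono m)
  finally show "(\<integral>w. (S w)\<^sup>2 \<partial>P) \<le> 2 * real n * h\<^sup>2" by simp
qed

section \<open>Norms of outer products and the drift contribution\<close>

lemma norm_outer_le:
  fixes x :: "real^'m" and y :: "real^'n"
  shows "norm (\<chi> i j. x $ i * y $ j) \<le> norm x * norm y"
proof -
  have "norm (\<chi> i j. x $ i * y $ j) = L2_set (\<lambda>i. norm (x $ i *\<^sub>R y)) UNIV"
  proof -
    have "(\<chi> i j. x $ i * y $ j) $ i = x $ i *\<^sub>R y" for i by (simp add: vec_eq_iff)
    then show ?thesis unfolding norm_vec_def[of "\<chi> i j. x $ i * y $ j"] by simp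
  qed
  also have "\<dots> = norm x * norm y"
    by (simp add: norm_vec_def[of x] L2_set_left_distrib)
  finally show ?thesis by simp
qed

lemma norm_outer_sq_add_le:
  fixes x b :: "real^'m"
  shows "norm (outer_sq (x + b) - outer_sq x) \<le> 2 * norm x * norm b + (norm b)\<^sup>2"
proof -
  have eq: "outer_sq (x + b) - outer_sq x = (\<chi> i j. x $ i * b $ j) + (\<chi> i j. b $ i * x $ j) + (\<chi> i j. b $ i * b $ j)"
    by (simp add: outer_sq_def vec_eq_iff algebra_simps)
  have "norm (outer_sq (x + b) - outer_sq x) \<le> norm (\<chi> i j. x $ i * b $ j) + norm (\<chi> i j. b $ i * x $ j) + norm (\<chi> i j. b $ i * b $ j)"
    unfolding eq by (intro norm_triangle_le add_mono order_refl norm_triangle_ineq)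
  also have "\<dots> \<le> norm x * norm b + norm b * norm x + norm b * norm b"
    by (intro add_mono norm_outer_le)
  finally show ?thesis by (simp add: power2_eq_square mult.commute)
qed

lemma outer_sq_matrix_vector:
  fixes K :: "real^'r^'p"
  shows "outer_sq (K *v x) = K ** outer_sq x ** transpose K"
proof -
  have "outer_sq (K *v x) $ i $ j = (K ** outer_sq x ** transpose K) $ i $ j" for i j
    unfolding outer_sq_def matrix_vector_mult_def matrix_matrix_mult_def transpose_def
    by (simp add: sum_distrib_left sum_distrib_right ac_simps)
  then show ?thesis by (simp add: vec_eq_iff)
qed

lemma norm_matrix_le_sum:
  fixes A :: "real^'n^'m"
  shows "norm A \<le> (\<Sum>a\<in>UNIV. \<Sum>b\<in>UNIV. \<bar>A $ a $ b\<bar>)"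
proof -
  have "norm A \<le> (\<Sum>a\<in>UNIV. norm (A $ a))"
    unfolding norm_vec_def[of A] by (rule L2_set_le_sum) simp
  also have "\<dots> \<le> (\<Sum>a\<in>UNIV. \<Sum>b\<in>UNIV. \<bar>A $ a $ b\<bar>)"
    by (intro sum_mono norm_le_l1_cart)
  finally show ?thesis .
qed

text \<open>The drift part of each increment is of order \<open>1 / n\<close> and the martingale part of order
  \<open>n\<^sup>-\<^sup>1\<^sup>/\<^sup>2\<close>, so by AM-GM the mixed products of the realized covariance contribute \<open>O(n\<^sup>-\<^sup>1\<^sup>/\<^sup>2)\<close>.\<close>

lemma realized_covariance_pathwise_bound:
  fixes x b :: "nat \<Rightarrow> real^'p"
  assumes n: "n \<ge> (1::nat)" and M: "M \<ge> 0" and b: "\<And>i. i \<in> {1..n} \<Longrightarrow> norm (b i) \<le> M * (T / real n)"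
  shows "sqrt (real n) * norm ((\<Sum>i=1..n. outer_sq (x i + b i)) - (\<Sum>i=1..n. outer_sq (x i)))
    \<le> (\<Sum>i=1..n. (norm (x i))\<^sup>2) + 2 * (M * T)\<^sup>2"
proof -
  let ?s = "sqrt (real n)"
  have s: "?s \<ge> 1" "?s * ?s = real n" using n by auto
  have "?s * norm ((\<Sum>i=1..n. outer_sq (x i + b i)) - (\<Sum>i=1..n. outer_sq (x i)))
      \<le> ?s * (\<Sum>i=1..n. 2 * norm (x i) * norm (b i) + (norm (b i))\<^sup>2)"
    unfolding sum_subtractf[symmetric]
    by (intro mult_left_mono sum_norm_le norm_outer_sq_add_le) auto
  also have "\<dots> \<le> (\<Sum>i=1..n. (norm (x i))\<^sup>2 + 2 * (M * T)\<^sup>2 / real n)"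
    unfolding sum_distrib_left
  proof (rule sum_mono)
    fix i assume i: "i \<in> {1..n}"
    let ?b = "norm (b i)" and ?x = "norm (x i)"
    have bb: "real n * ?b\<^sup>2 \<le> (M * T)\<^sup>2 / real n"
    proof -
      have "?b\<^sup>2 \<le> (M * (T / real n))\<^sup>2" using b[OF i] by (intro power_mono) auto
      then have "real n * ?b\<^sup>2 \<le> real n * (M * (T / real n))\<^sup>2" by (intro mult_left_mono) auto
      also have "\<dots> = (M * T)\<^sup>2 / real n" using n by (simp add: power2_eq_square field_simps)
      finally show ?thesis .
    qed
    have "?s * (2 * ?x * ?b + ?b\<^sup>2) = 2 * ?x * (?s * ?b) + ?s * ?b\<^sup>2" by (simp add: algebra_simps)
    also have "2 * ?x * (?s * ?b) \<le> ?x\<^sup>2 + (?s * ?b)\<^sup>2" by (rule sum_squares_bound)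
    also have "(?s * ?b)\<^sup>2 = real n * ?b\<^sup>2" using s by (simp add: power_mult_distrib)
    \<comment> \<open>As sqrt n \<le> n, both terms that remain from the drift obey the bound (M
      T)^2 / n; together they give the factor 2.\<close>
    also have "?s * ?b\<^sup>2 \<le> real n * ?b\<^sup>2"
    proof (rule mult_right_mono)
      have "?s * 1 \<le> ?s * ?s" using s by (intro mult_left_mono) auto
      then show "?s \<le> real n" using s by simp
    qed simp
    finally show "?s * (2 * ?x * ?b + ?b\<^sup>2) \<le> ?x\<^sup>2 + 2 * (M * T)\<^sup>2 / real n"
      using bb by simp
  qed
  also have "\<dots> = (\<Sum>i=1..n. (norm (x i))\<^sup>2) + 2 * (M * T)\<^sup>2"
    using n by (simp add: sum.distrib)
  finally show ?thesis .
qed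

text \<open>Concerns what remains of \<open>Z\<close> after removing its martingale part. The
  Lipschitz constant may depend on the path; the notion is stable under linear maps, so it passes
  from the four components to the observed process.\<close>

definition lipschitz_remainder ::
  "'w measure \<Rightarrow> real \<Rightarrow> (real \<Rightarrow> 'w \<Rightarrow> real^'d) \<Rightarrow> real^'r^'d \<Rightarrow> (real \<Rightarrow> 'w \<Rightarrow> real^'r) \<Rightarrow> bool" where
  "lipschitz_remainder P T Z S W \<longleftrightarrow> (AE w in P. \<exists>M\<ge>0. \<forall>s t. 0 \<le> s \<and> s \<le> t \<and> t \<le> T \<longrightarrow>
     norm (Z t w - Z s w - S *v (W t w - W s w)) \<le> M * (t - s))"

definition realized_cov :: "(real \<Rightarrow> 'w \<Rightarrow> real^'p) \<Rightarrow> real \<Rightarrow> nat \<Rightarrow> 'w \<Rightarrow> real^'p^'p" where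
  "realized_cov X T n w = (1 / T) *\<^sub>R (\<Sum>i=1..n. outer_sq (increment X T n i w))"

lemma borel_measurable_realized_cov:
  fixes X :: "real \<Rightarrow> 'w \<Rightarrow> real^'p"
  assumes T: "T > 0" and X: "\<And>t. 0 \<le> t \<Longrightarrow> X t \<in> borel_measurable P"
  shows "realized_cov X T n \<in> borel_measurable P"
proof -
  have "increment X T n i \<in> borel_measurable P" if "i \<in> {1..n}" for i
  proof -
    have "0 \<le> real i * (T / real n)" "0 \<le> (real i - 1) * (T / real n)" using T that by auto
    then show ?thesis unfolding increment_def by (intro borel_measurable_diff X)
  qed
  moreover have "(outer_sq :: real^'p \<Rightarrow> _) \<in> borel_measurable borel"
    unfolding outer_sq_def by (intro borel_measurable_continuous_onI continuous_on_vec_lambda continuous_intros)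
  ultimately have "(\<lambda>w. outer_sq (increment X T n i w)) \<in> borel_measurable P" if "i \<in> {1..n}" for i
    using that measurable_compose by blast
  then have [measurable]: "(\<lambda>w. \<Sum>i=1..n. outer_sq (increment X T n i w)) \<in> borel_measurable P"
    by (intro borel_measurable_sum)
  show ?thesis unfolding realized_cov_def by measurable
qed

text \<open>The noise is controlled in mean square, the drift by a constant depending on the path.
  The rescaled error \<open>D\<close> is at most a variable \<open>Z\<close> with bounded mean plus
  a quantity that along each path is bounded in n; Markov's inequality handles the first, continuity
  of the measure the second, each at the cost e / 2.\<close>

lemma realized_covariance_tight:
  fixes X :: "real \<Rightarrow> 'w \<Rightarrow> real^'p" and W :: "real \<Rightarrow> 'w \<Rightarrow> real^'r" and K :: "real^'r^'p"
  assumes P: "prob_space P" and T: "T > 0" and std: "std_increments P W"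
    and Xm: "\<And>t. 0 \<le> t \<Longrightarrow> X t \<in> borel_measurable P"
    and repr: "lipschitz_remainder P T X K W"
    and e: "e > 0"
  shows "\<exists>L. \<forall>n\<ge>1. measure P {w \<in> space P. sqrt (real n) * norm (realized_cov X T n w - K ** transpose K) > L} \<le> e"
proof -
  interpret prob_space P by (rule P)
  define D where "D = (\<lambda>n w. sqrt (real n) * norm (realized_cov X T n w - K ** transpose K))"
  define S where "S = (\<lambda>n a b w. \<Sum>i=1..n. incr_prod (\<lambda>t w. W t w $ a) (\<lambda>t w. W t w $ b) (if a = b then 1 else 0)
    ((real i - 1) * (T / real n)) (real i * (T / real n)) w)"
  have Sfacts: "S n a b \<in> borel_measurable P" "integrable P (\<lambda>w. (S n a b w)\<^sup>2)"
    "expectation (\<lambda>w. (S n a b w)\<^sup>2) \<le> 2 * real n * (T / real n)\<^sup>2" if "n \<ge> 1" for n a b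
  proof -
    have u: "uncorrelated_products P (\<lambda>t w. W t w $ a) (\<lambda>t w. W t w $ b) (if a = b then 1 else 0)"
      using std by (simp add: std_increments_def)
    have h: "T / real n > 0" using T that by simp
    show "S n a b \<in> borel_measurable P" "integrable P (\<lambda>w. (S n a b w)\<^sup>2)"
      "expectation (\<lambda>w. (S n a b w)\<^sup>2) \<le> 2 * real n * (T / real n)\<^sup>2"
      unfolding S_def by (rule uncorrelated_products_sum[OF u h])+
  qed
  have "linear (\<lambda>A::real^'r^'r. K ** A ** transpose K)"
    by (rule linearI) (simp_all add: matrix_matrix_mult_def vec_eq_iff sum_distrib_left sum_distrib_right
        sum.distrib distrib_left distrib_right ac_simps)
  then obtain B where B: "B > 0" "\<And>A. norm (K ** A ** transpose K) \<le> B * norm A"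
    using linear_bounded_pos by blast
  obtain B' where B': "B' > 0" "\<And>x. norm (K *v x) \<le> B' * norm x"
    using linear_bounded_pos[OF matrix_vector_mul_linear[of K]] by blast
  \<comment> \<open>One constant dominating both the bound for the map A \<mapsto> K A K^T and the
    squared bound for \<open>K\<close>.\<close>
  define C where "C = B + B'\<^sup>2"
  have C: "C > 0" "B \<le> C" "B'\<^sup>2 \<le> C" using B(1) B'(1) by (auto simp: C_def intro: add_pos_nonneg)
  \<comment> \<open>1 + T + n S^2 dominates two quantities: sqrt n |S|, by 2 z \<le> 1 + z^2, and
    for equal indices S + T, whose sum is the total squared length of the noise increments. The
    factor 2 counts these two uses, and 1 / T is the normalization in
    \<open>realized_cov\<close>.\<close>
  define Z where "Z = (\<lambda>n w. 2 * C / T * (\<Sum>a\<in>UNIV. \<Sum>b\<in>UNIV. 1 + T + real n * (S n a b w)\<^sup>2))"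
  have Z0: "0 \<le> Z n w" for n w
    unfolding Z_def using C T by (intro mult_nonneg_nonneg sum_nonneg add_nonneg_nonneg) auto
  have Zint: "integrable P (Z n)" if "n \<ge> 1" for n
    unfolding Z_def using Sfacts(2)[OF that]
    by (intro integrable_mult_right Bochner_Integration.integrable_sum Bochner_Integration.integrable_add) auto
  have ZE: "expectation (Z n) \<le> 2 * C / T * (\<Sum>a\<in>(UNIV::'r set). \<Sum>b\<in>(UNIV::'r set). 1 + T + 2 * T\<^sup>2)" if n: "n \<ge> 1" for n
  proof -
    have "expectation (Z n) = 2 * C / T * (\<Sum>a\<in>UNIV. \<Sum>b\<in>UNIV. 1 + T + real n * expectation (\<lambda>w. (S n a b w)\<^sup>2))"
      unfolding Z_def using Sfacts(2)[OF n]
      by (simp add: Bochner_Integration.integral_sum Bochner_Integration.integrable_sum Bochner_Integration.integral_add prob_space)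
    also have "\<dots> \<le> 2 * C / T * (\<Sum>a\<in>(UNIV::'r set). \<Sum>b\<in>(UNIV::'r set). 1 + T + 2 * T\<^sup>2)"
    proof (intro mult_left_mono sum_mono add_left_mono)
      fix a b
      have "real n * expectation (\<lambda>w. (S n a b w)\<^sup>2) \<le> real n * (2 * real n * (T / real n)\<^sup>2)"
        by (intro mult_left_mono Sfacts(3)[OF n]) auto
      also have "\<dots> = 2 * T\<^sup>2" using n by (simp add: power2_eq_square)
      finally show "real n * expectation (\<lambda>w. (S n a b w)\<^sup>2) \<le> 2 * T\<^sup>2" .
    qed (use C T in auto)
    finally show ?thesis .
  qed
  have Dm: "D n \<in> borel_measurable P" for n
  proof -
    have [measurable]: "realized_cov X T n \<in> borel_measurable P" by (rule borel_measurable_realized_cov[OF T Xm])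
    show ?thesis unfolding D_def by measurable
  qed
  have pathwise: "AE w in P. \<exists>B. \<forall>n. D (Suc n) w - Z (Suc n) w \<le> B"
    using repr[unfolded lipschitz_remainder_def]
  proof eventually_elim
    fix w assume "\<exists>M\<ge>0. \<forall>s t. 0 \<le> s \<and> s \<le> t \<and> t \<le> T \<longrightarrow>
      norm (X t w - X s w - K *v (W t w - W s w)) \<le> M * (t - s)"
    then obtain M where M: "M \<ge> 0" and XM: "\<And>s t. 0 \<le> s \<Longrightarrow> s \<le> t \<Longrightarrow> t \<le> T \<Longrightarrow>
      norm (X t w - X s w - K *v (W t w - W s w)) \<le> M * (t - s)" by blast
    have "D n w - Z n w \<le> 2 * (M * T)\<^sup>2 / T" if n: "n \<ge> 1" for n
    proof -
      let ?s = "sqrt (real n)"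
      define \<Delta> where "\<Delta> = (\<lambda>i. increment W T n i w)"
      define b where "b = (\<lambda>i. increment X T n i w - K *v \<Delta> i)"
      have bM: "norm (b i) \<le> M * (T / real n)" if i: "i \<in> {1..n}" for i
      proof -
        have "real i \<le> real n" using i by simp
        then have "real i * (T / real n) \<le> real n * (T / real n)" using T by (intro mult_right_mono) auto
        then have le: "real i * (T / real n) \<le> T" using n by simp
        have "norm (b i) \<le> M * (real i * (T / real n) - (real i - 1) * (T / real n))"
          unfolding b_def \<Delta>_def increment_def
          using i T le by (intro XM mult_right_mono) auto
        also have "real i * (T / real n) - (real i - 1) * (T / real n) = T / real n"
          by (simp add: left_diff_distrib diff_divide_distrib)
        finally show ?thesis .
      qed
      have inc: "increment X T n i w = K *v \<Delta> i + b i" for i by (simp add: b_def)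
      \<comment> \<open>Error of the realized covariance of the noise itself, multiplied by T; its
        entries are exactly the sums \<open>S\<close>.\<close>
      define R where "R = (\<Sum>i=1..n. outer_sq (\<Delta> i)) - T *\<^sub>R (mat 1 :: real^'r^'r)"
      have SR: "S n a b' w = R $ a $ b'" for a b'
      proof -
        have "S n a b' w = (\<Sum>i=1..n. \<Delta> i $ a * \<Delta> i $ b' - (if a = b' then 1 else 0) * (T / real n))"
          unfolding S_def incr_prod_def \<Delta>_def increment_def
          by (intro sum.cong refl) (simp add: algebra_simps diff_divide_distrib)
        also have "\<dots> = (\<Sum>i=1..n. \<Delta> i $ a * \<Delta> i $ b') - (if a = b' then T else 0)"
          using n by (simp add: sum_subtractf)
        also have "\<dots> = R $ a $ b'" by (simp add: R_def outer_sq_def mat_def)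
        finally show ?thesis .
      qed
      define Q where "Q = (\<Sum>a\<in>(UNIV::'r set). \<Sum>b'\<in>(UNIV::'r set). 1 + T + real n * (S n a b' w)\<^sup>2)"
      have Rn: "?s * norm R \<le> Q"
      proof -
        have "?s * norm R \<le> ?s * (\<Sum>a\<in>UNIV. \<Sum>b'\<in>UNIV. \<bar>R $ a $ b'\<bar>)"
          by (intro mult_left_mono norm_matrix_le_sum) simp
        also have "\<dots> \<le> Q"
          unfolding Q_def sum_distrib_left
        proof (intro sum_mono)
          fix a b'
          define z where "z = ?s * \<bar>S n a b' w\<bar>"
          have z: "z\<^sup>2 = real n * (S n a b' w)\<^sup>2" "0 \<le> z" by (simp_all add: z_def power_mult_distrib)
          have "2 * 1 * z \<le> 1\<^sup>2 + z\<^sup>2" by (rule sum_squares_bound)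
          then have "z \<le> 1 + T + real n * (S n a b' w)\<^sup>2" using T z by simp
          then show "?s * \<bar>R $ a $ b'\<bar> \<le> 1 + T + real n * (S n a b' w)\<^sup>2"
            by (simp add: z_def SR)
        qed
        finally show ?thesis .
      qed
      \<comment> \<open>Squared lengths are traces of outer products, so their sum is read off the
        diagonal of \<open>R\<close>.\<close>
      have D2: "(\<Sum>i=1..n. (norm (\<Delta> i))\<^sup>2) \<le> Q"
      proof -
        have "(\<Sum>i=1..n. (norm (\<Delta> i))\<^sup>2) = (\<Sum>i=1..n. \<Sum>a\<in>UNIV. \<Delta> i $ a * \<Delta> i $ a)"
          by (simp add: power2_norm_eq_inner inner_vec_def)
        also have "\<dots> = (\<Sum>a\<in>UNIV. \<Sum>i=1..n. \<Delta> i $ a * \<Delta> i $ a)" by (rule sum.swap)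
        also have "\<dots> = (\<Sum>a\<in>UNIV. S n a a w + T)"
          by (simp add: SR R_def outer_sq_def mat_def)
        also have "\<dots> \<le> Q"
          unfolding Q_def
        proof (rule sum_mono)
          fix a
          have "2 * (1/2) * S n a a w \<le> (1/2)\<^sup>2 + (S n a a w)\<^sup>2" by (rule sum_squares_bound)
          moreover have "1 * (S n a a w)\<^sup>2 \<le> real n * (S n a a w)\<^sup>2" using n by (intro mult_right_mono) auto
          ultimately have "S n a a w + T \<le> 1 + T + real n * (S n a a w)\<^sup>2" by (simp add: power2_eq_square)
          also have "\<dots> \<le> (\<Sum>b'\<in>UNIV. 1 + T + real n * (S n a b' w)\<^sup>2)"
            using T by (intro member_le_sum) auto
          finally show "S n a a w + T \<le> (\<Sum>b'\<in>UNIV. 1 + T + real n * (S n a b' w)\<^sup>2)" .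
        qed
        finally show ?thesis .
      qed
      have Q0: "Q \<ge> 0" unfolding Q_def using T by (intro sum_nonneg add_nonneg_nonneg) auto
      have sumK: "(\<Sum>i=1..n. outer_sq (K *v \<Delta> i)) - T *\<^sub>R (K ** transpose K) = K ** R ** transpose K"
      proof -
        have lin: "linear (\<lambda>A::real^'r^'r. K ** A ** transpose K)"
          by fact
        have "K ** R ** transpose K = (\<Sum>i=1..n. K ** outer_sq (\<Delta> i) ** transpose K) - T *\<^sub>R (K ** mat 1 ** transpose K)"
          unfolding R_def linear_diff[OF lin] linear_sum[OF lin] linear_cmul[OF lin] ..
        then show ?thesis by (simp add: outer_sq_matrix_vector)
      qed
      \<comment> \<open>Drift error plus transported noise error: the first is controlled along the
        path, the second through \<open>R\<close>.\<close>
      have split: "T *\<^sub>R (realized_cov X T n w - K ** transpose K)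
        = ((\<Sum>i=1..n. outer_sq (K *v \<Delta> i + b i)) - (\<Sum>i=1..n. outer_sq (K *v \<Delta> i))) + K ** R ** transpose K"
        unfolding sumK[symmetric] using T by (simp add: realized_cov_def inc scaleR_diff_right)
      have "T * D n w = ?s * norm (T *\<^sub>R (realized_cov X T n w - K ** transpose K))"
        unfolding D_def using T by simp
      also have "\<dots> \<le> ?s * (norm ((\<Sum>i=1..n. outer_sq (K *v \<Delta> i + b i)) - (\<Sum>i=1..n. outer_sq (K *v \<Delta> i))) + norm (K ** R ** transpose K))"
        unfolding split by (intro mult_left_mono norm_triangle_ineq) auto
      also have "\<dots> \<le> ((\<Sum>i=1..n. (norm (K *v \<Delta> i))\<^sup>2) + 2 * (M * T)\<^sup>2) + ?s * (B * norm R)"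
        unfolding distrib_left
        by (intro add_mono realized_covariance_pathwise_bound[OF n M bM] mult_left_mono B(2)) auto
      also have "\<dots> \<le> (C * Q + 2 * (M * T)\<^sup>2) + C * Q"
      proof (intro add_mono order_refl)
        have "(\<Sum>i=1..n. (norm (K *v \<Delta> i))\<^sup>2) \<le> (\<Sum>i=1..n. B'\<^sup>2 * (norm (\<Delta> i))\<^sup>2)"
          using B'(2) by (intro sum_mono) (auto simp: power_mult_distrib[symmetric] intro!: power_mono)
        also have "\<dots> = B'\<^sup>2 * (\<Sum>i=1..n. (norm (\<Delta> i))\<^sup>2)" by (simp add: sum_distrib_left)
        also have "\<dots> \<le> C * Q" using C D2 by (intro mult_mono sum_nonneg) auto
        finally show "(\<Sum>i=1..n. (norm (K *v \<Delta> i))\<^sup>2) \<le> C * Q" .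
        have "?s * (B * norm R) = B * (?s * norm R)" by simp
        also have "\<dots> \<le> C * Q" using C B Rn by (intro mult_mono) auto
        finally show "?s * (B * norm R) \<le> C * Q" .
      qed
      finally have "T * D n w \<le> 2 * C * Q + 2 * (M * T)\<^sup>2" by simp
      then have "D n w \<le> (2 * C * Q + 2 * (M * T)\<^sup>2) / T" using T by (simp add: pos_le_divide_eq mult.commute)
      moreover have "Z n w = 2 * C * Q / T" by (simp add: Z_def Q_def)
      ultimately show ?thesis by (simp add: add_divide_distrib)
    qed
    then show "\<exists>B. \<forall>n. D (Suc n) w - Z (Suc n) w \<le> B" by (intro exI[of _ "2 * (M * T)\<^sup>2 / T"]) simp
  qed
  have Zm: "Z n \<in> borel_measurable P" if "n \<ge> 1" for n using Zint[OF that] by simp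
  have e2: "e / 2 > 0" using e by simp
  obtain L1 where L1: "\<And>n. n \<ge> 1 \<Longrightarrow> prob {w \<in> space P. Z n w > L1} \<le> e / 2"
    using tight_of_integral_bounded[of Z, OF Zint Z0 ZE e2] by blast
  have "(\<lambda>w. D (Suc n) w - Z (Suc n) w) \<in> borel_measurable P" for n
    by (intro borel_measurable_diff Dm Zm) simp
  then obtain L2 where L2: "\<And>n. prob {w \<in> space P. D (Suc n) w - Z (Suc n) w > L2} \<le> e / 2"
    using tight_of_AE_bounded[of "\<lambda>n w. D (Suc n) w - Z (Suc n) w", OF _ pathwise e2] by blast
  show ?thesis
  proof (intro exI[of _ "L1 + L2"] allI impI)
    fix n :: nat assume n: "n \<ge> 1"
    then obtain m where m: "n = Suc m" by (cases n) auto
    have [measurable]: "D n \<in> borel_measurable P" "Z n \<in> borel_measurable P" using Dm Zm[OF n] by auto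
    have "prob {w \<in> space P. D n w > L1 + L2} \<le> prob ({w \<in> space P. Z n w > L1} \<union> {w \<in> space P. D n w - Z n w > L2})"
      by (rule finite_measure_mono) auto
    also have "\<dots> \<le> prob {w \<in> space P. Z n w > L1} + prob {w \<in> space P. D n w - Z n w > L2}"
      by (rule measure_Un_le) auto
    also have "\<dots> \<le> e / 2 + e / 2" using L1[OF n] L2[of m] unfolding m by (intro add_mono)
    finally show "measure P {w \<in> space P. sqrt (real n) * norm (realized_cov X T n w - K ** transpose K) > L1 + L2} \<le> e"
      by (simp add: D_def)
  qed
qed


section \<open>The structural equation model\<close>

lemma sum_UNIV_Plus:
  fixes f :: "'a::finite + 'b::finite \<Rightarrow> 'c::comm_monoid_add"
  shows "sum f UNIV = (\<Sum>a\<in>UNIV. f (Inl a)) + (\<Sum>b\<in>UNIV. f (Inr b))"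
  using sum.Plus[of UNIV UNIV f] by (simp add: UNIV_Plus_UNIV o_def)

text \<open>The coefficients of \<open>dW\<^sub>1, \<dots>, dW\<^sub>4\<close> in the martingale part of \<open>dX\<close>.\<close>

definition sem_load ::
  "('k1::finite, 'k2::finite, 'p1::finite, 'p2::finite,
    'r1::finite, 'r2::finite, 'r3::finite, 'r4::finite) sem \<Rightarrow>
   real^('r1 + ('r2 + ('r3 + 'r4)))^('p1 + 'p2)" where
  "sem_load A = (\<chi> i k.
     case k of
       Inl a \<Rightarrow> (case i of Inl p \<Rightarrow> (Lam1 A ** S1 A) $ p $ a
         | Inr q \<Rightarrow> (Lam2 A ** matrix_inv (Psi A) ** Gam A ** S1 A) $ q $ a)
     | Inr k' \<Rightarrow> (case k' of
         Inl b \<Rightarrow> (case i of Inl p \<Rightarrow> S2 A $ p $ b | Inr q \<Rightarrow> 0)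
       | Inr k'' \<Rightarrow> (case k'' of
           Inl c \<Rightarrow> (case i of Inl p \<Rightarrow> 0 | Inr q \<Rightarrow> S3 A $ q $ c)
         | Inr d \<Rightarrow> (case i of Inl p \<Rightarrow> 0 | Inr q \<Rightarrow> (Lam2 A ** matrix_inv (Psi A) ** S4 A) $ q $ d))))"

lemma matrix_mult_transpose_nth:
  "(A ** transpose B) $ i $ j = (\<Sum>k\<in>UNIV. A $ i $ k * B $ j $ k)"
  by (simp add: matrix_matrix_mult_def transpose_def)

lemma matrix_add_rdistrib:
  fixes A B :: "'a::semiring_1^'n^'m"
  shows "(A + B) ** C = A ** C + B ** C"
  by (simp add: matrix_matrix_mult_def vec_eq_iff sum.distrib distrib_right)

text \<open>Block multiplication. The row blocks of the load are (Lam1 S1, S2, 0, 0) and (Lam2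
  Psi^(-1) Gam S1, 0, S3, Lam2 Psi^(-1) S4); they share only the noise of \<xi>, which produces
  \<open>Sig12\<close>.\<close>

lemma sem_load_cov:
  "sem_load A ** transpose (sem_load A) = sem_cov A"
proof -
  let ?L1 = "Lam1 A ** S1 A" and ?G = "Lam2 A ** matrix_inv (Psi A) ** Gam A ** S1 A"
    and ?Z = "Lam2 A ** matrix_inv (Psi A) ** S4 A"
  have b11: "Sig11 A = ?L1 ** transpose ?L1 + S2 A ** transpose (S2 A)"
    by (simp add: Sig11_def Sig_xi_def Sig_delta_def matrix_transpose_mul matrix_mul_assoc)
  have b12: "Sig12 A = ?L1 ** transpose ?G"
    by (simp add: Sig12_def Sig_xi_def matrix_transpose_mul matrix_mul_assoc)
  have b21: "transpose (Sig12 A) = ?G ** transpose ?L1"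
    unfolding b12 by (simp add: matrix_transpose_mul matrix_mul_assoc)
  have b22: "Sig22 A = ?G ** transpose ?G + ?Z ** transpose ?Z + S3 A ** transpose (S3 A)"
    by (simp add: Sig22_def Sig_xi_def Sig_eps_def Sig_zeta_def matrix_transpose_mul matrix_mul_assoc
        matrix_add_ldistrib matrix_add_rdistrib)
  have "(sem_load A ** transpose (sem_load A)) $ i $ j = sem_cov A $ i $ j" for i j
    unfolding matrix_mult_transpose_nth sum_UNIV_Plus sem_cov_def block_mat_def b21
    unfolding b11 b12 b22
    by (cases i; cases j) (simp_all add: sem_load_def matrix_mult_transpose_nth)
  then show ?thesis by (simp add: vec_eq_iff)
qed

lemma inner_gram:
  fixes K :: "real^'r^'p"
  shows "x \<bullet> ((K ** transpose K) *v y) = (transpose K *v x) \<bullet> (transpose K *v y)"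
  by (simp only: matrix_vector_mul_assoc[symmetric] transpose_matrix_vector dot_lmul_matrix)

text \<open>The quadratic form is the squared length of load^T x. Its blocks for the noises of
  \<delta> and \<epsilon> are S2^T x1 and S3^T x2, and these vanish together only at x = 0 because
  both error covariances are positive definite.\<close>

lemma pos_def_sem_cov:
  assumes A: "admissible A"
  shows "pos_def (sem_cov A)"
  unfolding pos_def_def
proof (intro conjI allI impI)
  show "transpose (sem_cov A) = sem_cov A"
    unfolding sem_load_cov[symmetric] by (simp add: matrix_transpose_mul)
  fix x :: "real^('c + 'd)" assume x: "x \<noteq> 0"
  define x1 where "x1 = (\<chi> p. x $ Inl p)"
  define x2 where "x2 = (\<chi> q. x $ Inr q)"
  let ?y = "transpose (sem_load A) *v x"
  have y2: "?y $ Inr (Inl b) = (transpose (S2 A) *v x1) $ b" for b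
    by (simp add: matrix_vector_mult_def transpose_def sum_UNIV_Plus sem_load_def x1_def)
  have y3: "?y $ Inr (Inr (Inl c)) = (transpose (S3 A) *v x2) $ c" for c
    by (simp add: matrix_vector_mult_def transpose_def sum_UNIV_Plus sem_load_def x2_def)
  have "?y \<noteq> 0"
  proof
    assume "?y = 0"
    then have "transpose (S2 A) *v x1 = 0" "transpose (S3 A) *v x2 = 0"
      using y2 y3 by (simp_all add: vec_eq_iff)
    then have "x1 \<bullet> (Sig_delta A *v x1) = 0" "x2 \<bullet> (Sig_eps A *v x2) = 0"
      unfolding Sig_delta_def Sig_eps_def inner_gram by simp_all
    then have "x1 = 0" "x2 = 0"
      using A unfolding admissible_def pos_def_def by (metis less_irrefl)+
    then have "x $ Inl p = 0" "x $ Inr q = 0" for p q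
      unfolding x1_def x2_def by (simp_all add: vec_eq_iff)
    then have "x $ i = 0" for i by (cases i) auto
    then show False using x by (simp add: vec_eq_iff)
  qed
  then show "x \<bullet> (sem_cov A *v x) > 0"
    unfolding sem_load_cov[symmetric] inner_gram by simp
qed

text \<open>The reduced form: \<eta> is eliminated through the inverse of \<open>Psi\<close>, which
  makes the observation a linear function of (\<xi>, \<delta>, \<epsilon>, \<zeta>).\<close>

definition sem_map ::
  "('k1::finite, 'k2::finite, 'p1::finite, 'p2::finite,
    'r1::finite, 'r2::finite, 'r3::finite, 'r4::finite) sem \<Rightarrow>
   (real^'k1) \<times> (real^'p1) \<times> (real^'p2) \<times> (real^'k2) \<Rightarrow> real^('p1 + 'p2)" where
  "sem_map A = (\<lambda>(x, d, e, z). vec_append (Lam1 A *v x + d)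
     (Lam2 A *v (matrix_inv (Psi A) *v (Gam A *v x + z)) + e))"

lemma linear_sem_map: "linear (sem_map A)"
  by (rule linearI)
    (auto simp: sem_map_def vec_eq_iff vec_append_def matrix_vector_right_distrib matrix_vector_mult_scaleR
      algebra_simps split: sum.splits)

lemma sem_load_mult:
  "sem_load A *v vec_append w1 (vec_append w2 (vec_append w3 w4)) =
    sem_map A (S1 A *v w1, S2 A *v w2, S3 A *v w3, S4 A *v w4)"
proof -
  let ?w = "vec_append w1 (vec_append w2 (vec_append w3 w4))"
  have row: "(sem_load A *v ?w) $ i = (\<Sum>a\<in>UNIV. sem_load A $ i $ Inl a * w1 $ a)
      + ((\<Sum>b\<in>UNIV. sem_load A $ i $ Inr (Inl b) * w2 $ b)
      + ((\<Sum>c\<in>UNIV. sem_load A $ i $ Inr (Inr (Inl c)) * w3 $ c)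
      + (\<Sum>d\<in>UNIV. sem_load A $ i $ Inr (Inr (Inr d)) * w4 $ d)))" for i
    unfolding matrix_vector_mult_def by (simp add: sum_UNIV_Plus)
  have "(sem_load A *v ?w) $ Inl p = ((Lam1 A ** S1 A) *v w1 + S2 A *v w2) $ p" for p
    unfolding row by (simp add: sem_load_def matrix_vector_mult_def)
  moreover have "(sem_load A *v ?w) $ Inr q = ((Lam2 A ** matrix_inv (Psi A) ** Gam A ** S1 A) *v w1
      + S3 A *v w3 + (Lam2 A ** matrix_inv (Psi A) ** S4 A) *v w4) $ q" for q
    unfolding row by (simp add: sem_load_def matrix_vector_mult_def)
  ultimately have "(sem_load A *v ?w) $ i = sem_map A (S1 A *v w1, S2 A *v w2, S3 A *v w3, S4 A *v w4) $ i" for i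
    by (cases i) (simp_all add: sem_map_def matrix_vector_right_distrib matrix_vector_mul_assoc matrix_mul_assoc)
  then show ?thesis by (simp add: vec_eq_iff)
qed

text \<open>\<open>b\<close> along a continuous path is continuous, hence bounded on [0, T]; that
  bound is the Lipschitz constant of the integrated drift.\<close>

lemma sde_solution_lipschitz_remainder:
  fixes b :: "real^'d \<Rightarrow> real^'d"
  assumes Z: "sde_solution P F b S W c Z" and b: "\<exists>L. L-lipschitz_on UNIV b"
  shows "lipschitz_remainder P T Z S W"
proof -
  have "AE w in P. continuous_on {0..} (\<lambda>t. Z t w) \<and>
      (\<forall>t\<ge>0. (\<lambda>s. b (Z s w)) integrable_on {0..t} \<and>
         Z t w = c + integral {0..t} (\<lambda>s. b (Z s w)) + S *v W t w)"
    using Z unfolding sde_solution_def by blast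
  then show ?thesis
    unfolding lipschitz_remainder_def
  proof eventually_elim
    fix w assume *: "continuous_on {0..} (\<lambda>t. Z t w) \<and>
      (\<forall>t\<ge>0. (\<lambda>s. b (Z s w)) integrable_on {0..t} \<and>
         Z t w = c + integral {0..t} (\<lambda>s. b (Z s w)) + S *v W t w)"
    have "continuous_on UNIV b" using b lipschitz_on_continuous_on by blast
    then have cont: "continuous_on {0..} (\<lambda>s. b (Z s w))"
      using * continuous_on_compose2[of UNIV b "{0..}" "\<lambda>t. Z t w"] by auto
    have "bounded ((\<lambda>s. b (Z s w)) ` {0..T})"
      by (intro compact_imp_bounded compact_continuous_image continuous_on_subset[OF cont]) auto
    then obtain M where M: "M > 0" "\<And>s. s \<in> {0..T} \<Longrightarrow> norm (b (Z s w)) \<le> M"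
      unfolding bounded_pos by auto
    show "\<exists>M\<ge>0. \<forall>s t. 0 \<le> s \<and> s \<le> t \<and> t \<le> T \<longrightarrow>
      norm (Z t w - Z s w - S *v (W t w - W s w)) \<le> M * (t - s)"
    proof (intro exI[of _ M] conjI allI impI; (elim conjE)?)
      fix s t :: real assume st: "0 \<le> s" "s \<le> t" "t \<le> T"
      have Zt: "Z t w = c + integral {0..t} (\<lambda>s. b (Z s w)) + S *v W t w"
        and Zs: "Z s w = c + integral {0..s} (\<lambda>s. b (Z s w)) + S *v W s w"
        and int: "(\<lambda>s. b (Z s w)) integrable_on {0..t}" using * st by auto
      have "integral {0..s} (\<lambda>s. b (Z s w)) + integral {s..t} (\<lambda>s. b (Z s w)) = integral {0..t} (\<lambda>s. b (Z s w))"
        by (rule Henstock_Kurzweil_Integration.integral_combine[OF st(1,2) int])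
      then have "Z t w - Z s w - S *v (W t w - W s w) = integral {s..t} (\<lambda>s. b (Z s w))"
        unfolding Zt Zs by (simp add: matrix_vector_mult_diff_distrib algebra_simps)
      also have "norm \<dots> \<le> M * (t - s)"
        using st by (intro integral_bound continuous_on_subset[OF cont] M(2)) auto
      finally show "norm (Z t w - Z s w - S *v (W t w - W s w)) \<le> M * (t - s)" .
    qed (use M in simp)
  qed
qed

lemma vec_append_diff: "vec_append x y - vec_append x' y' = vec_append (x - x') (y - y')"
proof -
  have "(vec_append x y - vec_append x' y') $ i = vec_append (x - x') (y - y') $ i" for i
    by (cases i) auto
  then show ?thesis by (simp add: vec_eq_iff)
qed

text \<open>\<open>sem_map\<close> is linear, hence bounded, and sends the four remainders to the
  remainder of \<open>X\<close>; the four constants add up and are multiplied by the bound of the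
  map.\<close>

lemma sem_map_remainder:
  fixes A :: "('k1::finite, 'k2::finite, 'p1::finite, 'p2::finite,
    'r1::finite, 'r2::finite, 'r3::finite, 'r4::finite) sem"
  assumes "lipschitz_remainder P T \<xi> (S1 A) W1" "lipschitz_remainder P T \<delta> (S2 A) W2"
    "lipschitz_remainder P T \<epsilon> (S3 A) W3" "lipschitz_remainder P T \<zeta> (S4 A) W4"
    and X: "\<And>t w. 0 \<le> t \<Longrightarrow> w \<in> space P \<Longrightarrow> X t w = sem_map A (\<xi> t w, \<delta> t w, \<epsilon> t w, \<zeta> t w)"
  shows "lipschitz_remainder P T X (sem_load A)
    (\<lambda>t w. vec_append (W1 t w) (vec_append (W2 t w) (vec_append (W3 t w) (W4 t w))))"
proof -
  have "\<exists>B>0. \<forall>x. norm (sem_map A x) \<le> norm x * B"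
    by (rule bounded_linear.pos_bounded[OF linear_conv_bounded_linear[THEN iffD1, OF linear_sem_map]])
  then obtain B where B: "B > 0" and all: "\<forall>x. norm (sem_map A x) \<le> norm x * B" by (elim exE conjE)
  have Bx: "norm (sem_map A x) \<le> B * norm x" for x
    using all[THEN spec, of x] by (simp only: mult.commute)
  show ?thesis
    unfolding lipschitz_remainder_def
    using assms(1)[unfolded lipschitz_remainder_def] assms(2)[unfolded lipschitz_remainder_def]
      assms(3)[unfolded lipschitz_remainder_def] assms(4)[unfolded lipschitz_remainder_def] AE_space[of P]
  proof eventually_elim
    case (elim w)
    obtain M1 where M1: "M1 \<ge> 0" "\<And>s t. 0 \<le> s \<Longrightarrow> s \<le> t \<Longrightarrow> t \<le> T \<Longrightarrow> norm (\<xi> t w - \<xi> s w - S1 A *v (W1 t w - W1 s w)) \<le> M1 * (t - s)"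
      using elim(1) by blast
    obtain M2 where M2: "M2 \<ge> 0" "\<And>s t. 0 \<le> s \<Longrightarrow> s \<le> t \<Longrightarrow> t \<le> T \<Longrightarrow> norm (\<delta> t w - \<delta> s w - S2 A *v (W2 t w - W2 s w)) \<le> M2 * (t - s)"
      using elim(2) by blast
    obtain M3 where M3: "M3 \<ge> 0" "\<And>s t. 0 \<le> s \<Longrightarrow> s \<le> t \<Longrightarrow> t \<le> T \<Longrightarrow> norm (\<epsilon> t w - \<epsilon> s w - S3 A *v (W3 t w - W3 s w)) \<le> M3 * (t - s)"
      using elim(3) by blast
    obtain M4 where M4: "M4 \<ge> 0" "\<And>s t. 0 \<le> s \<Longrightarrow> s \<le> t \<Longrightarrow> t \<le> T \<Longrightarrow> norm (\<zeta> t w - \<zeta> s w - S4 A *v (W4 t w - W4 s w)) \<le> M4 * (t - s)"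
      using elim(4) by blast
    show ?case
    proof (intro exI[of _ "B * (M1 + (M2 + (M3 + M4)))"] conjI allI impI; (elim conjE)?)
      show "0 \<le> B * (M1 + (M2 + (M3 + M4)))" using B M1(1) M2(1) M3(1) M4(1) by (intro mult_nonneg_nonneg add_nonneg_nonneg) auto
      fix s t :: real assume st: "0 \<le> s" "s \<le> t" "t \<le> T"
      let ?r1 = "\<xi> t w - \<xi> s w - S1 A *v (W1 t w - W1 s w)"
      let ?r2 = "\<delta> t w - \<delta> s w - S2 A *v (W2 t w - W2 s w)"
      let ?r3 = "\<epsilon> t w - \<epsilon> s w - S3 A *v (W3 t w - W3 s w)"
      let ?r4 = "\<zeta> t w - \<zeta> s w - S4 A *v (W4 t w - W4 s w)"
      have Xt: "X t w = sem_map A (\<xi> t w, \<delta> t w, \<epsilon> t w, \<zeta> t w)" "X s w = sem_map A (\<xi> s w, \<delta> s w, \<epsilon> s w, \<zeta> s w)"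
        using X st elim by auto
      have "norm (?r1, ?r2, ?r3, ?r4) \<le> norm ?r1 + (norm ?r2 + (norm ?r3 + norm ?r4))"
        using norm_Pair_le[of ?r1 "(?r2, ?r3, ?r4)"] norm_Pair_le[of ?r2 "(?r3, ?r4)"] norm_Pair_le[of ?r3 ?r4]
        by linarith
      also have "\<dots> \<le> M1 * (t - s) + (M2 * (t - s) + (M3 * (t - s) + M4 * (t - s)))"
        by (intro add_mono M1(2) M2(2) M3(2) M4(2) st)
      finally have le: "norm (?r1, ?r2, ?r3, ?r4) \<le> (M1 + (M2 + (M3 + M4))) * (t - s)"
        by (simp only: distrib_right)
      have eq: "X t w - X s w - sem_load A *v
        (vec_append (W1 t w) (vec_append (W2 t w) (vec_append (W3 t w) (W4 t w)))
         - vec_append (W1 s w) (vec_append (W2 s w) (vec_append (W3 s w) (W4 s w))))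
        = sem_map A (?r1, ?r2, ?r3, ?r4)"
        unfolding vec_append_diff sem_load_mult Xt linear_diff[OF linear_sem_map, symmetric] by simp
      have "norm (sem_map A (?r1, ?r2, ?r3, ?r4)) \<le> B * ((M1 + (M2 + (M3 + M4))) * (t - s))"
        by (rule order_trans[OF Bx mult_left_mono[OF le less_imp_le[OF B]]])
      then show "norm (X t w - X s w - sem_load A *v
        (vec_append (W1 t w) (vec_append (W2 t w) (vec_append (W3 t w) (W4 t w)))
         - vec_append (W1 s w) (vec_append (W2 s w) (vec_append (W3 s w) (W4 s w)))))
        \<le> B * (M1 + (M2 + (M3 + M4))) * (t - s)"
        unfolding eq by (simp only: mult.assoc)
    qed
  qed
qed


section \<open>The quasi-likelihood\<close>

text \<open>The bracket is the Frobenius inner product, which is the inner product of the matrix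
  type; this lets the statistic be a vector in the sense of
  \<open>quadratic_contrast\<close>.\<close>

lemma mat_dot_eq_inner: "mat_dot A B = A \<bullet> B"
  by (simp add: mat_dot_def trace_def matrix_matrix_mult_def transpose_def inner_vec_def)

text \<open>The powers of 2 pi h cancel exactly, and 1 / (2 h) = n / (2 T) converts the sum of
  squared increments into n times \<open>realized_cov\<close>. It is stated for the likelihood
  itself because the estimator is defined through it.\<close>

lemma quasi_lik_exp:
  fixes X :: "real \<Rightarrow> 'w \<Rightarrow> real^'p" and Sig :: "real^'q \<Rightarrow> real^'p^'p"
  assumes n: "n \<ge> 1" and T: "T > 0" and d: "det (Sig \<theta>) > 0"
  shows "(2 * pi * (T / real n)) powr (real n * real CARD('p) / 2) * quasi_lik X T Sig n w \<theta> =
    exp (real n * (- (1 / 2) * ln (det (Sig \<theta>)) + realized_cov X T n w \<bullet> ((- (1 / 2)) *\<^sub>R matrix_inv (Sig \<theta>))))"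
proof -
  define h where "h = T / real n"
  have h: "h > 0" using n T by (simp add: h_def)
  define c where "c = 2 * pi * h"
  have c: "c > 0" using h by (simp add: c_def)
  define m where "m = (\<lambda>i. matrix_inv (Sig \<theta>) \<bullet> outer_sq (increment X T n i w))"
  have "quasi_lik X T Sig n w \<theta> = (\<Prod>i=1..n. 1 / (c powr (real CARD('p) / 2) * sqrt (det (Sig \<theta>))) * exp (- (1 / (2 * h)) * m i))"
    unfolding quasi_lik_def Let_def h_def c_def m_def mat_dot_eq_inner ..
  also have "\<dots> = (1 / (c powr (real CARD('p) / 2) * sqrt (det (Sig \<theta>)))) ^ n * exp (\<Sum>i=1..n. - (1 / (2 * h)) * m i)"
    by (simp only: prod.distrib exp_sum finite_atLeastAtMost prod_constant card_atLeastAtMost) simp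
  finally have q: "quasi_lik X T Sig n w \<theta> = (1 / (c powr (real CARD('p) / 2) * sqrt (det (Sig \<theta>)))) ^ n * exp (\<Sum>i=1..n. - (1 / (2 * h)) * m i)" .
  have cp: "c powr (real n * real CARD('p) / 2) = (c powr (real CARD('p) / 2)) ^ n"
    using c by (simp add: powr_realpow[symmetric] powr_powr mult.commute)
  have sd: "(1 / sqrt (det (Sig \<theta>))) ^ n = exp (real n * (- (1 / 2) * ln (det (Sig \<theta>))))"
  proof -
    have "1 / sqrt (det (Sig \<theta>)) = exp (- (1 / 2) * ln (det (Sig \<theta>)))"
      using d by (simp add: exp_minus powr_half_sqrt[symmetric] powr_def inverse_eq_divide)
    then show ?thesis by (simp only: exp_of_nat_mult)
  qed
  have ex: "(\<Sum>i=1..n. - (1 / (2 * h)) * m i) = real n * (realized_cov X T n w \<bullet> ((- (1 / 2)) *\<^sub>R matrix_inv (Sig \<theta>)))"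
  proof -
    have "realized_cov X T n w \<bullet> matrix_inv (Sig \<theta>) = (1 / T) * (\<Sum>i=1..n. m i)"
      by (simp add: realized_cov_def inner_sum_left inner_sum_right m_def inner_commute)
    moreover have "- (1 / (2 * h)) = - real n / (2 * T)" by (simp add: h_def)
    moreover have "(\<Sum>i=1..n. - (1 / (2 * h)) * m i) = - (1 / (2 * h)) * (\<Sum>i=1..n. m i)"
      by (simp only: sum_distrib_left)
    ultimately show ?thesis by simp
  qed
  have "c powr (real n * real CARD('p) / 2) * quasi_lik X T Sig n w \<theta> = (1 / sqrt (det (Sig \<theta>))) ^ n * exp (\<Sum>i=1..n. - (1 / (2 * h)) * m i)"
    unfolding q cp using c by (simp add: power_divide power_mult_distrib)
  also have "\<dots> = exp (real n * (- (1 / 2) * ln (det (Sig \<theta>))) + real n * (realized_cov X T n w \<bullet> ((- (1 / 2)) *\<^sub>R matrix_inv (Sig \<theta>))))"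
    unfolding sd ex exp_add ..
  finally show ?thesis unfolding c_def h_def by (simp only: distrib_left)
qed

lemma quasi_loglik_eq:
  fixes X :: "real \<Rightarrow> 'w \<Rightarrow> real^'p" and Sig :: "real^'q \<Rightarrow> real^'p^'p"
  assumes "n \<ge> 1" "T > 0" "det (Sig \<theta>) > 0"
  shows "quasi_loglik X T Sig n w \<theta> =
    real n * (- (1 / 2) * ln (det (Sig \<theta>)) + realized_cov X T n w \<bullet> ((- (1 / 2)) *\<^sub>R matrix_inv (Sig \<theta>)))"
  unfolding quasi_loglik_def quasi_lik_exp[where Sig = Sig and \<theta> = \<theta>, OF assms] by (rule ln_exp)

text \<open>The log-likelihood is identified with n times the contrast only where the covariance has
  positive determinant, so both derivatives are compared on an open set.\<close>

lemma hessian_scaled_on_open: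
  fixes f h :: "real^'q \<Rightarrow> real"
  assumes U: "open U" and x: "x \<in> U" and f: "Ck_on 2 U f" and eq: "\<And>y. y \<in> U \<Longrightarrow> h y = c * f y"
  shows "hessian h x = c *\<^sub>R hessian f x"
proof -
  have fd: "f differentiable (at y)" if "y \<in> U" for y
    using f that by (simp add: numeral_2_eq_2)
  have gd: "dir_deriv f (axis j 1) differentiable (at y)" if "y \<in> U" for y j
    using f that by (simp add: numeral_2_eq_2 axis_Basis)
  have 1: "dir_deriv h v y = c * dir_deriv f v y" if y: "y \<in> U" for v y
  proof (rule dir_deriv_eq)
    have "((\<lambda>y. c * f y) has_derivative (\<lambda>v. c * dir_deriv f v y)) (at y)"
      by (intro has_derivative_mult_right dir_deriv_has_derivative fd y)
    then show "(h has_derivative (\<lambda>v. c * dir_deriv f v y)) (at y)"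
      by (rule has_derivative_transform_within_open[OF _ U y]) (simp add: eq)
  qed
  have 2: "dir_deriv (dir_deriv h (axis j 1)) v x = c * dir_deriv (dir_deriv f (axis j 1)) v x" for j v
  proof (rule dir_deriv_eq)
    have "((\<lambda>y. c * dir_deriv f (axis j 1) y) has_derivative (\<lambda>v. c * dir_deriv (dir_deriv f (axis j 1)) v x)) (at x)"
      by (intro has_derivative_mult_right dir_deriv_has_derivative gd x)
    then show "(dir_deriv h (axis j 1) has_derivative (\<lambda>v. c * dir_deriv (dir_deriv f (axis j 1)) v x)) (at x)"
      by (rule has_derivative_transform_within_open[OF _ U x]) (simp add: 1)
  qed
  show ?thesis by (simp add: hessian_def 2 vec_eq_iff)
qed

text \<open>Gives measurability of the event \<open>J\<close>. A symmetric matrix is positive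
  definite iff for some k its form is at least |x|^2 / (k + 1), where k comes from the minimum over
  the compact unit sphere; this is a countable union of closed conditions.\<close>

lemma pos_def_sets_borel: "{A :: real^'n^'n. pos_def A} \<in> sets borel"
proof -
  have quad: "continuous_on UNIV (\<lambda>A::real^'n^'n. x \<bullet> (A *v x))" for x
    unfolding inner_vec_def matrix_vector_mult_def by (simp, intro continuous_intros)
  define S where "S = {A :: real^'n^'n. transpose A = A}"
  have S: "closed S"
  proof -
    have "S = {A. \<forall>i j. A $ i $ j = A $ j $ i}"
      by (auto simp: S_def transpose_def vec_eq_iff)
    also have "closed \<dots>"
      by (intro closed_Collect_all closed_Collect_eq continuous_intros)
    finally show ?thesis .
  qed
  define B where "B = (\<lambda>k::nat. {A :: real^'n^'n. \<forall>x. (norm x)\<^sup>2 / real (Suc k) \<le> x \<bullet> (A *v x)})"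
  have B: "closed (B k)" for k
    unfolding B_def by (intro closed_Collect_all closed_Collect_le continuous_on_const quad)
  have "{A :: real^'n^'n. pos_def A} = S \<inter> (\<Union>k. B k)"
  proof (intro equalityI subsetI)
    fix A :: "real^'n^'n" assume "A \<in> {A. pos_def A}"
    then have A: "transpose A = A" "\<And>x. x \<noteq> 0 \<Longrightarrow> x \<bullet> (A *v x) > 0" by (auto simp: pos_def_def)
    have cont: "continuous_on (sphere 0 1) (\<lambda>x::real^'n. x \<bullet> (A *v x))"
      by (intro continuous_on_inner continuous_on_id linear_continuous_on matrix_vector_mul_bounded_linear)
    have "axis (undefined :: 'n) (1::real) \<in> sphere 0 1" by simp
    then have "(sphere 0 1 :: (real^'n) set) \<noteq> {}" by blast
    then obtain x0 where x0: "x0 \<in> sphere 0 1" "\<And>x. x \<in> sphere 0 1 \<Longrightarrow> x0 \<bullet> (A *v x0) \<le> x \<bullet> (A *v x)"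
      using continuous_attains_inf[OF compact_sphere _ cont] by blast
    define m where "m = x0 \<bullet> (A *v x0)"
    have "x0 \<noteq> 0" using x0 by auto
    then have "m > 0" unfolding m_def by (rule A(2))
    then obtain k where k: "inverse (real (Suc k)) < m" using reals_Archimedean by blast
    have "(norm x)\<^sup>2 / real (Suc k) \<le> x \<bullet> (A *v x)" for x
    proof (cases "x = 0")
      case False
      then have nx: "norm x > 0" by simp
      have "m \<le> ((1 / norm x) *\<^sub>R x) \<bullet> (A *v ((1 / norm x) *\<^sub>R x))"
        unfolding m_def using nx by (intro x0(2)) simp
      also have "\<dots> = (x \<bullet> (A *v x)) / (norm x)\<^sup>2"
        by (simp add: matrix_vector_mult_scaleR power2_eq_square)
      finally have "m * (norm x)\<^sup>2 \<le> x \<bullet> (A *v x)" using nx by (simp add: pos_le_divide_eq)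
      moreover have "(norm x)\<^sup>2 / real (Suc k) \<le> m * (norm x)\<^sup>2"
        using mult_right_mono[OF less_imp_le[OF k], of "(norm x)\<^sup>2"] by (simp add: divide_inverse mult.commute)
      ultimately show ?thesis by linarith
    qed simp
    then show "A \<in> S \<inter> (\<Union>k. B k)" using A by (auto simp: S_def B_def)
  next
    fix A :: "real^'n^'n" assume "A \<in> S \<inter> (\<Union>k. B k)"
    then obtain k where A: "transpose A = A" "\<And>x. (norm x)\<^sup>2 / real (Suc k) \<le> x \<bullet> (A *v x)"
      by (auto simp: S_def B_def)
    have "x \<bullet> (A *v x) > 0" if "x \<noteq> 0" for x
    proof -
      have "0 < (norm x)\<^sup>2 / real (Suc k)" using that by simp
      then show ?thesis using A(2)[of x] by (rule less_le_trans)
    qed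
    then show "A \<in> {A. pos_def A}" using A by (simp add: pos_def_def)
  qed
  then show ?thesis using S B by (simp add: borel_closed sets.countable_UN)
qed

lemma borel_measurable_elog [measurable]: "elog \<in> borel_measurable borel"
  unfolding elog_def by measurable

text \<open>Serves the prior density and continuous functions on \<open>\<Theta>\<close>, whose
  measurability is known after truncation to a set containing all values of
  \<open>t\<close>.\<close>

lemma borel_measurable_compose_on:
  fixes f :: "'a::topological_space \<Rightarrow> 'b::real_normed_vector"
  assumes "(\<lambda>x. indicator S x *\<^sub>R f x) \<in> borel_measurable borel" and "t \<in> borel_measurable M"
    and "\<And>w. w \<in> space M \<Longrightarrow> t w \<in> S"
  shows "(\<lambda>w. f (t w)) \<in> borel_measurable M"
proof -
  have "(\<lambda>w. indicator S (t w) *\<^sub>R f (t w)) \<in> borel_measurable M"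
    using measurable_compose[OF assms(2,1)] .
  also have "(\<lambda>w. indicator S (t w) *\<^sub>R f (t w)) \<in> borel_measurable M \<longleftrightarrow> (\<lambda>w. f (t w)) \<in> borel_measurable M"
    by (rule measurable_cong) (simp add: assms(3))
  finally show ?thesis .
qed


section \<open>Uniformity over the sample and measurability at the maximizer\<close>

context quadratic_contrast
begin

lemma laplace_uniform:
  assumes B: "cond_B \<Theta> \<theta>0 \<pi>" and prior: "\<And>n. n \<ge> 1 \<Longrightarrow> prior_density \<Theta> (\<pi> n)" and e: "e > 0"
  obtains n0 where "\<And>n Q t. n \<ge> n0 \<Longrightarrow> sqrt (real n) * norm (Q - Q0) \<le> L \<Longrightarrow> t \<in> \<Theta> \<Longrightarrow>
      (\<And>\<theta>. \<theta> \<in> \<Theta> \<Longrightarrow> f Q \<theta> \<le> f Q t) \<Longrightarrow> transpose (hessian (f Q) t) = hessian (f Q) t \<Longrightarrow>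
      evidence (\<pi> n) n Q > 0 \<and> det (- (real n *\<^sub>R hessian (f Q) t)) > 0 \<and> \<bar>laplace_error (\<pi> n) n Q t\<bar> < e"
proof -
  define hyp where "hyp = (\<lambda>n Q t. sqrt (real n) * norm (Q - Q0) \<le> L \<and> t \<in> \<Theta> \<and>
      (\<forall>\<theta>\<in>\<Theta>. f Q \<theta> \<le> f Q t) \<and> transpose (hessian (f Q) t) = hessian (f Q) t)"
  define concl where "concl = (\<lambda>n Q t. (evidence (\<pi> n) n Q > 0 \<and> det (- (real n *\<^sub>R hessian (f Q) t)) > 0) \<and> \<bar>laplace_error (\<pi> n) n Q t\<bar> < e)"
  have "\<exists>n0. \<forall>n\<ge>n0. \<forall>Q t. hyp n Q t \<longrightarrow> concl n Q t"
  proof (rule ccontr)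
    assume "\<not> ?thesis"
    \<comment> \<open>Counterexamples with index at least \<open>Suc k\<close>: this makes
      \<open>N\<close> tend to infinity and keeps it positive, as \<open>laplace_sequence\<close>
      requires.\<close>
    then have "\<forall>k. \<exists>n Q t. n \<ge> Suc k \<and> hyp n Q t \<and> \<not> concl n Q t" by blast
    then obtain N Q t where N: "\<And>k. N k \<ge> Suc k" and hyp: "\<And>k. hyp (N k) (Q k) (t k)"
      and bad: "\<And>k. \<not> concl (N k) (Q k) (t k)" by metis
    have Nlim: "filterlim N at_top sequentially"
      using N by (intro filterlim_at_top_mono[OF filterlim_Suc]) auto
    have N1: "N k \<ge> 1" for k using N[of k] by simp
    have h: "sqrt (real (N k)) * norm (Q k - Q0) \<le> L" "t k \<in> \<Theta>" "\<And>\<theta>. \<theta> \<in> \<Theta> \<Longrightarrow> f (Q k) \<theta> \<le> f (Q k) (t k)"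
      "transpose (hessian (f (Q k)) (t k)) = hessian (f (Q k)) (t k)" for k
      using hyp[of k] unfolding hyp_def by blast+
    have lap: "eventually (\<lambda>k. evidence (\<pi> (N k)) (N k) (Q k) > 0 \<and>
        det (- (real (N k) *\<^sub>R hessian (f (Q k)) (t k))) > 0) sequentially"
      by (rule laplace_sequence(1)[OF Nlim N1 B prior h(1) h(2) h(3) h(4)])
    have lim: "(\<lambda>k. laplace_error (\<pi> (N k)) (N k) (Q k) (t k)) \<longlonglongrightarrow> 0"
      by (rule laplace_sequence(2)[OF Nlim N1 B prior h(1) h(2) h(3) h(4)])
    have "eventually (\<lambda>k. \<bar>laplace_error (\<pi> (N k)) (N k) (Q k) (t k)\<bar> < e) sequentially"
      using order_tendstoD(2)[OF tendsto_rabs_zero[OF lim] e] .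
    with lap have "eventually (\<lambda>k. concl (N k) (Q k) (t k)) sequentially"
      by eventually_elim (simp add: concl_def)
    with bad show False by (simp add: eventually_False)
  qed
  then obtain n0 where n0: "\<And>n Q t. n \<ge> n0 \<Longrightarrow> hyp n Q t \<Longrightarrow> concl n Q t" by blast
  show ?thesis
  proof (rule that[of n0])
    fix n Q t assume "n \<ge> n0" "sqrt (real n) * norm (Q - Q0) \<le> L" "t \<in> \<Theta>"
      "\<And>\<theta>. \<theta> \<in> \<Theta> \<Longrightarrow> f Q \<theta> \<le> f Q t" "transpose (hessian (f Q) t) = hessian (f Q) t"
    then have "concl n Q t" by (intro n0) (auto simp: hyp_def)
    then show "evidence (\<pi> n) n Q > 0 \<and> det (- (real n *\<^sub>R hessian (f Q) t)) > 0 \<and> \<bar>laplace_error (\<pi> n) n Q t\<bar> < e"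
      unfolding concl_def by blast
  qed
qed

lemma borel_measurable_continuous_at_maximizer:
  fixes h :: "real^'q \<Rightarrow> 'c::real_normed_vector"
  assumes "continuous_on U h" "t \<in> borel_measurable M" "\<And>w. w \<in> space M \<Longrightarrow> t w \<in> \<Theta>"
  shows "(\<lambda>w. h (t w)) \<in> borel_measurable M"
  by (rule borel_measurable_compose_on[OF borel_measurable_continuous_on_indicator assms(2,3)])
    (use compact continuous_on_subset[OF assms(1) U(2)] in \<open>auto intro: borel_compact\<close>)

lemma borel_measurable_f:
  assumes Q: "Q \<in> borel_measurable M" and t: "t \<in> borel_measurable M" "\<And>w. w \<in> space M \<Longrightarrow> t w \<in> \<Theta>"
  shows "(\<lambda>w. f (Q w) (t w)) \<in> borel_measurable M"
  unfolding f_def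
  by (intro borel_measurable_add borel_measurable_inner Q
      borel_measurable_continuous_at_maximizer[OF _ t] Ck_on_imp_continuous_on[OF g0] Ck_on_imp_continuous_on[OF g])

lemma borel_measurable_hessian:
  assumes Q: "Q \<in> borel_measurable M" and t: "t \<in> borel_measurable M" "\<And>w. w \<in> space M \<Longrightarrow> t w \<in> \<Theta>"
  shows "(\<lambda>w. hessian (f (Q w)) (t w)) \<in> borel_measurable M"
proof -
  have entry: "(\<lambda>w. hessian (f (Q w)) (t w) $ i $ j) \<in> borel_measurable M" for i j
  proof -
    have c: "continuous_on U (dir_deriv (dir_deriv g0 (axis j 1)) (axis i 1))"
      "continuous_on U (dir_deriv (dir_deriv g (axis j 1)) (axis i 1))"
      using g0 g by (simp_all add: numeral_2_eq_2 axis_Basis)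
    have "(\<lambda>w. dir_deriv (dir_deriv g0 (axis j 1)) (axis i 1) (t w) + Q w \<bullet> dir_deriv (dir_deriv g (axis j 1)) (axis i 1) (t w)) \<in> borel_measurable M"
      by (intro borel_measurable_add borel_measurable_inner Q borel_measurable_continuous_at_maximizer[OF _ t] c)
    also have "?this \<longleftrightarrow> ?thesis"
    proof (rule measurable_cong)
      fix w assume "w \<in> space M"
      then have "t w \<in> U" using t(2) U(2) by blast
      then show "dir_deriv (dir_deriv g0 (axis j 1)) (axis i 1) (t w) + Q w \<bullet> dir_deriv (dir_deriv g (axis j 1)) (axis i 1) (t w)
        = hessian (f (Q w)) (t w) $ i $ j"
        by (simp add: hessian_def dir_deriv2_f[OF _ axis_Basis])
    qed
    finally show ?thesis .
  qed
  have "(\<lambda>w. \<Sum>i\<in>UNIV. \<Sum>j\<in>UNIV. (hessian (f (Q w)) (t w) $ i $ j) *\<^sub>R axis i (axis j (1::real))) \<in> borel_measurable M"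
    using entry by measurable
  then show ?thesis by (simp only: matrix_eq_sum_axis[symmetric])
qed

text \<open>Measurability of a parameter integral rests on joint measurability in the sample point
  and \<theta>; \<open>a\<close>, \<open>b\<close> and \<open>p'\<close> are the parts of the
  integrand truncated to \<open>\<Theta>\<close>, which are Borel on the whole space and give the
  same integral.\<close>

lemma borel_measurable_evidence:
  assumes Q [measurable]: "Q \<in> borel_measurable M" and p: "(\<lambda>\<theta>. indicator \<Theta> \<theta> *\<^sub>R p \<theta>) \<in> borel_measurable borel"
  shows "(\<lambda>w. evidence p n (Q w)) \<in> borel_measurable M"
proof -
  have \<Theta>: "\<Theta> \<in> sets borel" using compact by (rule borel_compact)
  define p' where "p' = (\<lambda>\<theta>. indicator \<Theta> \<theta> *\<^sub>R p \<theta>)"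
  define a where "a = (\<lambda>\<theta>. indicator \<Theta> \<theta> *\<^sub>R g0 \<theta>)"
  define b where "b = (\<lambda>\<theta>. indicator \<Theta> \<theta> *\<^sub>R g \<theta>)"
  have [measurable]: "p' \<in> borel_measurable borel" using p by (simp add: p'_def)
  have [measurable]: "a \<in> borel_measurable borel" "b \<in> borel_measurable borel"
    unfolding a_def b_def
    by (intro borel_measurable_continuous_on_indicator \<Theta>
        continuous_on_subset[OF Ck_on_imp_continuous_on[OF g0] U(2)]
        continuous_on_subset[OF Ck_on_imp_continuous_on[OF g] U(2)])+
  have eq: "indicator \<Theta> \<theta> *\<^sub>R (exp (real n * f (Q w) \<theta>) * p \<theta>) = exp (real n * (a \<theta> + Q w \<bullet> b \<theta>)) * p' \<theta>" for w \<theta>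
    by (simp add: f_def a_def b_def p'_def indicator_def)
  have "(\<lambda>w. \<integral>\<theta>. exp (real n * (a \<theta> + Q w \<bullet> b \<theta>)) * p' \<theta> \<partial>lborel) \<in> borel_measurable M"
    by (rule sigma_finite_measure.borel_measurable_lebesgue_integral[OF sigma_finite_lborel]) measurable
  then show ?thesis unfolding evidence_def set_lebesgue_integral_def eq .
qed

end

section \<open>From the deterministic approximation to convergence in probability\<close>

theorem theorem1:
  fixes P :: "'w measure" and F :: "real \<Rightarrow> 'w measure"
    and W1 :: "real \<Rightarrow> 'w \<Rightarrow> real^'r1" and W2 :: "real \<Rightarrow> 'w \<Rightarrow> real^'r2"
    and W3 :: "real \<Rightarrow> 'w \<Rightarrow> real^'r3" and W4 :: "real \<Rightarrow> 'w \<Rightarrow> real^'r4"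
    and B1 :: "real^'k1 \<Rightarrow> real^'k1" and B2 :: "real^'p1 \<Rightarrow> real^'p1"
    and B3 :: "real^'p2 \<Rightarrow> real^'p2" and B4 :: "real^'k2 \<Rightarrow> real^'k2"
    and c1 :: "real^'k1" and c2 :: "real^'p1" and c3 :: "real^'p2" and c4 :: "real^'k2"
    and \<xi> :: "real \<Rightarrow> 'w \<Rightarrow> real^'k1" and \<delta> :: "real \<Rightarrow> 'w \<Rightarrow> real^'p1"
    and \<epsilon> :: "real \<Rightarrow> 'w \<Rightarrow> real^'p2" and \<zeta> \<eta> :: "real \<Rightarrow> 'w \<Rightarrow> real^'k2"
    and X1 :: "real \<Rightarrow> 'w \<Rightarrow> real^'p1" and X2 :: "real \<Rightarrow> 'w \<Rightarrow> real^'p2"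
    and X :: "real \<Rightarrow> 'w \<Rightarrow> real^('p1 + 'p2)"
    and A0 :: "('k1, 'k2, 'p1, 'p2, 'r1, 'r2, 'r3, 'r4) sem"
    and A :: "real^'q \<Rightarrow> ('k1, 'k2, 'p1, 'p2, 'r1, 'r2, 'r3, 'r4) sem"
    and Sig :: "real^'q \<Rightarrow> real^('p1 + 'p2)^('p1 + 'p2)"
    and \<Theta> :: "(real^'q) set" and \<theta>0 :: "real^'q"
    and T :: real
    and \<pi> :: "nat \<Rightarrow> real^'q \<Rightarrow> real"
    and \<theta>hat :: "nat \<Rightarrow> 'w \<Rightarrow> real^'q"
    and H :: "nat \<Rightarrow> 'w \<Rightarrow> real^'q \<Rightarrow> real"
    and J :: "nat \<Rightarrow> 'w set"
  assumes dims: "CARD('k1) \<le> CARD('p1)" "CARD('k2) \<le> CARD('p2)"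
    and basis: "stochastic_basis P F"
    and wiener: "wiener_process P F W1" "wiener_process P F W2"
      "wiener_process P F W3" "wiener_process P F W4"
    and indep: "independent_processes4 P W1 W2 W3 W4"
    and sde_xi: "sde_solution P F B1 (S1 A0) W1 c1 \<xi>"
    and sde_delta: "sde_solution P F B2 (S2 A0) W2 c2 \<delta>"
    and sde_eps: "sde_solution P F B3 (S3 A0) W3 c3 \<epsilon>"
    and sde_zeta: "sde_solution P F B4 (S4 A0) W4 c4 \<zeta>"
    and eta: "\<And>t w. 0 \<le> t \<Longrightarrow> w \<in> space P \<Longrightarrow>
      \<eta> t w = Bmat A0 *v \<eta> t w + Gam A0 *v \<xi> t w + \<zeta> t w"
    and X1: "\<And>t w. 0 \<le> t \<Longrightarrow> w \<in> space P \<Longrightarrow> X1 t w = Lam1 A0 *v \<xi> t w + \<delta> t w"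
    and X2: "\<And>t w. 0 \<le> t \<Longrightarrow> w \<in> space P \<Longrightarrow> X2 t w = Lam2 A0 *v \<eta> t w + \<epsilon> t w"
    and X: "\<And>t w. 0 \<le> t \<Longrightarrow> w \<in> space P \<Longrightarrow> X t w = vec_append (X1 t w) (X2 t w)"
    and true_admissible: "admissible A0"
    and T: "T > 0"
    and Theta: "convex \<Theta>" "compact \<Theta>" "locally_lipschitz_boundary \<Theta>"
    and model_admissible: "\<And>\<theta>. \<theta> \<in> \<Theta> \<Longrightarrow> admissible (A \<theta>)"
    and Sig: "Sig = (\<lambda>\<theta>. sem_cov (A \<theta>))"
    and smooth: "\<exists>U. open U \<and> \<Theta> \<subseteq> U \<and> Ck_on 3 U Sig"
    and prior: "\<And>n. n \<ge> 1 \<Longrightarrow> prior_density \<Theta> (\<pi> n)"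
    and theta0: "\<theta>0 \<in> interior \<Theta>" "sem_cov A0 = Sig \<theta>0"
    and qmle_measurable: "\<And>n. n \<ge> 1 \<Longrightarrow> \<theta>hat n \<in> borel_measurable P"
    and qmle: "\<And>n w. n \<ge> 1 \<Longrightarrow> w \<in> space P \<Longrightarrow> \<theta>hat n w \<in> \<Theta> \<and>
      quasi_lik X T Sig n w (\<theta>hat n w) = (SUP \<theta>\<in>\<Theta>. quasi_lik X T Sig n w \<theta>)"
    and A: "cond_A P B1 \<xi>" "cond_A P B2 \<delta>" "cond_A P B3 \<epsilon>" "cond_A P B4 \<zeta>"
    and B: "cond_B \<Theta> \<theta>0 \<pi>"
    and C1: "cond_C1 \<Theta> Sig \<theta>0"
    and prior_qmle: "op_one P (\<lambda>n w. elog (\<pi> n (\<theta>hat n w)) - elog (\<pi> n \<theta>0))"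
    and H: "H = quasi_loglik X T Sig"
    and J: "J = (\<lambda>n. {w \<in> space P.
      pos_def (- (1 / real n) *\<^sub>R hessian (H n w) (\<theta>hat n w))})"
  shows "op_one P (\<lambda>n w. indicator (J n) w *
    (elog (LINT \<theta>:\<Theta>|lborel. exp (H n w \<theta>) * \<pi> n \<theta>)
     - (ereal (H n w (\<theta>hat n w))
        + ereal (real CARD('q) / 2 * ln (2 * pi))
        - ereal (1 / 2) * elog (det (- hessian (H n w) (\<theta>hat n w)))
        + elog (\<pi> n (\<theta>hat n w)))))"
proof -
  interpret prob_space P by (rule stochastic_basisD(1)[OF basis])
  define Q where "Q = realized_cov X T"
  define g0 where "g0 = (\<lambda>\<theta>. - (1 / 2) * ln (det (Sig \<theta>)))"
  define g where "g = (\<lambda>\<theta>. (- (1 / 2)) *\<^sub>R matrix_inv (Sig \<theta>))"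
  have th0: "\<theta>0 \<in> \<Theta>" using theta0(1) interior_subset by blast
  have det_pos: "det (Sig \<theta>) > 0" if "\<theta> \<in> \<Theta>" for \<theta>
    unfolding Sig using pos_def_imp_det_pos[OF pos_def_sem_cov[OF model_admissible[OF that]]] .
  obtain U0 where U0: "open U0" "\<Theta> \<subseteq> U0" "Ck_on 3 U0 Sig" using smooth by blast
  \<comment> \<open>\<open>U0\<close> may contain parameters with degenerate covariance; restricting
    to positive determinant keeps the log-determinant and the inverse smooth on an open set around
    \<open>\<Theta>\<close>.\<close>
  define U where "U = U0 \<inter> (\<lambda>\<theta>. det (Sig \<theta>)) -` {0<..}"
  have Sig2: "Ck_on 2 U0 Sig" using U0(3) Ck_on_SucD[of 2 U0 Sig] by (simp only: eval_nat_numeral)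
  have U: "open U" "\<Theta> \<subseteq> U" "U \<subseteq> U0"
  proof -
    have "continuous_on U0 (\<lambda>\<theta>. det (Sig \<theta>))"
      by (intro Ck_on_imp_continuous_on[of 2] Ck_on_det[OF U0(1)] Ck_on_matrix_entry[OF U0(1) Sig2])
    then show "open U" unfolding U_def using U0(1) by (intro continuous_open_preimage) auto
    show "\<Theta> \<subseteq> U" using U0(2) det_pos by (auto simp: U_def)
    show "U \<subseteq> U0" by (auto simp: U_def)
  qed
  have detU: "det (Sig \<theta>) > 0" if "\<theta> \<in> U" for \<theta> using that by (simp add: U_def)
  have SigU: "Ck_on 2 U Sig" by (rule Ck_on_subset[OF Sig2 U(3)])
  have Cg0: "Ck_on 2 U g0"
    unfolding g0_def
    by (intro Ck_on_mult[OF U(1)] Ck_on_const Ck_on_ln[OF U(1) detU] Ck_on_det[OF U(1)] Ck_on_matrix_entry[OF U(1) SigU])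
  have detU0: "det (Sig \<theta>) \<noteq> 0" if "\<theta> \<in> U" for \<theta> using detU[OF that] by simp
  have Cg: "Ck_on 2 U g"
    unfolding g_def
    by (intro Ck_on_linear[OF U(1) bounded_linear_scaleR_right] Ck_on_matrix_inv[OF U(1) SigU detU0])
  obtain \<kappa> where \<kappa>: "\<kappa> > 0" "\<And>\<theta>. \<theta> \<in> \<Theta> \<Longrightarrow> contrast_Y Sig \<theta>0 \<theta> \<le> - \<kappa> * (norm (\<theta> - \<theta>0))\<^sup>2"
    using C1 unfolding cond_C1_def by blast
  interpret quadratic_contrast \<Theta> U g0 g \<theta>0 "sem_cov A0" \<kappa>
  proof
    fix \<theta> assume th: "\<theta> \<in> \<Theta>"
    \<comment> \<open>At the true covariance the difference of contrasts is exactly the function in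
      [C1](a).\<close>
    have "(g0 \<theta> + sem_cov A0 \<bullet> g \<theta>) - (g0 \<theta>0 + sem_cov A0 \<bullet> g \<theta>0) = contrast_Y Sig \<theta>0 \<theta>"
      unfolding contrast_Y_def mat_dot_eq_inner theta0(2) g0_def g_def
      using det_pos[OF th] det_pos[OF th0] by (simp add: ln_div inner_diff_left inner_diff_right inner_commute field_simps)
    then show "(g0 \<theta> + sem_cov A0 \<bullet> g \<theta>) - (g0 \<theta>0 + sem_cov A0 \<bullet> g \<theta>0) \<le> - \<kappa> * (norm (\<theta> - \<theta>0))\<^sup>2"
      using \<kappa>(2)[OF th] by simp
  qed (fact U Theta theta0(1) Cg0 Cg \<kappa>(1))+

  have Hf: "H n w \<theta> = real n * f (Q n w) \<theta>" if "n \<ge> 1" "\<theta> \<in> U" for n w \<theta>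
    unfolding H f_def unfolding g0_def g_def Q_def by (rule quasi_loglik_eq[where Sig = Sig, OF that(1) T detU[OF that(2)]])
  have Hhess: "hessian (H n w) \<theta> = real n *\<^sub>R hessian (f (Q n w)) \<theta>" if "n \<ge> 1" "\<theta> \<in> U" for n w \<theta>
    by (rule hessian_scaled_on_open[OF U(1) that(2) Ck_on_f]) (rule Hf[OF that(1)])
  have hat: "\<theta>hat n w \<in> \<Theta>" if "n \<ge> 1" "w \<in> space P" for n w using qmle[OF that] by blast
  have maximal: "f (Q n w) \<theta> \<le> f (Q n w) (\<theta>hat n w)" if n: "n \<ge> 1" and w: "w \<in> space P" and th: "\<theta> \<in> \<Theta>" for n w \<theta>
  proof -
    define c where "c = (2 * pi * (T / real n)) powr (real n * real CARD('p1 + 'p2) / 2)"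
    have c: "c > 0" using T n by (simp add: c_def)
    have ql: "quasi_lik X T Sig n w \<theta> = exp (real n * f (Q n w) \<theta>) / c" if "\<theta> \<in> \<Theta>" for \<theta>
      using quasi_lik_exp[where Sig = Sig and \<theta> = \<theta> and X = X and w = w, OF n T det_pos[OF that]] c
      unfolding c_def f_def unfolding g0_def g_def Q_def by (simp add: field_simps)
    have "continuous_on \<Theta> (\<lambda>\<theta>. exp (real n * f (Q n w) \<theta>) / c)"
      using c by (intro continuous_intros continuous_on_subset[OF Ck_on_imp_continuous_on[OF Ck_on_f] U(2)]) auto
    then have "bounded ((\<lambda>\<theta>. exp (real n * f (Q n w) \<theta>) / c) ` \<Theta>)"
      by (intro compact_imp_bounded compact_continuous_image Theta(2))
    \<comment> \<open>The supremum in the definition of the estimator is a real one, hence an upper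
      bound once the likelihood is known to be bounded on \<open>\<Theta>\<close>.\<close>
    then have "bdd_above (quasi_lik X T Sig n w ` \<Theta>)"
      using bounded_imp_bdd_above by (simp add: ql cong: image_cong)
    then have "quasi_lik X T Sig n w \<theta> \<le> quasi_lik X T Sig n w (\<theta>hat n w)"
      using qmle[OF n w] th by (simp add: cSUP_upper)
    then have "real n * f (Q n w) \<theta> \<le> real n * f (Q n w) (\<theta>hat n w)"
      unfolding ql[OF th] ql[OF hat[OF n w]] using c by (simp add: divide_le_cancel)
    then show ?thesis using n by simp
  qed

  have proc_meas: "Z t \<in> borel_measurable P" if "sde_solution P F b S W c Z" "0 \<le> t"
    for b S W c and Z :: "real \<Rightarrow> 'w \<Rightarrow> real^'dim" and t
    using that measurable_from_subalg[OF stochastic_basisD(3)[OF basis that(2)]] unfolding sde_solution_def by blast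
  have Xmap: "X t w = sem_map A0 (\<xi> t w, \<delta> t w, \<epsilon> t w, \<zeta> t w)" if t: "0 \<le> t" and w: "w \<in> space P" for t w
  proof -
    have inv: "matrix_inv (Psi A0) ** Psi A0 = mat 1"
      using true_admissible by (intro matrix_mult_matrix_inv) (simp add: admissible_def)
    \<comment> \<open>\<eta> is given implicitly: moving its \<open>Bmat\<close> term to the left
      gives Psi \<eta> = Gam \<xi> + \<zeta>, which the inverse of \<open>Psi\<close>
      solves.\<close>
    have "Psi A0 *v \<eta> t w = \<eta> t w - Bmat A0 *v \<eta> t w"
      by (simp add: Psi_def matrix_vector_mult_diff_rdistrib)
    also have "\<dots> = Gam A0 *v \<xi> t w + \<zeta> t w"
      using eta[OF t w] by (metis add.assoc add_diff_cancel_left')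
    finally have "matrix_inv (Psi A0) *v (Gam A0 *v \<xi> t w + \<zeta> t w) = (matrix_inv (Psi A0) ** Psi A0) *v \<eta> t w"
      by (simp add: matrix_vector_mul_assoc[symmetric])
    then have "\<eta> t w = matrix_inv (Psi A0) *v (Gam A0 *v \<xi> t w + \<zeta> t w)" by (simp add: inv)
    then show ?thesis by (simp add: X[OF t w] X1[OF t w] X2[OF t w] sem_map_def)
  qed
  have Xm: "X t \<in> borel_measurable P" if t: "0 \<le> t" for t
  proof -
    have [measurable]: "\<xi> t \<in> borel_measurable P" "\<delta> t \<in> borel_measurable P" "\<epsilon> t \<in> borel_measurable P" "\<zeta> t \<in> borel_measurable P"
      using proc_meas[OF sde_xi t] proc_meas[OF sde_delta t] proc_meas[OF sde_eps t] proc_meas[OF sde_zeta t] .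
    have "continuous_on UNIV (sem_map A0)"
      by (rule linear_continuous_on) (rule linear_conv_bounded_linear[THEN iffD1, OF linear_sem_map])
    then have [measurable]: "sem_map A0 \<in> borel_measurable borel" by (rule borel_measurable_continuous_onI)
    have "(\<lambda>w. sem_map A0 (\<xi> t w, \<delta> t w, \<epsilon> t w, \<zeta> t w)) \<in> borel_measurable P"
      by (rule measurable_compose[of _ _ borel]) (intro borel_measurable_Pair, measurable)
    also have "?this \<longleftrightarrow> ?thesis" by (rule measurable_cong) (simp add: Xmap[OF t])
    finally show ?thesis .
  qed
  have Qm: "Q n \<in> borel_measurable P" for n
    unfolding Q_def by (rule borel_measurable_realized_cov[OF T Xm])
  have tight: "\<exists>L. \<forall>n\<ge>1. prob {w \<in> space P. sqrt (real n) * norm (Q n w - sem_cov A0) > L} \<le> e" if e: "e > 0" for e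
  proof -
    let ?W = "\<lambda>t w. vec_append (W1 t w) (vec_append (W2 t w) (vec_append (W3 t w) (W4 t w)))"
    have std: "std_increments P ?W" by (rule independent_processes4_std_increments[OF basis wiener indep])
    have lip: "\<exists>L. L-lipschitz_on UNIV B1" "\<exists>L. L-lipschitz_on UNIV B2" "\<exists>L. L-lipschitz_on UNIV B3" "\<exists>L. L-lipschitz_on UNIV B4"
      using A by (simp_all add: cond_A_def)
    have rem: "lipschitz_remainder P T X (sem_load A0) ?W"
      by (rule sem_map_remainder[OF sde_solution_lipschitz_remainder[OF sde_xi lip(1)]
          sde_solution_lipschitz_remainder[OF sde_delta lip(2)]
          sde_solution_lipschitz_remainder[OF sde_eps lip(3)]
          sde_solution_lipschitz_remainder[OF sde_zeta lip(4)] Xmap])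
    show ?thesis
      using realized_covariance_tight[OF prob_space_axioms T std Xm rem e] unfolding sem_load_cov Q_def .
  qed

  define I where "I = (\<lambda>n w. LINT \<theta>:\<Theta>|lborel. exp (H n w \<theta>) * \<pi> n \<theta>)"
  have If: "I n w = evidence (\<pi> n) n (Q n w)" if "n \<ge> 1" for n w
    unfolding I_def evidence_def set_lebesgue_integral_def
    by (rule Bochner_Integration.integral_cong) (use Hf[OF that] U(2) in \<open>auto simp: indicator_def\<close>)
  define V where "V = (\<lambda>n w. indicator (J n) w * (elog (I n w) - (ereal (H n w (\<theta>hat n w))
        + ereal (real CARD('q) / 2 * ln (2 * pi))
        - ereal (1 / 2) * elog (det (- hessian (H n w) (\<theta>hat n w)))
        + elog (\<pi> n (\<theta>hat n w)))))"
  define D where "D = (\<lambda>n w. elog (\<pi> n (\<theta>hat n w)) - elog (\<pi> n \<theta>0))"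
  have hatU: "\<theta>hat n w \<in> U" if "n \<ge> 1" "w \<in> space P" for n w using hat[OF that] U(2) by blast
  have Jf: "w \<in> J n \<longleftrightarrow> pos_def (- hessian (f (Q n w)) (\<theta>hat n w))" if "n \<ge> 1" "w \<in> space P" for n w
    using that unfolding J by (simp add: Hhess[OF that(1) hatU[OF that]])

  \<comment> \<open>\<open>op_one\<close> includes measurability, so the event, the integral, the
    determinant and the prior at the estimator all have to be measurable in the sample
    point.\<close>
  have Vm: "V n \<in> borel_measurable P" if n: "n \<ge> 1" for n
  proof -
    have tm: "\<theta>hat n \<in> borel_measurable P" by (rule qmle_measurable[OF n])
    have pm: "(\<lambda>\<theta>. indicator \<Theta> \<theta> *\<^sub>R \<pi> n \<theta>) \<in> borel_measurable borel"
      using prior[OF n] unfolding prior_density_def set_integrable_def by auto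
    have hm: "(\<lambda>w. hessian (f (Q n w)) (\<theta>hat n w)) \<in> borel_measurable P"
      by (rule borel_measurable_hessian[OF Qm tm hat[OF n]])
    have [measurable]: "I n \<in> borel_measurable P"
      using borel_measurable_evidence[OF Qm pm, of n] by (simp add: If[OF n, abs_def])
    have [measurable]: "(\<lambda>w. \<pi> n (\<theta>hat n w)) \<in> borel_measurable P"
      by (rule borel_measurable_compose_on[OF pm tm hat[OF n]])
    have "(\<lambda>w. real n * f (Q n w) (\<theta>hat n w)) \<in> borel_measurable P"
      by (intro borel_measurable_times borel_measurable_const borel_measurable_f[OF Qm tm hat[OF n]])
    also have "?this \<longleftrightarrow> (\<lambda>w. H n w (\<theta>hat n w)) \<in> borel_measurable P"
      by (rule measurable_cong) (simp add: Hf[OF n hatU[OF n]])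
    finally have [measurable]: "(\<lambda>w. H n w (\<theta>hat n w)) \<in> borel_measurable P" .
    have "continuous_on UNIV (\<lambda>M::real^'q^'q. det (- (real n *\<^sub>R M)))"
      unfolding det_def by (intro continuous_intros)
    then have "(\<lambda>w. det (- (real n *\<^sub>R hessian (f (Q n w)) (\<theta>hat n w)))) \<in> borel_measurable P"
      using measurable_compose[OF hm borel_measurable_continuous_onI] by blast
    also have "?this \<longleftrightarrow> (\<lambda>w. det (- hessian (H n w) (\<theta>hat n w))) \<in> borel_measurable P"
      by (rule measurable_cong) (simp add: Hhess[OF n hatU[OF n]])
    finally have [measurable]: "(\<lambda>w. det (- hessian (H n w) (\<theta>hat n w))) \<in> borel_measurable P" .
    have "(\<lambda>w. - hessian (f (Q n w)) (\<theta>hat n w)) -` {M. pos_def M} \<inter> space P \<in> events"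
      using hm by (intro measurable_sets[OF _ pos_def_sets_borel] borel_measurable_uminus)
    also have "(\<lambda>w. - hessian (f (Q n w)) (\<theta>hat n w)) -` {M. pos_def M} \<inter> space P = J n"
      using Jf[OF n] by (auto simp: J)
    finally have [measurable]: "J n \<in> events" .
    show ?thesis unfolding V_def by measurable
  qed

  \<comment> \<open>Deterministic form of the claim: half of e is the Laplace error, the other half
    pays for replacing \<pi>(\<theta>0) by the prior at the estimator.\<close>
  have small: "\<exists>n0\<ge>1. \<forall>n\<ge>n0. \<forall>w\<in>space P. sqrt (real n) * norm (Q n w - sem_cov A0) \<le> L \<longrightarrow>
      \<bar>D n w\<bar> \<le> ereal (e / 2) \<longrightarrow> \<bar>V n w\<bar> \<le> ereal e" if e: "e > 0" for e L
  proof -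
    have e2: "e / 2 > 0" using e by simp
    obtain n1 where n1: "\<And>n Q t. n \<ge> n1 \<Longrightarrow> sqrt (real n) * norm (Q - sem_cov A0) \<le> L \<Longrightarrow> t \<in> \<Theta> \<Longrightarrow>
      (\<And>\<theta>. \<theta> \<in> \<Theta> \<Longrightarrow> f Q \<theta> \<le> f Q t) \<Longrightarrow> transpose (hessian (f Q) t) = hessian (f Q) t \<Longrightarrow>
      evidence (\<pi> n) n Q > 0 \<and> det (- (real n *\<^sub>R hessian (f Q) t)) > 0 \<and> \<bar>laplace_error (\<pi> n) n Q t\<bar> < e / 2"
      using laplace_uniform[OF B prior e2] by blast
    show ?thesis
    proof (intro exI[of _ "max n1 1"] conjI allI ballI impI)
      fix n w assume n: "max n1 1 \<le> n" and w: "w \<in> space P"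
        and L: "sqrt (real n) * norm (Q n w - sem_cov A0) \<le> L" and D: "\<bar>D n w\<bar> \<le> ereal (e / 2)"
      have n': "n \<ge> n1" "n \<ge> 1" using n by auto
      show "\<bar>V n w\<bar> \<le> ereal e"
      proof (cases "w \<in> J n")
        \<comment> \<open>Off the event the factor is 0, and 0 times an infinite value is 0 in
          \<open>ereal\<close>.\<close>
        case False
        then show ?thesis using e by (simp add: V_def)
      next
        case True
        let ?t = "\<theta>hat n w" and ?Q = "Q n w"
        have "transpose (- hessian (f ?Q) ?t) = - hessian (f ?Q) ?t"
          using True unfolding Jf[OF n'(2) w] pos_def_def by blast
        then have sym: "transpose (hessian (f ?Q) ?t) = hessian (f ?Q) ?t"
          by (simp add: transpose_def vec_eq_iff)
        have Ipos: "I n w > 0" and dpos: "det (- hessian (H n w) ?t) > 0"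
          and R: "\<bar>ln (I n w) - (H n w ?t + real CARD('q) / 2 * ln (2 * pi)
            - 1 / 2 * ln (det (- hessian (H n w) ?t)) + ln (\<pi> n \<theta>0))\<bar> < e / 2"
          using n1[OF n'(1) L hat[OF n'(2) w] maximal[OF n'(2) w] sym]
          unfolding laplace_error_def If[OF n'(2)] Hhess[OF n'(2) hatU[OF n'(2) w]] Hf[OF n'(2) hatU[OF n'(2) w]] by blast+
        have p0: "\<pi> n \<theta>0 > 0" using B n'(2) unfolding cond_B_def by (meson less_le_trans)
        \<comment> \<open>If the prior vanished at the estimator, \<open>elog\<close> would be
          -\<infinity> and \<open>D\<close> infinite, against its bound; so the logarithm is finite
          here.\<close>
        have phat: "\<pi> n ?t > 0" and Dr: "\<bar>ln (\<pi> n ?t) - ln (\<pi> n \<theta>0)\<bar> \<le> e / 2"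
          using D p0 by (auto simp: D_def elog_def split: if_splits)
        have "V n w = ereal (ln (I n w) - (H n w ?t + real CARD('q) / 2 * ln (2 * pi)
            - 1 / 2 * ln (det (- hessian (H n w) ?t)) + ln (\<pi> n ?t)))"
          unfolding V_def elog_def using True Ipos dpos phat by simp
        moreover have "\<bar>ln (I n w) - (H n w ?t + real CARD('q) / 2 * ln (2 * pi)
            - 1 / 2 * ln (det (- hessian (H n w) ?t)) + ln (\<pi> n ?t))\<bar> \<le> e"
          using R Dr by linarith
        ultimately show ?thesis by simp
      qed
    qed simp
  qed

  have "op_one P V"
    unfolding op_one_def
  proof (intro conjI allI impI)
    show "\<forall>\<^sub>F n in sequentially. V n \<in> borel_measurable P"
      using eventually_ge_at_top[of 1] by eventually_elim (rule Vm)
    fix e :: real assume e: "e > 0"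
    have e2: "e / 2 > 0" using e by simp
    have Dlim: "(\<lambda>n. prob {w \<in> space P. \<bar>D n w\<bar> > ereal (e / 2)}) \<longlonglongrightarrow> 0"
      and Dm: "\<forall>\<^sub>F n in sequentially. D n \<in> borel_measurable P"
      using prior_qmle e2 unfolding op_one_def D_def by blast+
    show "(\<lambda>n. prob {w \<in> space P. \<bar>V n w\<bar> > ereal e}) \<longlonglongrightarrow> 0"
    proof (rule tendstoI)
      fix r :: real assume r: "r > 0"
      then have r2: "r / 2 > 0" by simp
      \<comment> \<open>Half of r is spent on tightness of the statistic, the other half on the
        hypothesis about the prior.\<close>
      obtain L where L: "\<And>n. n \<ge> 1 \<Longrightarrow> prob {w \<in> space P. sqrt (real n) * norm (Q n w - sem_cov A0) > L} \<le> r / 2"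
        using tight[OF r2] by blast
      obtain n0 where n0: "n0 \<ge> 1" "\<And>n w. n \<ge> n0 \<Longrightarrow> w \<in> space P \<Longrightarrow>
          sqrt (real n) * norm (Q n w - sem_cov A0) \<le> L \<Longrightarrow> \<bar>D n w\<bar> \<le> ereal (e / 2) \<Longrightarrow> \<bar>V n w\<bar> \<le> ereal e"
        using small[OF e, of L] by blast
      have Dr: "\<forall>\<^sub>F n in sequentially. prob {w \<in> space P. \<bar>D n w\<bar> > ereal (e / 2)} < r / 2"
        by (rule order_tendstoD(2)[OF Dlim r2])
      show "\<forall>\<^sub>F n in sequentially. dist (prob {w \<in> space P. \<bar>V n w\<bar> > ereal e}) 0 < r"
        using Dr Dm eventually_ge_at_top[of n0]
      proof eventually_elim
        case (elim n)
        note [measurable] = elim(2) Qm[of n]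
        let ?A = "{w \<in> space P. sqrt (real n) * norm (Q n w - sem_cov A0) > L}"
        let ?B = "{w \<in> space P. \<bar>D n w\<bar> > ereal (e / 2)}"
        have A: "?A \<in> events" and B': "?B \<in> events" by measurable
        have "{w \<in> space P. \<bar>V n w\<bar> > ereal e} \<subseteq> ?A \<union> ?B"
        proof
          fix w assume w: "w \<in> {w \<in> space P. \<bar>V n w\<bar> > ereal e}"
          show "w \<in> ?A \<union> ?B"
          proof (rule ccontr)
            assume "w \<notin> ?A \<union> ?B"
            then have "\<bar>V n w\<bar> \<le> ereal e" using w by (intro n0(2) elim(3)) auto
            then show False using w by auto
          qed
        qed
        then have "prob {w \<in> space P. \<bar>V n w\<bar> > ereal e} \<le> prob (?A \<union> ?B)"
          using A B' by (intro finite_measure_mono) auto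
        also have "\<dots> \<le> prob ?A + prob ?B" by (rule measure_Un_le[OF A B'])
        also have "\<dots> < r / 2 + r / 2"
          using L[of n] n0(1) elim(1,3) by (intro add_le_less_mono) auto
        finally show ?case by simp
      qed
    qed
  qed
  then show ?thesis unfolding V_def I_def .
qed

end
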